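(* Let $\mathsf{k}$ be a field, $E$ a sandpile graph and $(E,\omega)$ the balanced weighted graph associated with $E$. Then the following lattices are isomorphic to each other: (1) the lattice $\mathrm{Idem}(\mathrm{SP}(E))$ of all idempotents of $\mathrm{SP}(E)$; (2) the lattice $\mathcal{F}_E$ of all filters of $\mathcal{C}_E$; (3) the lattice $\mathcal{H}_E$ of all nonempty saturated hereditary subsets of $E^0$; (4) the lattice $\mathcal{L}(\mathrm{SP}(E))$ of all order-ideals of $\mathrm{SP}(E)$; (5) the lattice $\mathcal{L}_{\mathrm{gr}}(L_{\mathsf{k}}(E))$ of all nonzero graded ideals of $L_{\mathsf{k}}(E)$; (6) the lattice $\mathcal{L}_{\mathrm{ver}}(L_{\mathsf{k}}(E,\omega))$ of all ideals of $L_{\mathsf{k}}(E,\omega)$ generated by (nonempty sets of) vertices.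
   Context: Graphs are directed: $E=(E^0,E^1,s,r)$ with source and range maps $s,r:E^1\to E^0$. A sink is a vertex emitting no edges; a vertex is regular if it is not a sink and emits only finitely many edges; $E^0_{\mathrm{reg}}$ is the set of regular vertices. Vertices are paths of length $0$. A cycle is a closed path $e_1\cdots e_n$ ($n\ge 1$) with $s(e_i)\ne s(e_j)$ for $i\neq j$. A sandpile graph is a finite directed graph with a unique sink (also denoted $s$) such that from every vertex there is a path to $s$. Its sandpile monoid is the commutative monoid $$\mathrm{SP}(E)=\langle v\mid v\in E^0\rangle\big/\big\langle s=0;\ |s^{-1}(v)|\,v=\textstyle\sum_{e\in s^{-1}(v)}r(e)\ \text{for all } v\in E^0\setminus\{s\}\big\rangle,$$ the quotient of the free commutative monoid on $E^0$ by the congruence generated by these relations. For a commutative monoid $M$, put $x\le y$ iff $y=x+m$ for some $m\in M$. $\mathrm{Idem}(M)$ is the set of idempotents; for finite $M$, $(\mathrm{Idem}(M),\le)$ is a lattice with $m\vee m'=m+m'$ and $m\wedge m'=\sum_{x\le m,m'}x$ (sum over idempotents $x$). An order-ideal of $M$ is a submonoid $I$ such that $x+y\in I$ implies $x,y\in I$; $\mathcal{L}(M)$ is the lattice of order-ideals under inclusion. $H\subseteq E^0$ is hereditary if $s(e)\in H$ implies $r(e)\in H$ for all $e\in E^1$; it is saturated if $v\in E^0_{\mathrm{reg}}$ and $r(s^{-1}(v))\subseteq H$ imply $v\in H$. $\overline{H}$ is the smallest hereditary saturated subset containing $H$. $\mathcal{H}_E$ is ordered by inclusion, with $H\vee H'=\overline{H\cup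 H'}$, $H\wedge H'=H\cap H'$. $\mathcal{C}_E$ is the set of strongly connected cyclic components of $E$ (strongly connected components containing a cycle), partially ordered by $C\le C'$ iff there is a path from $C$ to $C'$. A filter of a poset $P$ is a (possibly empty) subset $F$ such that $x\in F$, $x\le y$ imply $y\in F$; $\mathcal{F}_E$ is the lattice of filters of $\mathcal{C}_E$ under union and intersection. A weighted graph is a graph with a map $\omega:E^1\to\{1,2,\dots\}$; for a regular vertex $v$, $\omega(v)=\max\{\omega(e)\mid e\in s^{-1}(v)\}$. The balanced weighted graph associated with $E$ is $(E,\omega)$ with $\omega(e)=|s^{-1}(v)|$ for all $v\in E^0_{\mathrm{reg}}$ and $e\in s^{-1}(v)$. For a row-finite weighted graph $(E,\omega)$ (each vertex emits finitely many edges), the weighted Leavitt path algebra $L_{\mathsf{k}}(E,\omega)$ is the $\mathsf{k}$-algebra generated by $\{v,e_i,e_i^*\mid v\in E^0,e\in E^1,1\le i\le\omega(e)\}$ subject to: (i) $uv=\delta_{uv}u$ for $u,v\in E^0$; (ii) $s(e)e_i=e_i=e_ir(e)$, $r(e)e_i^*=e_i^*=e_i^*s(e)$; (iii) $\sum_{e\in s^{-1}(v)}e_ie_j^*=\delta_{ij}v$ for $v\in E^0_{\mathrm{reg}}$, $1\le i,j\le\omega(v)$; (iv) $\sum_{1\le i\le\omega(v)}e_i^*f_i=\delta_{ef}r(e)$ for $v\in E^0_{\mathrm{reg}}$, $e,f\in s^{-1}(v)$; where $e_i,e_i^*$ are set to $0$ if $i>\omega(e)$. The Leavitt path algebra $L_{\mathsf{k}}(E)$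 is the case where all weights are $1$. It is $\mathbb{Z}$-graded by $\deg v=0$, $\deg e=1$, $\deg e^*=-1$. The sets in (5) and (6) are ordered by inclusion. *)

theory Defs
  imports
    "Graph_Theory.Digraph_Component"
    "HOL-Algebra.Divisibility"
    "HOL-Algebra.Ideal"
    "HOL-Algebra.Lattice"
    "HOL-Library.Multiset"
    "HOL-Library.Poly_Mapping"
begin

section \<open>Lattices\<close>

text \<open>
  A lattice is a poset in which any two elements have a join and a meet, so the lattices below are
  given by their carrier and order; \<open>lattice\<close> is the HOL-Algebra locale.
\<close>

definition order_of :: "'a set \<Rightarrow> ('a \<Rightarrow> 'a \<Rightarrow> bool) \<Rightarrow> 'a gorder" where
  "order_of A r = \<lparr>carrier = A, eq = (=), le = r\<rparr>"

definition lattice_isomorphic :: "'a gorder \<Rightarrow> 'b gorder \<Rightarrow> bool" (infix \<open>\<cong>\<^sub>l\<close> 50) where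
  "L \<cong>\<^sub>l M \<longleftrightarrow> lattice L \<and> lattice M \<and>
     (\<exists>h. bij_betw h (carrier L) (carrier M) \<and>
        (\<forall>x\<in>carrier L. \<forall>y\<in>carrier L.
           h (x \<squnion>\<^bsub>L\<^esub> y) = h x \<squnion>\<^bsub>M\<^esub> h y \<and> h (x \<sqinter>\<^bsub>L\<^esub> y) = h x \<sqinter>\<^bsub>M\<^esub> h y))"

lemma lattice_isomorphic_sym:
  assumes "L \<cong>\<^sub>l M" shows "M \<cong>\<^sub>l L"
proof -
  obtain h where L: "lattice L" and M: "lattice M" and h: "bij_betw h (carrier L) (carrier M)"
    and hom: "\<And>x y. x \<in> carrier L \<Longrightarrow> y \<in> carrier L \<Longrightarrow>
       h (x \<squnion>\<^bsub>L\<^esub> y) = h x \<squnion>\<^bsub>M\<^esub> h y \<and> h (x \<sqinter>\<^bsub>L\<^esub> y) = h x \<sqinter>\<^bsub>M\<^esub> h y"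
    using assms unfolding lattice_isomorphic_def by blast
  interpret L: lattice L by (fact L)
  let ?g = "inv_into (carrier L) h"
  have g: "bij_betw ?g (carrier M) (carrier L)" using h by (rule bij_betw_inv_into)
  have "?g (x \<squnion>\<^bsub>M\<^esub> y) = ?g x \<squnion>\<^bsub>L\<^esub> ?g y \<and> ?g (x \<sqinter>\<^bsub>M\<^esub> y) = ?g x \<sqinter>\<^bsub>L\<^esub> ?g y"
    if "x \<in> carrier M" "y \<in> carrier M" for x y
  proof -
    have c: "?g x \<in> carrier L" "?g y \<in> carrier L" using g that by (auto dest: bij_betwE)
    have e: "h (?g x) = x" "h (?g y) = y"
      using h that by (simp_all add: bij_betw_inv_into_right)
    show ?thesis
      using hom[OF c] c e h bij_betw_inv_into_left[OF h] L.join_closed[OF c] L.meet_closed[OF c]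
      by metis
  qed
  then show ?thesis unfolding lattice_isomorphic_def using L M g by blast
qed

lemma lattice_isomorphic_trans:
  assumes "K \<cong>\<^sub>l L" "L \<cong>\<^sub>l M" shows "K \<cong>\<^sub>l M"
proof -
  obtain f where K: "lattice K" and f: "bij_betw f (carrier K) (carrier L)"
    and homf: "\<forall>x\<in>carrier K. \<forall>y\<in>carrier K.
       f (x \<squnion>\<^bsub>K\<^esub> y) = f x \<squnion>\<^bsub>L\<^esub> f y \<and> f (x \<sqinter>\<^bsub>K\<^esub> y) = f x \<sqinter>\<^bsub>L\<^esub> f y"
    using assms(1) unfolding lattice_isomorphic_def by blast
  obtain g where M: "lattice M" and g: "bij_betw g (carrier L) (carrier M)"
    and homg: "\<forall>x\<in>carrier L. \<forall>y\<in>carrier L.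
       g (x \<squnion>\<^bsub>L\<^esub> y) = g x \<squnion>\<^bsub>M\<^esub> g y \<and> g (x \<sqinter>\<^bsub>L\<^esub> y) = g x \<sqinter>\<^bsub>M\<^esub> g y"
    using assms(2) unfolding lattice_isomorphic_def by blast
  have "bij_betw (g \<circ> f) (carrier K) (carrier M)" using f g by (rule bij_betw_trans)
  moreover have "\<forall>x\<in>carrier K. \<forall>y\<in>carrier K.
      (g \<circ> f) (x \<squnion>\<^bsub>K\<^esub> y) = (g \<circ> f) x \<squnion>\<^bsub>M\<^esub> (g \<circ> f) y \<and>
      (g \<circ> f) (x \<sqinter>\<^bsub>K\<^esub> y) = (g \<circ> f) x \<sqinter>\<^bsub>M\<^esub> (g \<circ> f) y"
    using homf homg bij_betwE[OF f] by auto
  ultimately show ?thesis unfolding lattice_isomorphic_def using K M by blast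
qed


section \<open>Sandpile graphs\<close>

definition is_sink :: "('v, 'e) pre_digraph \<Rightarrow> 'v \<Rightarrow> bool" where
  "is_sink E v \<longleftrightarrow> v \<in> verts E \<and> out_arcs E v = {}"

definition regular :: "('v, 'e) pre_digraph \<Rightarrow> 'v \<Rightarrow> bool" where
  "regular E v \<longleftrightarrow> v \<in> verts E \<and> \<not> is_sink E v \<and> finite (out_arcs E v)"

locale sandpile_graph = fin_digraph E for E :: "('v, 'e) pre_digraph" +
  assumes unique_sink: "\<exists>!s. is_sink E s"
    and reaches_sink: "\<And>v s. v \<in> verts E \<Longrightarrow> is_sink E s \<Longrightarrow> v \<rightarrow>\<^sup>*\<^bsub>E\<^esub> s"


section \<open>The sandpile monoid\<close>

definition quotient_op :: "('a \<times> 'a) set \<Rightarrow> ('a \<Rightarrow> 'a \<Rightarrow> 'a) \<Rightarrow> 'a set \<Rightarrow> 'a set \<Rightarrow> 'a set" where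
  "quotient_op R f A B = (\<Union>a\<in>A. \<Union>b\<in>B. R `` {f a b})"

text \<open>
  The free commutative monoid on the vertices consists of the multisets of vertices, and
  \<open>sandpile_cong E\<close> is the congruence on it generated by the sandpile relations.
\<close>

definition free_cmonoid :: "('v, 'e) pre_digraph \<Rightarrow> 'v multiset set" where
  "free_cmonoid E = {M. set_mset M \<subseteq> verts E}"

inductive_set sandpile_cong :: "('v, 'e) pre_digraph \<Rightarrow> ('v multiset \<times> 'v multiset) set"
  for E :: "('v, 'e) pre_digraph" where
  sink: "is_sink E s \<Longrightarrow> ({#s#}, {#}) \<in> sandpile_cong E"
| topple: "v \<in> verts E \<Longrightarrow> \<not> is_sink E v \<Longrightarrow>
    (replicate_mset (card (out_arcs E v)) v, image_mset (head E) (mset_set (out_arcs E v)))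
      \<in> sandpile_cong E"
| refl: "M \<in> free_cmonoid E \<Longrightarrow> (M, M) \<in> sandpile_cong E"
| sym: "(M, N) \<in> sandpile_cong E \<Longrightarrow> (N, M) \<in> sandpile_cong E"
| trans: "(M, N) \<in> sandpile_cong E \<Longrightarrow> (N, K) \<in> sandpile_cong E \<Longrightarrow> (M, K) \<in> sandpile_cong E"
| add: "(M, N) \<in> sandpile_cong E \<Longrightarrow> (M', N') \<in> sandpile_cong E \<Longrightarrow>
    (M + M', N + N') \<in> sandpile_cong E"

text \<open>
  HOL-Algebra writes monoids multiplicatively: \<open>\<otimes>\<close> is the addition of SP(E), \<open>\<one>\<close> its zero, and
  \<open>divides\<close> its algebraic preorder.
\<close>

definition sandpile_monoid :: "('v, 'e) pre_digraph \<Rightarrow> 'v multiset set monoid" where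
  "sandpile_monoid E =
     \<lparr>carrier = free_cmonoid E // sandpile_cong E,
      mult = quotient_op (sandpile_cong E) (+),
      one = sandpile_cong E `` {{#}}\<rparr>"

definition idempotents :: "('a, 'b) monoid_scheme \<Rightarrow> 'a set" where
  "idempotents M = {x \<in> carrier M. x \<otimes>\<^bsub>M\<^esub> x = x}"

definition idempotent_lattice :: "('a, 'b) monoid_scheme \<Rightarrow> 'a gorder" where
  "idempotent_lattice M = order_of (idempotents M) (\<lambda>x y. x divides\<^bsub>M\<^esub> y)"

definition order_ideal :: "'a set \<Rightarrow> ('a, 'b) monoid_scheme \<Rightarrow> bool" where
  "order_ideal I M \<longleftrightarrow> submonoid I M \<and>
     (\<forall>x\<in>carrier M. \<forall>y\<in>carrier M. x \<otimes>\<^bsub>M\<^esub> y \<in> I \<longrightarrow> x \<in> I \<and> y \<in> I)"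

definition order_ideal_lattice :: "('a, 'b) monoid_scheme \<Rightarrow> 'a set gorder" where
  "order_ideal_lattice M = order_of {I. order_ideal I M} (\<subseteq>)"


section \<open>Hereditary saturated sets and filters of cyclic components\<close>

definition hereditary :: "('v, 'e) pre_digraph \<Rightarrow> 'v set \<Rightarrow> bool" where
  "hereditary E H \<longleftrightarrow> H \<subseteq> verts E \<and> (\<forall>e\<in>arcs E. tail E e \<in> H \<longrightarrow> head E e \<in> H)"

definition saturated :: "('v, 'e) pre_digraph \<Rightarrow> 'v set \<Rightarrow> bool" where
  "saturated E H \<longleftrightarrow> (\<forall>v. regular E v \<and> head E ` out_arcs E v \<subseteq> H \<longrightarrow> v \<in> H)"

definition hereditary_saturated_lattice :: "('v, 'e) pre_digraph \<Rightarrow> 'v set gorder" where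
  "hereditary_saturated_lattice E =
     order_of {H. hereditary E H \<and> saturated E H \<and> H \<noteq> {}} (\<subseteq>)"

definition cyclic_components :: "('v, 'e) pre_digraph \<Rightarrow> ('v, 'e) pre_digraph set" where
  "cyclic_components E = {C \<in> pre_digraph.sccs E. \<exists>p. pre_digraph.cycle C p}"

definition component_le ::
  "('v, 'e) pre_digraph \<Rightarrow> ('v, 'e) pre_digraph \<Rightarrow> ('v, 'e) pre_digraph \<Rightarrow> bool" where
  "component_le E C C' \<longleftrightarrow> (\<exists>u\<in>verts C. \<exists>v\<in>verts C'. u \<rightarrow>\<^sup>*\<^bsub>E\<^esub> v)"

definition order_filter :: "'a set \<Rightarrow> ('a \<Rightarrow> 'a \<Rightarrow> bool) \<Rightarrow> 'a set \<Rightarrow> bool" where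
  "order_filter P r F \<longleftrightarrow> F \<subseteq> P \<and> (\<forall>x\<in>F. \<forall>y\<in>P. r x y \<longrightarrow> y \<in> F)"

definition filter_lattice :: "('v, 'e) pre_digraph \<Rightarrow> ('v, 'e) pre_digraph set gorder" where
  "filter_lattice E =
     order_of {F. order_filter (cyclic_components E) (component_le E) F} (\<subseteq>)"


section \<open>Weighted Leavitt path algebras\<close>

text \<open>
  Words are wrapped lists, with concatenation as addition, so that the convolution product of
  \<open>Poly_Mapping\<close> makes \<open>'g word \<Rightarrow>\<^sub>0 'k\<close> the free unital \<open>'k\<close>-algebra on \<open>'g\<close>.
\<close>

datatype 'g word = Word (letters: "'g list")

instantiation word :: (type) monoid_add
begin

definition zero_word :: "'a word" where
  "0 = Word []"

definition plus_word :: "'a word \<Rightarrow> 'a word \<Rightarrow> 'a word" where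
  "u + v = Word (letters u @ letters v)"

instance
  by standard (simp_all add: zero_word_def plus_word_def)

end

text \<open>\<open>Edge e i\<close> and \<open>Ghost e i\<close> stand for $e_i$ and $e_i^*$.\<close>

datatype ('v, 'e) gen = Vertex 'v | Edge 'e nat | Ghost 'e nat

definition gens :: "('v, 'e) pre_digraph \<Rightarrow> ('e \<Rightarrow> nat) \<Rightarrow> ('v, 'e) gen set" where
  "gens E \<omega> = Vertex ` verts E
     \<union> {Edge e i | e i. e \<in> arcs E \<and> 1 \<le> i \<and> i \<le> \<omega> e}
     \<union> {Ghost e i | e i. e \<in> arcs E \<and> 1 \<le> i \<and> i \<le> \<omega> e}"

text \<open>
  The value \<open>0\<close> outside \<open>gens E \<omega>\<close> is the convention $e_i = e_i^* = 0$ for $i > \omega(e)$.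
\<close>

definition gen_elem ::
  "('v, 'e) pre_digraph \<Rightarrow> ('e \<Rightarrow> nat) \<Rightarrow> ('v, 'e) gen \<Rightarrow> (('v, 'e) gen word \<Rightarrow>\<^sub>0 'k::field)" where
  "gen_elem E \<omega> g = (if g \<in> gens E \<omega> then Poly_Mapping.single (Word [g]) 1 else 0)"

text \<open>
  Algebras are not assumed unital in the presentation of the weighted Leavitt path algebra: the
  free algebra only involves nonempty words.
\<close>

definition free_algebra ::
  "('v, 'e) pre_digraph \<Rightarrow> ('e \<Rightarrow> nat) \<Rightarrow> (('v, 'e) gen word \<Rightarrow>\<^sub>0 'k::field) set" where
  "free_algebra E \<omega> =
     {x. \<forall>w\<in>Poly_Mapping.keys x. letters w \<noteq> [] \<and> set (letters w) \<subseteq> gens E \<omega>}"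

definition vertex_weight :: "('v, 'e) pre_digraph \<Rightarrow> ('e \<Rightarrow> nat) \<Rightarrow> 'v \<Rightarrow> nat" where
  "vertex_weight E \<omega> v = Max (\<omega> ` out_arcs E v)"

inductive_set relators ::
  "('v, 'e) pre_digraph \<Rightarrow> ('e \<Rightarrow> nat) \<Rightarrow> (('v, 'e) gen word \<Rightarrow>\<^sub>0 'k::field) set"
  for E :: "('v, 'e) pre_digraph" and \<omega> :: "'e \<Rightarrow> nat" where
  vertices: "u \<in> verts E \<Longrightarrow> v \<in> verts E \<Longrightarrow>
    gen_elem E \<omega> (Vertex u) * gen_elem E \<omega> (Vertex v)
      - (if u = v then gen_elem E \<omega> (Vertex u) else 0) \<in> relators E \<omega>"
| tail_edge: "e \<in> arcs E \<Longrightarrow> 1 \<le> i \<Longrightarrow> i \<le> \<omega> e \<Longrightarrow>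
    gen_elem E \<omega> (Vertex (tail E e)) * gen_elem E \<omega> (Edge e i) - gen_elem E \<omega> (Edge e i)
      \<in> relators E \<omega>"
| edge_head: "e \<in> arcs E \<Longrightarrow> 1 \<le> i \<Longrightarrow> i \<le> \<omega> e \<Longrightarrow>
    gen_elem E \<omega> (Edge e i) * gen_elem E \<omega> (Vertex (head E e)) - gen_elem E \<omega> (Edge e i)
      \<in> relators E \<omega>"
| head_ghost: "e \<in> arcs E \<Longrightarrow> 1 \<le> i \<Longrightarrow> i \<le> \<omega> e \<Longrightarrow>
    gen_elem E \<omega> (Vertex (head E e)) * gen_elem E \<omega> (Ghost e i) - gen_elem E \<omega> (Ghost e i)
      \<in> relators E \<omega>"
| ghost_tail: "e \<in> arcs E \<Longrightarrow> 1 \<le> i \<Longrightarrow> i \<le> \<omega> e \<Longrightarrow>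
    gen_elem E \<omega> (Ghost e i) * gen_elem E \<omega> (Vertex (tail E e)) - gen_elem E \<omega> (Ghost e i)
      \<in> relators E \<omega>"
| edge_ghost: "regular E v \<Longrightarrow> i \<in> {1..vertex_weight E \<omega> v} \<Longrightarrow> j \<in> {1..vertex_weight E \<omega> v} \<Longrightarrow>
    (\<Sum>e\<in>out_arcs E v. gen_elem E \<omega> (Edge e i) * gen_elem E \<omega> (Ghost e j))
      - (if i = j then gen_elem E \<omega> (Vertex v) else 0) \<in> relators E \<omega>"
| ghost_edge: "regular E v \<Longrightarrow> e \<in> out_arcs E v \<Longrightarrow> f \<in> out_arcs E v \<Longrightarrow>
    (\<Sum>i\<in>{1..vertex_weight E \<omega> v}. gen_elem E \<omega> (Ghost e i) * gen_elem E \<omega> (Edge f i))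
      - (if e = f then gen_elem E \<omega> (Vertex (head E e)) else 0) \<in> relators E \<omega>"

text \<open>
  The two-sided ideal of the free algebra generated by the relators, as an ideal of a nonunital
  \<open>'k\<close>-algebra; multiplication by \<open>Poly_Mapping.single 0 c\<close> is multiplication by the scalar \<open>c\<close>.
\<close>

inductive_set relator_ideal ::
  "('v, 'e) pre_digraph \<Rightarrow> ('e \<Rightarrow> nat) \<Rightarrow> (('v, 'e) gen word \<Rightarrow>\<^sub>0 'k::field) set"
  for E :: "('v, 'e) pre_digraph" and \<omega> :: "'e \<Rightarrow> nat" where
  relator: "x \<in> relators E \<omega> \<Longrightarrow> x \<in> relator_ideal E \<omega>"
| zero: "0 \<in> relator_ideal E \<omega>"
| add: "x \<in> relator_ideal E \<omega> \<Longrightarrow> y \<in> relator_ideal E \<omega> \<Longrightarrow> x + y \<in> relator_ideal E \<omega>"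
| scale: "x \<in> relator_ideal E \<omega> \<Longrightarrow> Poly_Mapping.single 0 c * x \<in> relator_ideal E \<omega>"
| left_mult: "a \<in> free_algebra E \<omega> \<Longrightarrow> x \<in> relator_ideal E \<omega> \<Longrightarrow> a * x \<in> relator_ideal E \<omega>"
| right_mult: "a \<in> free_algebra E \<omega> \<Longrightarrow> x \<in> relator_ideal E \<omega> \<Longrightarrow> x * a \<in> relator_ideal E \<omega>"

definition leavitt_cong ::
  "('v, 'e) pre_digraph \<Rightarrow> ('e \<Rightarrow> nat) \<Rightarrow>
    ((('v, 'e) gen word \<Rightarrow>\<^sub>0 'k::field) \<times> (('v, 'e) gen word \<Rightarrow>\<^sub>0 'k)) set" where
  "leavitt_cong E \<omega> =
     {(x, y). x \<in> free_algebra E \<omega> \<and> y \<in> free_algebra E \<omega> \<and> x - y \<in> relator_ideal E \<omega>}"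

text \<open>
  For a graph with finitely many vertices, the sum of the vertices is the identity of the algebra.
  Scalars then act through the ring multiplication, so the ring ideals are the algebra ideals.
\<close>

definition weighted_leavitt ::
  "'k::field itself \<Rightarrow> ('v, 'e) pre_digraph \<Rightarrow> ('e \<Rightarrow> nat) \<Rightarrow> (('v, 'e) gen word \<Rightarrow>\<^sub>0 'k) set ring" where
  "weighted_leavitt k E \<omega> =
     \<lparr>carrier = free_algebra E \<omega> // leavitt_cong E \<omega>,
      mult = quotient_op (leavitt_cong E \<omega>) (*),
      one = leavitt_cong E \<omega> `` {\<Sum>v\<in>verts E. gen_elem E \<omega> (Vertex v)},
      ring.zero = leavitt_cong E \<omega> `` {0},
      ring.add = quotient_op (leavitt_cong E \<omega>) (+)\<rparr>"

definition balanced_weight :: "('v, 'e) pre_digraph \<Rightarrow> 'e \<Rightarrow> nat" where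
  "balanced_weight E e = card (out_arcs E (tail E e))"

definition vertex_class ::
  "'k::field itself \<Rightarrow> ('v, 'e) pre_digraph \<Rightarrow> ('e \<Rightarrow> nat) \<Rightarrow> 'v \<Rightarrow>
    (('v, 'e) gen word \<Rightarrow>\<^sub>0 'k) set" where
  "vertex_class k E \<omega> v = leavitt_cong E \<omega> `` {gen_elem E \<omega> (Vertex v)}"

definition vertex_ideal_lattice ::
  "'k::field itself \<Rightarrow> ('v, 'e) pre_digraph \<Rightarrow> ('e \<Rightarrow> nat) \<Rightarrow>
    (('v, 'e) gen word \<Rightarrow>\<^sub>0 'k) set set gorder" where
  "vertex_ideal_lattice k E \<omega> =
     order_of
       {I. \<exists>X. X \<subseteq> verts E \<and> X \<noteq> {} \<and>
          I = Idl\<^bsub>weighted_leavitt k E \<omega>\<^esub> (vertex_class k E \<omega> ` X)}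
       (\<subseteq>)"


section \<open>Graded ideals of Leavitt path algebras\<close>

definition leavitt ::
  "'k::field itself \<Rightarrow> ('v, 'e) pre_digraph \<Rightarrow> (('v, 'e) gen word \<Rightarrow>\<^sub>0 'k) set ring" where
  "leavitt k E = weighted_leavitt k E (\<lambda>_. 1)"

fun gen_degree :: "('v, 'e) gen \<Rightarrow> int" where
  "gen_degree (Vertex v) = 0"
| "gen_degree (Edge e i) = 1"
| "gen_degree (Ghost e i) = - 1"

definition word_degree :: "('v, 'e) gen word \<Rightarrow> int" where
  "word_degree w = (\<Sum>g\<leftarrow>letters w. gen_degree g)"

definition leavitt_component ::
  "'k::field itself \<Rightarrow> ('v, 'e) pre_digraph \<Rightarrow> int \<Rightarrow> (('v, 'e) gen word \<Rightarrow>\<^sub>0 'k) set set" where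
  "leavitt_component k E n =
     {leavitt_cong E (\<lambda>_. 1) `` {x} | x.
        x \<in> free_algebra E (\<lambda>_. 1) \<and> (\<forall>w\<in>Poly_Mapping.keys x. word_degree w = n)}"

text \<open>
  For a ring \<open>R\<close> graded by the components \<open>A n\<close>, an ideal \<open>I\<close> is graded iff it is the sum of the
  subgroups \<open>I \<inter> A n\<close>.
\<close>

definition graded_ideal :: "'a set \<Rightarrow> ('a, 'b) ring_scheme \<Rightarrow> (int \<Rightarrow> 'a set) \<Rightarrow> bool" where
  "graded_ideal I R A \<longleftrightarrow> ideal I R \<and>
     (\<forall>x\<in>I. \<exists>N f. finite N \<and> (\<forall>n\<in>N. f n \<in> I \<inter> A n) \<and> x = (\<Oplus>\<^bsub>R\<^esub>n\<in>N. f n))"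

definition graded_ideal_lattice ::
  "'k::field itself \<Rightarrow> ('v, 'e) pre_digraph \<Rightarrow> (('v, 'e) gen word \<Rightarrow>\<^sub>0 'k) set set gorder" where
  "graded_ideal_lattice k E =
     order_of {I. graded_ideal I (leavitt k E) (leavitt_component k E) \<and> I \<noteq> {\<zero>\<^bsub>leavitt k E\<^esub>}} (\<subseteq>)"


section \<open>Well-definedness\<close>

text \<open>
  The quotients above really are a commutative monoid and, for finite graphs, a ring with identity.
  The latter matters because the HOL-Algebra locale \<open>ideal\<close> includes \<open>ring\<close>.
\<close>

lemma quotient_op_class:
  assumes "equiv A R" and "\<And>x x' y y'. (x, x') \<in> R \<Longrightarrow> (y, y') \<in> R \<Longrightarrow> (f x y, f x' y') \<in> R"
    and "x \<in> A" "y \<in> A"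
  shows "quotient_op R f (R `` {x}) (R `` {y}) = R `` {f x y}"
proof -
  have "congruent2 R R (\<lambda>a b. R `` {f a b})"
    unfolding congruent2_def using assms(1,2) by (auto intro!: equiv_class_eq)
  then show ?thesis
    unfolding quotient_op_def using UN_equiv_class2[OF assms(1,1) _ assms(3,4)] by blast
qed

lemma sandpile_cong_subset:
  assumes "fin_digraph E" and "(M, N) \<in> sandpile_cong E"
  shows "M \<in> free_cmonoid E \<and> N \<in> free_cmonoid E"
proof -
  interpret fin_digraph E by fact
  show ?thesis using assms(2)
    by induction (auto simp: free_cmonoid_def is_sink_def out_arcs_def split: if_splits)
qed

lemma equiv_sandpile_cong: "fin_digraph E \<Longrightarrow> equiv (free_cmonoid E) (sandpile_cong E)"
  by (intro equivI refl_onI symI transI subsetI)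
    (auto dest: sandpile_cong_subset intro: sandpile_cong.intros)

lemma comm_monoid_sandpile_monoid:
  assumes "fin_digraph E"
  shows "comm_monoid (sandpile_monoid E)"
proof -
  note eq = equiv_sandpile_cong[OF assms]
  note op = quotient_op_class[OF eq sandpile_cong.add]
  have cl: "M + N \<in> free_cmonoid E" if "M \<in> free_cmonoid E" "N \<in> free_cmonoid E" for M N
    using that by (auto simp: free_cmonoid_def)
  have z: "{#} \<in> free_cmonoid E" by (simp add: free_cmonoid_def)
  show ?thesis
    unfolding sandpile_monoid_def
    by (rule comm_monoidI)
      (auto elim!: quotientE simp: op cl z add_ac intro!: quotientI)
qed

lemma free_algebra_zero: "0 \<in> free_algebra E \<omega>"
  by (simp add: free_algebra_def)

lemma free_algebra_add: "x \<in> free_algebra E \<omega> \<Longrightarrow> y \<in> free_algebra E \<omega> \<Longrightarrow> x + y \<in> free_algebra E \<omega>"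
  using Poly_Mapping.keys_add[of x y] by (auto simp: free_algebra_def)

lemma free_algebra_uminus: "x \<in> free_algebra E \<omega> \<Longrightarrow> - x \<in> free_algebra E \<omega>"
  by (simp add: free_algebra_def)

lemma free_algebra_mult: "x \<in> free_algebra E \<omega> \<Longrightarrow> y \<in> free_algebra E \<omega> \<Longrightarrow> x * y \<in> free_algebra E \<omega>"
  using keys_mult[of x y] by (fastforce simp: free_algebra_def plus_word_def)

lemma free_algebra_sum: "(\<And>i. i \<in> A \<Longrightarrow> f i \<in> free_algebra E \<omega>) \<Longrightarrow> sum f A \<in> free_algebra E \<omega>"
  by (induction A rule: infinite_finite_induct) (simp_all add: free_algebra_zero free_algebra_add)

lemma free_algebra_gen: "gen_elem E \<omega> g \<in> free_algebra E \<omega>"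
  by (simp add: gen_elem_def free_algebra_def)

lemma free_algebra_single:
  "letters w \<noteq> [] \<Longrightarrow> set (letters w) \<subseteq> gens E \<omega> \<Longrightarrow> Poly_Mapping.single w c \<in> free_algebra E \<omega>"
  by (simp add: free_algebra_def)

lemma relator_ideal_uminus: "x \<in> relator_ideal E \<omega> \<Longrightarrow> - x \<in> relator_ideal E \<omega>"
proof -
  assume "x \<in> relator_ideal E \<omega>"
  then have "Poly_Mapping.single 0 (-1) * x \<in> relator_ideal E \<omega>" by (rule relator_ideal.scale)
  also have "Poly_Mapping.single 0 (-1) * x = - x"
    by (metis mult_minus_left mult_1 single_one single_uminus)
  finally show ?thesis .
qed

lemma relator_ideal_diff:
  "x \<in> relator_ideal E \<omega> \<Longrightarrow> y \<in> relator_ideal E \<omega> \<Longrightarrow> x - y \<in> relator_ideal E \<omega>"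
  using relator_ideal.add[OF _ relator_ideal_uminus] by fastforce

lemma relator_ideal_sum: "(\<And>i. i \<in> A \<Longrightarrow> f i \<in> relator_ideal E \<omega>) \<Longrightarrow> sum f A \<in> relator_ideal E \<omega>"
  by (induction A rule: infinite_finite_induct) (simp_all add: relator_ideal.intros)

lemma equiv_leavitt_cong: "equiv (free_algebra E \<omega>) (leavitt_cong E \<omega>)"
proof (intro equivI refl_onI symI transI subsetI)
  fix x y z :: "('a, 'b) gen word \<Rightarrow>\<^sub>0 'c"
  assume "(x, y) \<in> leavitt_cong E \<omega>"
  then show "(y, x) \<in> leavitt_cong E \<omega>"
    using relator_ideal_uminus[of "x - y" E \<omega>] by (simp add: leavitt_cong_def)
  assume "(y, z) \<in> leavitt_cong E \<omega>"
  with \<open>(x, y) \<in> leavitt_cong E \<omega>\<close> show "(x, z) \<in> leavitt_cong E \<omega>"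
    using relator_ideal.add[of "x - y" E \<omega> "y - z"] by (simp add: leavitt_cong_def)
qed (auto simp: leavitt_cong_def relator_ideal.zero)

lemma leavitt_cong_add:
  "(x, x') \<in> leavitt_cong E \<omega> \<Longrightarrow> (y, y') \<in> leavitt_cong E \<omega> \<Longrightarrow> (x + y, x' + y') \<in> leavitt_cong E \<omega>"
  using relator_ideal.add[of "x - x'" E \<omega> "y - y'"]
  by (simp add: leavitt_cong_def free_algebra_add algebra_simps)

lemma leavitt_cong_mult:
  "(x, x') \<in> leavitt_cong E \<omega> \<Longrightarrow> (y, y') \<in> leavitt_cong E \<omega> \<Longrightarrow> (x * y, x' * y') \<in> leavitt_cong E \<omega>"
  using relator_ideal.add[OF relator_ideal.left_mult[of x E \<omega> "y - y'"]
      relator_ideal.right_mult[of y' E \<omega> "x - x'"]]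
  by (simp add: leavitt_cong_def free_algebra_mult algebra_simps)

lemma sum_singles:
  fixes x :: "'g word \<Rightarrow>\<^sub>0 'k::field"
  shows "x = (\<Sum>w\<in>Poly_Mapping.keys x. Poly_Mapping.single 0 (Poly_Mapping.lookup x w) * Poly_Mapping.single w 1)"
proof (rule poly_mapping_eqI)
  fix k
  show "Poly_Mapping.lookup x k = Poly_Mapping.lookup (\<Sum>w\<in>Poly_Mapping.keys x. Poly_Mapping.single 0 (Poly_Mapping.lookup x w) * Poly_Mapping.single w 1) k"
    by (simp add: mult_single lookup_sum lookup_single when_def in_keys_iff)
qed

lemma scalar_commute:
  fixes x :: "'g word \<Rightarrow>\<^sub>0 'k::field"
  shows "x * Poly_Mapping.single 0 c = Poly_Mapping.single 0 c * x"
  by (subst (1 2) sum_singles[of x])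
    (simp add: sum_distrib_left sum_distrib_right mult_single mult.commute)

definition vertex_sum ::
  "('v, 'e) pre_digraph \<Rightarrow> ('e \<Rightarrow> nat) \<Rightarrow> (('v, 'e) gen word \<Rightarrow>\<^sub>0 'k::field)" where
  "vertex_sum E \<omega> = (\<Sum>v\<in>verts E. gen_elem E \<omega> (Vertex v))"

lemma vertex_sum_free: "vertex_sum E \<omega> \<in> free_algebra E \<omega>"
  unfolding vertex_sum_def by (intro free_algebra_sum free_algebra_gen)

lemma gen_left_vertex:
  assumes "wf_digraph E" "g \<in> gens E \<omega>"
  shows "\<exists>a\<in>verts E. gen_elem E \<omega> (Vertex a) * gen_elem E \<omega> g - gen_elem E \<omega> g \<in> relator_ideal E \<omega>"
proof -
  interpret wf_digraph E by fact
  from assms(2) consider v where "g = Vertex v" "v \<in> verts E"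
    | e i where "g = Edge e i" "e \<in> arcs E" "1 \<le> i" "i \<le> \<omega> e"
    | e i where "g = Ghost e i" "e \<in> arcs E" "1 \<le> i" "i \<le> \<omega> e"
    unfolding gens_def by blast
  then show ?thesis
  proof cases
    case 1 then show ?thesis using relators.vertices[of v E v \<omega>] by (auto intro: relator_ideal.relator)
  next
    case 2 then show ?thesis using relators.tail_edge[of e E i \<omega>] by (auto intro: relator_ideal.relator)
  next
    case 3 then show ?thesis using relators.head_ghost[of e E i \<omega>] by (auto intro: relator_ideal.relator)
  qed
qed

lemma gen_right_vertex:
  assumes "wf_digraph E" "g \<in> gens E \<omega>"
  shows "\<exists>a\<in>verts E. gen_elem E \<omega> g * gen_elem E \<omega> (Vertex a) - gen_elem E \<omega> g \<in> relator_ideal E \<omega>"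
proof -
  interpret wf_digraph E by fact
  from assms(2) consider v where "g = Vertex v" "v \<in> verts E"
    | e i where "g = Edge e i" "e \<in> arcs E" "1 \<le> i" "i \<le> \<omega> e"
    | e i where "g = Ghost e i" "e \<in> arcs E" "1 \<le> i" "i \<le> \<omega> e"
    unfolding gens_def by blast
  then show ?thesis
  proof cases
    case 1 then show ?thesis using relators.vertices[of v E v \<omega>] by (auto intro: relator_ideal.relator)
  next
    case 2 then show ?thesis using relators.edge_head[of e E i \<omega>] by (auto intro: relator_ideal.relator)
  next
    case 3 then show ?thesis using relators.ghost_tail[of e E i \<omega>] by (auto intro: relator_ideal.relator)
  qed
qed

lemma vertex_sum_vertex:
  assumes "finite (verts E)" "a \<in> verts E"
  shows "vertex_sum E \<omega> * gen_elem E \<omega> (Vertex a) - gen_elem E \<omega> (Vertex a) \<in> relator_ideal E \<omega>"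
    and "gen_elem E \<omega> (Vertex a) * vertex_sum E \<omega> - gen_elem E \<omega> (Vertex a) \<in> relator_ideal E \<omega>"
proof -
  let ?V = "\<lambda>v. gen_elem E \<omega> (Vertex v)"
  have "vertex_sum E \<omega> * ?V a - ?V a = (\<Sum>v\<in>verts E. ?V v * ?V a - (if v = a then ?V v else 0))"
    unfolding vertex_sum_def using assms by (simp add: sum_distrib_right sum_subtractf)
  also have "\<dots> \<in> relator_ideal E \<omega>"
    using assms by (intro relator_ideal_sum relator_ideal.relator relators.vertices)
  finally show "vertex_sum E \<omega> * ?V a - ?V a \<in> relator_ideal E \<omega>" .
  have "?V a * vertex_sum E \<omega> - ?V a = (\<Sum>v\<in>verts E. ?V a * ?V v - (if a = v then ?V a else 0))"
    unfolding vertex_sum_def using assms by (simp add: sum_distrib_left sum_subtractf)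
  also have "\<dots> \<in> relator_ideal E \<omega>"
    using assms by (intro relator_ideal_sum relator_ideal.relator relators.vertices)
  finally show "?V a * vertex_sum E \<omega> - ?V a \<in> relator_ideal E \<omega>" .
qed

lemma vertex_sum_gen:
  fixes E :: "('a, 'b) pre_digraph"
  assumes "fin_digraph E" "g \<in> gens E \<omega>"
  shows "vertex_sum E \<omega> * (gen_elem E \<omega> g :: ('a, 'b) gen word \<Rightarrow>\<^sub>0 'c::field) - gen_elem E \<omega> g \<in> relator_ideal E \<omega>"
    and "(gen_elem E \<omega> g :: ('a, 'b) gen word \<Rightarrow>\<^sub>0 'c) * vertex_sum E \<omega> - gen_elem E \<omega> g \<in> relator_ideal E \<omega>"
proof -
  interpret fin_digraph E by fact
  let ?V = "\<lambda>v. gen_elem E \<omega> (Vertex v) :: ('a, 'b) gen word \<Rightarrow>\<^sub>0 'c"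
    and ?g = "gen_elem E \<omega> g :: ('a, 'b) gen word \<Rightarrow>\<^sub>0 'c"
    and ?u = "vertex_sum E \<omega> :: ('a, 'b) gen word \<Rightarrow>\<^sub>0 'c"
  obtain a where a: "a \<in> verts E" "?V a * ?g - ?g \<in> relator_ideal E \<omega>"
    using gen_left_vertex[OF wf_digraph assms(2)] by blast
  have "?u * ?g - ?g = (?u * ?V a - ?V a) * ?g - ?u * (?V a * ?g - ?g) + (?V a * ?g - ?g)"
    by (simp add: algebra_simps)
  also have "\<dots> \<in> relator_ideal E \<omega>"
    using relator_ideal.right_mult[OF free_algebra_gen vertex_sum_vertex(1)[OF finite_verts a(1)]]
      relator_ideal.left_mult[OF vertex_sum_free a(2)] a(2)
    by (rule relator_ideal.add[OF relator_ideal_diff])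
  finally show "?u * ?g - ?g \<in> relator_ideal E \<omega>" .
  obtain b where b: "b \<in> verts E" "?g * ?V b - ?g \<in> relator_ideal E \<omega>"
    using gen_right_vertex[OF wf_digraph assms(2)] by blast
  have "?g * ?u - ?g = ?g * (?V b * ?u - ?V b) - (?g * ?V b - ?g) * ?u + (?g * ?V b - ?g)"
    by (simp add: algebra_simps)
  also have "\<dots> \<in> relator_ideal E \<omega>"
    using relator_ideal.left_mult[OF free_algebra_gen vertex_sum_vertex(2)[OF finite_verts b(1)]]
      relator_ideal.right_mult[OF vertex_sum_free b(2)] b(2)
    by (rule relator_ideal.add[OF relator_ideal_diff])
  finally show "?g * ?u - ?g \<in> relator_ideal E \<omega>" .
qed

lemma vertex_sum_word:
  fixes E :: "('a, 'b) pre_digraph"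
  assumes "fin_digraph E" "letters w \<noteq> []" "set (letters w) \<subseteq> gens E \<omega>"
  shows "vertex_sum E \<omega> * Poly_Mapping.single w (1::'c::field) - Poly_Mapping.single w 1 \<in> relator_ideal E \<omega>"
    and "Poly_Mapping.single w (1::'c) * vertex_sum E \<omega> - Poly_Mapping.single w 1 \<in> relator_ideal E \<omega>"
proof -
  let ?u = "vertex_sum E \<omega>"
  obtain g gs where w: "letters w = g # gs" using assms(2) by (cases "letters w") auto
  have s: "Poly_Mapping.single w (1::'c) = gen_elem E \<omega> g * Poly_Mapping.single (Word gs) 1"
    using w assms(3) by (cases w) (simp add: gen_elem_def mult_single plus_word_def)
  have "?u * Poly_Mapping.single w (1::'c) - Poly_Mapping.single w 1 =
     (?u * gen_elem E \<omega> g - gen_elem E \<omega> g) * Poly_Mapping.single (Word gs) 1"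
    unfolding s by (simp add: algebra_simps)
  also have "\<dots> \<in> relator_ideal E \<omega>"
  proof (cases "gs = []")
    case True
    then have "Poly_Mapping.single (Word gs) (1::'c) = 1"
      by (metis single_one zero_word_def)
    then show ?thesis using vertex_sum_gen(1)[OF assms(1), of g \<omega>] w assms(3) by simp
  next
    case False
    then show ?thesis using vertex_sum_gen(1)[OF assms(1), of g \<omega>] w assms(3)
      by (intro relator_ideal.right_mult free_algebra_single) auto
  qed
  finally show "?u * Poly_Mapping.single w (1::'c) - Poly_Mapping.single w 1 \<in> relator_ideal E \<omega>" .
  obtain h hs where w: "letters w = hs @ [h]" using assms(2) by (cases "letters w" rule: rev_cases) auto
  have s: "Poly_Mapping.single w (1::'c) = Poly_Mapping.single (Word hs) 1 * gen_elem E \<omega> h"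
    using w assms(3) by (cases w) (simp add: gen_elem_def mult_single plus_word_def)
  have "Poly_Mapping.single w (1::'c) * ?u - Poly_Mapping.single w 1 =
     Poly_Mapping.single (Word hs) 1 * (gen_elem E \<omega> h * ?u - gen_elem E \<omega> h)"
    unfolding s by (simp add: algebra_simps)
  also have "\<dots> \<in> relator_ideal E \<omega>"
  proof (cases "hs = []")
    case True
    then have "Poly_Mapping.single (Word hs) (1::'c) = 1"
      by (metis single_one zero_word_def)
    then show ?thesis using vertex_sum_gen(2)[OF assms(1), of h \<omega>] w assms(3) by simp
  next
    case False
    then show ?thesis using vertex_sum_gen(2)[OF assms(1), of h \<omega>] w assms(3)
      by (intro relator_ideal.left_mult free_algebra_single) auto
  qed
  finally show "Poly_Mapping.single w (1::'c) * ?u - Poly_Mapping.single w 1 \<in> relator_ideal E \<omega>" .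
qed

lemma vertex_sum_unit:
  assumes "fin_digraph E" "x \<in> free_algebra E \<omega>"
  shows "vertex_sum E \<omega> * x - x \<in> relator_ideal E \<omega>" and "x * vertex_sum E \<omega> - x \<in> relator_ideal E \<omega>"
proof -
  let ?u = "vertex_sum E \<omega>" and ?s = "\<lambda>w. Poly_Mapping.single w 1"
    and ?c = "\<lambda>w. Poly_Mapping.single 0 (Poly_Mapping.lookup x w)"
  have c: "?u * (?c w * y) = ?c w * (?u * y)" for w y
    by (metis scalar_commute mult.assoc)
  have w: "letters w \<noteq> [] \<and> set (letters w) \<subseteq> gens E \<omega>" if "w \<in> Poly_Mapping.keys x" for w
    using assms(2) that by (auto simp: free_algebra_def)
  have "?u * x - x = (\<Sum>w\<in>Poly_Mapping.keys x. ?c w * (?u * ?s w - ?s w))"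
    by (subst (1 2) sum_singles[of x]) (simp add: sum_distrib_left sum_subtractf c right_diff_distrib del: mult_single)
  also have "\<dots> \<in> relator_ideal E \<omega>"
    using w by (intro relator_ideal_sum relator_ideal.scale vertex_sum_word(1)[OF assms(1)]) auto
  finally show "?u * x - x \<in> relator_ideal E \<omega>" .
  have "x * ?u - x = (\<Sum>w\<in>Poly_Mapping.keys x. ?c w * (?s w * ?u - ?s w))"
    by (subst (1 2) sum_singles[of x]) (simp add: sum_distrib_right sum_subtractf right_diff_distrib mult.assoc)
  also have "\<dots> \<in> relator_ideal E \<omega>"
    using w by (intro relator_ideal_sum relator_ideal.scale vertex_sum_word(2)[OF assms(1)]) auto
  finally show "x * ?u - x \<in> relator_ideal E \<omega>" .
qed

lemma ring_weighted_leavitt: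
  fixes k :: "'k::field itself"
  assumes "fin_digraph E"
  shows "ring (weighted_leavitt k E \<omega>)"
proof -
  let ?F = "free_algebra E \<omega> :: (('a, 'b) gen word \<Rightarrow>\<^sub>0 'k) set"
  let ?R = "leavitt_cong E \<omega> :: ((('a, 'b) gen word \<Rightarrow>\<^sub>0 'k) \<times> _) set"
  have eq: "equiv ?F ?R" by (rule equiv_leavitt_cong)
  note add = quotient_op_class[OF eq leavitt_cong_add]
  note mul = quotient_op_class[OF eq leavitt_cong_mult]
  note F = free_algebra_zero free_algebra_add free_algebra_mult vertex_sum_free[of E \<omega>]
  have unit: "?R `` {vertex_sum E \<omega> * x} = ?R `` {x}" "?R `` {x * vertex_sum E \<omega>} = ?R `` {x}" if "x \<in> ?F" for x
    using vertex_sum_unit[OF assms that] that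
    by (intro equiv_class_eq[OF eq]; simp add: leavitt_cong_def F)+
  have inv: "\<exists>y\<in>?F // ?R. quotient_op ?R (+) y A = ?R `` {0}" if "A \<in> ?F // ?R" for A
    using that
  proof (rule quotientE)
    fix x assume "A = ?R `` {x}" "x \<in> ?F"
    then show ?thesis
      by (intro bexI[of _ "?R `` {- x}"]) (auto simp: add free_algebra_uminus intro: quotientI)
  qed
  show ?thesis
    unfolding weighted_leavitt_def vertex_sum_def[symmetric]
  proof (rule ringI)
    show "abelian_group \<lparr>carrier = ?F // ?R, mult = quotient_op ?R (*), one = ?R `` {vertex_sum E \<omega>},
        ring.zero = ?R `` {0}, ring.add = quotient_op ?R (+)\<rparr>"
      using inv by (intro abelian_groupI)
        (auto elim!: quotientE simp: add F add_ac intro!: quotientI)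
    show "monoid \<lparr>carrier = ?F // ?R, mult = quotient_op ?R (*), one = ?R `` {vertex_sum E \<omega>},
        ring.zero = ?R `` {0}, ring.add = quotient_op ?R (+)\<rparr>"
      by (rule monoidI) (auto elim!: quotientE simp: mul F unit mult.assoc intro!: quotientI)
  qed (auto elim!: quotientE simp: add mul F distrib_left distrib_right)
qed

end

(* Every lattice is compared with the nonempty hereditary saturated subsets H of the vertices.

   A subset H is recovered from the cyclic components it contains: a vertex outside H has a successor
   outside H, hence reaches a cycle outside H. This gives (2).

   Both sides of each sandpile relation are supported in H or neither is, so the classes supported in
   H form an order-ideal, and every order-ideal arises in this way. The monoid is finite because
   toppling decreases a positive potential, and in a finite commutative monoid every order-ideal
   consists of the divisors of a unique idempotent. This gives (1) and (4).

   The vertices of an ideal of a (weighted) Leavitt path algebra form a hereditary saturated set. That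
   the ideal generated by H contains no other vertices is seen on a module with basis (V - H) x N, on
   which the generators act through bijections {1..w(v)} x N -> {e in s^-1(v) | r(e) notin H} x N.
   This gives (6). For (5), let x be homogeneous in a graded ideal I. If q is a real path that is long
   or ends at the sink, then x q is a combination of real paths of one length. Left multiplication by
   ghost edges extracts the coefficients, so that the vertices of I already generate x q, and x is the
   sum of the elements (x q) q* over all such q of a fixed length or ending earlier at the sink. *)

theory Submission
  imports Defs
begin

section \<open>Order isomorphisms\<close>

text \<open>Only the filters are shown to form a lattice directly, being closed under unions and
  intersections; a union of saturated sets need not be saturated. All other lattice structures are
  transported along order isomorphisms.

  Ideals of the quotient algebras are handled through their preimages in the free algebra, so that
  identities are checked on representatives modulo the relators.

  The obstacle to a module on which exactly the vertices of H vanish is dimension: relations (iii)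
  and (iv) at v identify the \<omega>(v)-fold sum of the space at v with the sum of the spaces at
  the ranges of its edges, and finite dimensions need not match. The factor N removes this
  constraint and leaves only nonemptiness to check.

  In (5) a ghost edge is cancelled by a real edge to its right, which is why elements are first
  multiplied on the right by real paths. A path ending at the sink cannot be prolonged, but there a
  ghost edge without partner meets the sink vertex, and the product is 0.\<close>

lemma least_Upper_order_of:
  "x \<in> A \<Longrightarrow> y \<in> A \<Longrightarrow> least (order_of A r) l (Upper (order_of A r) {x, y}) \<longleftrightarrow>
    l \<in> A \<and> r x l \<and> r y l \<and> (\<forall>z\<in>A. r x z \<and> r y z \<longrightarrow> r l z)"
  unfolding least_def Upper_def order_of_def by auto

lemma greatest_Lower_order_of:
  "x \<in> A \<Longrightarrow> y \<in> A \<Longrightarrow> greatest (order_of A r) l (Lower (order_of A r) {x, y}) \<longleftrightarrow>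
    l \<in> A \<and> r l x \<and> r l y \<and> (\<forall>z\<in>A. r z x \<and> r z y \<longrightarrow> r z l)"
  unfolding greatest_def Lower_def order_of_def by auto

text \<open>Joins and meets are determined by the order, so a bijection that preserves and reflects
  it carries them across. Only the source has to be known as a lattice; the target becomes one on
  the way.\<close>

lemma lattice_isomorphic_orderI:
  assumes L: "lattice (order_of A r)"
    and h: "bij_betw h A B"
    and le: "\<And>x y. x \<in> A \<Longrightarrow> y \<in> A \<Longrightarrow> r x y \<longleftrightarrow> s (h x) (h y)"
  shows "order_of A r \<cong>\<^sub>l order_of B s"
proof -
  let ?L = "order_of A r" and ?M = "order_of B s"
  interpret L: lattice ?L by (fact L)
  have [simp]: "carrier ?L = A" "carrier ?M = B" "le ?L = r" "le ?M = s" "eq ?L = (=)" "eq ?M = (=)"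
    by (simp_all add: order_of_def)
  have hB: "h x \<in> B" if "x \<in> A" for x using h that by (auto dest: bij_betwE)
  have B: "B = h ` A" using h by (simp add: bij_betw_def)
  have surj: "\<exists>x\<in>A. y = h x" if "y \<in> B" for y
    using B that by auto
  have M: "partial_order ?M"
  proof
    fix x y z assume "x \<in> carrier ?M" "y \<in> carrier ?M" "z \<in> carrier ?M"
    then obtain a b c where abc: "a \<in> A" "b \<in> A" "c \<in> A" "x = h a" "y = h b" "z = h c"
      using surj by auto metis
    show "x \<sqsubseteq>\<^bsub>?M\<^esub> x" using abc le[of a a] L.le_refl[of a] by simp
    show "x .=\<^bsub>?M\<^esub> y" if "x \<sqsubseteq>\<^bsub>?M\<^esub> y" "y \<sqsubseteq>\<^bsub>?M\<^esub> x"
      using that abc le[of a b] le[of b a] L.le_antisym[of a b] by auto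
    show "x \<sqsubseteq>\<^bsub>?M\<^esub> z" if "x \<sqsubseteq>\<^bsub>?M\<^esub> y" "y \<sqsubseteq>\<^bsub>?M\<^esub> z"
      using that abc le[of a b] le[of b c] le[of a c] L.le_trans[of a b c] by auto
  qed auto
  have lub: "least ?M (h l) (Upper ?M {h x, h y})"
    if "x \<in> A" "y \<in> A" "least ?L l (Upper ?L {x, y})" for x y l
    using that hB[OF that(1)] hB[OF that(2)]
    by (simp add: least_Upper_order_of) (auto simp: B le[symmetric])
  have glb: "greatest ?M (h l) (Lower ?M {h x, h y})"
    if "x \<in> A" "y \<in> A" "greatest ?L l (Lower ?L {x, y})" for x y l
    using that hB[OF that(1)] hB[OF that(2)]
    by (simp add: greatest_Lower_order_of) (auto simp: B le[symmetric])
  interpret M: partial_order ?M by (fact M)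
  interpret M: lattice ?M
  proof
    fix x y assume "x \<in> carrier ?M" "y \<in> carrier ?M"
    then obtain a b where ab: "a \<in> A" "b \<in> A" "x = h a" "y = h b"
      using surj by auto metis
    show "\<exists>s. least ?M s (Upper ?M {x, y})"
      using lub[OF ab(1,2)] L.sup_of_two_exists[of a b] ab by auto
    show "\<exists>s. greatest ?M s (Lower ?M {x, y})"
      using glb[OF ab(1,2)] L.inf_of_two_exists[of a b] ab by auto
  qed
  have "h (x \<squnion>\<^bsub>?L\<^esub> y) = h x \<squnion>\<^bsub>?M\<^esub> h y" if "x \<in> A" "y \<in> A" for x y
  proof (rule M.least_unique)
    show "least ?M (h (x \<squnion>\<^bsub>?L\<^esub> y)) (Upper ?M {h x, h y})"
      using lub that L.sup_of_two_least by (simp add: join_def)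
    show "least ?M (h x \<squnion>\<^bsub>?M\<^esub> h y) (Upper ?M {h x, h y})"
      using that hB M.sup_of_two_least by (simp add: join_def)
  qed
  moreover have "h (x \<sqinter>\<^bsub>?L\<^esub> y) = h x \<sqinter>\<^bsub>?M\<^esub> h y" if "x \<in> A" "y \<in> A" for x y
  proof (rule M.greatest_unique)
    show "greatest ?M (h (x \<sqinter>\<^bsub>?L\<^esub> y)) (Lower ?M {h x, h y})"
      using glb that L.inf_of_two_greatest by (simp add: meet_def)
    show "greatest ?M (h x \<sqinter>\<^bsub>?M\<^esub> h y) (Lower ?M {h x, h y})"
      using that hB M.inf_of_two_greatest by (simp add: meet_def)
  qed
  ultimately show ?thesis
    unfolding lattice_isomorphic_def using h L M.lattice_axioms by auto
qed


text \<open>For the case where the lattice is known on the target: the inverse bijection reduces it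
  to \<open>lattice_isomorphic_orderI\<close>.\<close>

lemma lattice_isomorphic_orderI':
  assumes L: "lattice (order_of B s)"
    and h: "bij_betw h A B"
    and le: "\<And>x y. x \<in> A \<Longrightarrow> y \<in> A \<Longrightarrow> r x y \<longleftrightarrow> s (h x) (h y)"
  shows "order_of A r \<cong>\<^sub>l order_of B s"
proof (rule lattice_isomorphic_sym)
  note g = bij_betw_inv_into[OF h]
  have "s x y \<longleftrightarrow> r (inv_into A h x) (inv_into A h y)" if "x \<in> B" "y \<in> B" for x y
    using le[of "inv_into A h x" "inv_into A h y"] bij_betwE[OF g] that
    by (simp add: bij_betw_inv_into_right[OF h])
  then show "order_of B s \<cong>\<^sub>l order_of A r"
    by (rule lattice_isomorphic_orderI[OF L g])
qed

section \<open>Ideals of weighted Leavitt path algebras\<close>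

lemma relators_free: "x \<in> relators E \<omega> \<Longrightarrow> x \<in> free_algebra E \<omega>"
proof (induction rule: relators.induct)
qed (simp_all only: diff_conv_add_uminus if_distrib[of uminus]; 
    intro free_algebra_add free_algebra_uminus free_algebra_mult free_algebra_sum free_algebra_gen; 
    simp add: free_algebra_zero free_algebra_uminus free_algebra_gen)+

lemma free_algebra_scale:
  "x \<in> free_algebra E \<omega> \<Longrightarrow> Poly_Mapping.single 0 c * x \<in> free_algebra E \<omega>"
  using keys_mult[of "Poly_Mapping.single 0 c" x] by (fastforce simp: free_algebra_def split: if_splits)

lemma relator_ideal_free: "x \<in> relator_ideal E \<omega> \<Longrightarrow> x \<in> free_algebra E \<omega>"
  by (induction rule: relator_ideal.induct)
    (simp_all add: relators_free free_algebra_zero free_algebra_add free_algebra_mult free_algebra_scale)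

text \<open>These are the preimages in the free algebra of the ideals of the quotient algebra.
  Closure under scalars follows from the unit of the quotient, see \<open>scale\<close>.\<close>

locale algebra_ideal = fin_digraph E for E :: "('v, 'e) pre_digraph" +
  fixes \<omega> :: "'e \<Rightarrow> nat" and U :: "(('v, 'e) gen word \<Rightarrow>\<^sub>0 'k::field) set"
  assumes sub: "U \<subseteq> free_algebra E \<omega>"
    and rel: "relator_ideal E \<omega> \<subseteq> U"
    and add: "x \<in> U \<Longrightarrow> y \<in> U \<Longrightarrow> x + y \<in> U"
    and left: "a \<in> free_algebra E \<omega> \<Longrightarrow> x \<in> U \<Longrightarrow> a * x \<in> U"
    and right: "a \<in> free_algebra E \<omega> \<Longrightarrow> x \<in> U \<Longrightarrow> x * a \<in> U"
begin

text \<open>The scalar \<open>?c\<close> sits on the empty word and so need not lie in the free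
  algebra, but \<open>?c * ?u\<close> does, where \<open>?u\<close> is the sum of the vertices.
  Since \<open>?u * x\<close> equals \<open>x\<close> modulo relators, \<open>(?c * ?u) * x\<close>
  represents \<open>?c * x\<close>.\<close>

lemma scale:
  assumes "x \<in> U" shows "Poly_Mapping.single 0 c * x \<in> U"
proof -
  let ?c = "Poly_Mapping.single 0 c" and ?u = "vertex_sum E \<omega>"
  have "fin_digraph E" by unfold_locales
  then have "Poly_Mapping.single 0 (- 1) * (?c * (?u * x - x)) \<in> relator_ideal E \<omega>"
    using assms sub by (intro relator_ideal.scale vertex_sum_unit(1)) auto
  then have "(?c * ?u) * x + Poly_Mapping.single 0 (- 1) * (?c * (?u * x - x)) \<in> U"
    by (intro add left[OF free_algebra_scale[OF vertex_sum_free] assms] subsetD[OF rel])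
  also have "Poly_Mapping.single 0 (- 1) = (- 1 :: ('v, 'e) gen word \<Rightarrow>\<^sub>0 'k)"
    by (metis single_one single_uminus)
  finally show ?thesis by (simp add: algebra_simps)
qed

lemma uminus: "x \<in> U \<Longrightarrow> - x \<in> U"
proof -
  assume "x \<in> U"
  then have "Poly_Mapping.single 0 (-1) * x \<in> U" by (rule scale)
  then show ?thesis by (metis mult_minus_left mult_1 single_one single_uminus)
qed

lemma diff: "x \<in> U \<Longrightarrow> y \<in> U \<Longrightarrow> x - y \<in> U"
  using add[OF _ uminus] by fastforce

lemma zero: "0 \<in> U"
  using rel relator_ideal.zero by blast

lemma sum: "(\<And>i. i \<in> A \<Longrightarrow> f i \<in> U) \<Longrightarrow> sum f A \<in> U"
  by (induction A rule: infinite_finite_induct) (simp_all add: zero add)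

lemma cong: "x - y \<in> U \<Longrightarrow> x \<in> U \<longleftrightarrow> y \<in> U"
  using add[of "x - y" y] diff[of x "x - y"] by auto

lemma cong_rel: "x - y \<in> relator_ideal E \<omega> \<Longrightarrow> x \<in> U \<longleftrightarrow> y \<in> U"
  using rel by (intro cong) auto

end

lemma algebra_ideal_relator_ideal:
  "fin_digraph E \<Longrightarrow> algebra_ideal E \<omega> (relator_ideal E \<omega> :: (('v, 'e) gen word \<Rightarrow>\<^sub>0 'k::field) set)"
  by (intro algebra_ideal.intro algebra_ideal_axioms.intro)
    (auto intro: relator_ideal.intros relator_ideal_free)

abbreviation leavitt_class ::
  "('v, 'e) pre_digraph \<Rightarrow> ('e \<Rightarrow> nat) \<Rightarrow> (('v, 'e) gen word \<Rightarrow>\<^sub>0 'k::field) \<Rightarrow> _ set" where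
  "leavitt_class E \<omega> x \<equiv> leavitt_cong E \<omega> `` {x}"

section \<open>Correspondence between ideals of the quotient and ideals above the relators\<close>

context fin_digraph
begin

lemma fin_digraph_this: "fin_digraph G" by unfold_locales

lemma class_eq_iff:
  assumes "x \<in> free_algebra G \<omega>" "y \<in> free_algebra G \<omega>"
  shows "leavitt_class G \<omega> x = leavitt_class G \<omega> y \<longleftrightarrow> x - y \<in> relator_ideal G \<omega>"
  using eq_equiv_class_iff[OF equiv_leavitt_cong assms] assms by (simp add: leavitt_cong_def)

context
  fixes k :: "'k::field itself" and \<omega> :: "'b \<Rightarrow> nat"
begin

lemma carrier_weighted_leavitt:
  "carrier (weighted_leavitt k G \<omega>) = leavitt_class G \<omega> ` free_algebra G \<omega>"
  by (auto simp: weighted_leavitt_def quotient_def)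

lemma class_carrier:
  "x \<in> free_algebra G \<omega> \<Longrightarrow> leavitt_class G \<omega> x \<in> carrier (weighted_leavitt k G \<omega>)"
  by (simp add: carrier_weighted_leavitt)

lemma class_zero: "\<zero>\<^bsub>weighted_leavitt k G \<omega>\<^esub> = leavitt_class G \<omega> 0"
  by (simp add: weighted_leavitt_def)

lemma class_add:
  "x \<in> free_algebra G \<omega> \<Longrightarrow> y \<in> free_algebra G \<omega> \<Longrightarrow>
    leavitt_class G \<omega> x \<oplus>\<^bsub>weighted_leavitt k G \<omega>\<^esub> leavitt_class G \<omega> y = leavitt_class G \<omega> (x + y)"
  by (simp add: weighted_leavitt_def quotient_op_class[OF equiv_leavitt_cong leavitt_cong_add])

lemma class_mult:
  "x \<in> free_algebra G \<omega> \<Longrightarrow> y \<in> free_algebra G \<omega> \<Longrightarrow>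
    leavitt_class G \<omega> x \<otimes>\<^bsub>weighted_leavitt k G \<omega>\<^esub> leavitt_class G \<omega> y = leavitt_class G \<omega> (x * y)"
  by (simp add: weighted_leavitt_def quotient_op_class[OF equiv_leavitt_cong leavitt_cong_mult])

lemma ring_leavitt: "ring (weighted_leavitt k G \<omega>)"
  by (rule ring_weighted_leavitt) unfold_locales

lemma class_finsum:
  assumes "finite N" "\<And>n. n \<in> N \<Longrightarrow> f n \<in> free_algebra G \<omega>"
  shows "(\<Oplus>\<^bsub>weighted_leavitt k G \<omega>\<^esub>n\<in>N. leavitt_class G \<omega> (f n)) = leavitt_class G \<omega> (\<Sum>n\<in>N. f n)"
proof -
  interpret L: ring "weighted_leavitt k G \<omega>" by (rule ring_leavitt)
  show ?thesis using assms
    by (induction N) (auto simp: class_zero[symmetric] class_add free_algebra_sum class_carrier)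
qed

definition ideal_lift :: "(('a, 'b) gen word \<Rightarrow>\<^sub>0 'k) set set \<Rightarrow> (('a, 'b) gen word \<Rightarrow>\<^sub>0 'k) set" where
  "ideal_lift I = {x \<in> free_algebra G \<omega>. leavitt_class G \<omega> x \<in> I}"

lemma algebra_ideal_lift:
  assumes "ideal I (weighted_leavitt k G \<omega>)"
  shows "algebra_ideal G \<omega> (ideal_lift I)"
proof -
  interpret I: ideal I "weighted_leavitt k G \<omega>" by fact
  show ?thesis
  proof (intro algebra_ideal.intro algebra_ideal_axioms.intro fin_digraph_this)
    show "relator_ideal G \<omega> \<subseteq> ideal_lift I"
    proof
      fix x :: "('a, 'b) gen word \<Rightarrow>\<^sub>0 'k" assume x: "x \<in> relator_ideal G \<omega>"
      then have "leavitt_class G \<omega> x = leavitt_class G \<omega> 0"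
        by (subst class_eq_iff) (auto simp: relator_ideal_free free_algebra_zero)
      then show "x \<in> ideal_lift I"
        using additive_subgroup.zero_closed[OF I.additive_subgroup_axioms] x unfolding class_zero by (auto simp: ideal_lift_def relator_ideal_free)
    qed
  qed (use I.a_closed I.I_l_closed I.I_r_closed in
      \<open>auto simp: ideal_lift_def free_algebra_add free_algebra_mult class_add[symmetric]
        class_mult[symmetric] class_carrier\<close>)
qed

lemma ideal_class_image:
  assumes "algebra_ideal G \<omega> U"
  shows "ideal (leavitt_class G \<omega> ` U) (weighted_leavitt k G \<omega>)"
proof -
  interpret U: algebra_ideal G \<omega> U by fact
  interpret L: ring "weighted_leavitt k G \<omega>" by (rule ring_leavitt)
  have F: "x \<in> free_algebra G \<omega>" if "x \<in> U" for x using U.sub that by auto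
  show ?thesis
  proof (rule idealI[OF ring_leavitt])
    show "subgroup (leavitt_class G \<omega> ` U) (add_monoid (weighted_leavitt k G \<omega>))"
    proof (rule L.add.subgroupI)
      show "leavitt_class G \<omega> ` U \<subseteq> carrier (weighted_leavitt k G \<omega>)"
        using F by (auto simp: class_carrier)
      show "leavitt_class G \<omega> ` U \<noteq> {}" using U.zero by auto
      fix a assume "a \<in> leavitt_class G \<omega> ` U"
      then obtain x where x: "x \<in> U" "a = leavitt_class G \<omega> x" by auto
      have "\<ominus>\<^bsub>weighted_leavitt k G \<omega>\<^esub> a = leavitt_class G \<omega> (- x)"
        using F[OF x(1)] x(2)
        by (intro L.minus_equality) (auto simp: class_add free_algebra_uminus class_zero class_carrier)
      then show "\<ominus>\<^bsub>weighted_leavitt k G \<omega>\<^esub> a \<in> leavitt_class G \<omega> ` U"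
        using x U.uminus by auto
    qed (use F in \<open>auto simp: class_add intro!: imageI U.add\<close>)
  qed (use F U.left U.right in \<open>auto simp: class_mult carrier_weighted_leavitt\<close>)
qed

lemma class_image_lift:
  "ideal I (weighted_leavitt k G \<omega>) \<Longrightarrow> leavitt_class G \<omega> ` ideal_lift I = I"
  using ideal.Icarr[of I "weighted_leavitt k G \<omega>"]
  by (auto simp: ideal_lift_def carrier_weighted_leavitt image_iff)

text \<open>An ideal above the relators is a union of classes, hence the full preimage of its
  image.\<close>

lemma lift_class_image:
  assumes "algebra_ideal G \<omega> U"
  shows "ideal_lift (leavitt_class G \<omega> ` U) = U"
proof -
  interpret U: algebra_ideal G \<omega> U by fact
  have "x \<in> U" if "x \<in> free_algebra G \<omega>" "y \<in> U" "leavitt_class G \<omega> x = leavitt_class G \<omega> y" for x y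
    using that U.sub class_eq_iff[of x \<omega> y] U.cong_rel[of x y] by auto
  then show ?thesis
    using U.sub unfolding ideal_lift_def by blast
qed

text \<open>The universal property of the generated ideal, moved to the free algebra, where
  membership of generators can be computed.\<close>

lemma idl_subset_iff:
  assumes "X \<subseteq> verts G" "ideal I (weighted_leavitt k G \<omega>)"
  shows "Idl\<^bsub>weighted_leavitt k G \<omega>\<^esub> (vertex_class k G \<omega> ` X) \<subseteq> I \<longleftrightarrow>
    gen_elem G \<omega> ` Vertex ` X \<subseteq> ideal_lift I"
proof -
  interpret L: ring "weighted_leavitt k G \<omega>" by (rule ring_leavitt)
  have "vertex_class k G \<omega> ` X \<subseteq> carrier (weighted_leavitt k G \<omega>)"
    by (auto simp: vertex_class_def class_carrier free_algebra_gen)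
  from L.Idl_subset_ideal[OF assms(2) this] show ?thesis
    by (auto simp: ideal_lift_def vertex_class_def free_algebra_gen)
qed

lemma ideal_idl: "ideal (Idl\<^bsub>weighted_leavitt k G \<omega>\<^esub> (vertex_class k G \<omega> ` X)) (weighted_leavitt k G \<omega>)"
proof -
  interpret L: ring "weighted_leavitt k G \<omega>" by (rule ring_leavitt)
  show ?thesis
    by (intro L.genideal_ideal) (auto simp: vertex_class_def class_carrier free_algebra_gen)
qed

end
end

section \<open>Vertices in ideals\<close>

text \<open>Both algebras of the theorem fall under this locale: weights all 1, and weights equal to
  the out-degree of the source. Equal weights at a vertex make \<open>Ed e i\<close> a genuine
  generator for every \<open>i\<close> from 1 up to the vertex weight.\<close>

locale constant_weight = fin_digraph E for E :: "('v, 'e) pre_digraph" +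
  fixes \<omega> :: "'e \<Rightarrow> nat"
  assumes weight: "e \<in> arcs E \<Longrightarrow> \<omega> e = vertex_weight E \<omega> (tail E e)"
    and weight_pos: "e \<in> arcs E \<Longrightarrow> 1 \<le> \<omega> e"
begin

abbreviation V :: "'v \<Rightarrow> ('v, 'e) gen word \<Rightarrow>\<^sub>0 'k::field" where
  "V v \<equiv> gen_elem E \<omega> (Vertex v)"

abbreviation Ed :: "'e \<Rightarrow> nat \<Rightarrow> ('v, 'e) gen word \<Rightarrow>\<^sub>0 'k::field" where
  "Ed e i \<equiv> gen_elem E \<omega> (Edge e i)"

abbreviation Gh :: "'e \<Rightarrow> nat \<Rightarrow> ('v, 'e) gen word \<Rightarrow>\<^sub>0 'k::field" where
  "Gh e i \<equiv> gen_elem E \<omega> (Ghost e i)"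

lemma regular_iff: "regular E v \<longleftrightarrow> v \<in> verts E \<and> out_arcs E v \<noteq> {}"
  by (auto simp: regular_def is_sink_def finite_out_arcs)

lemma regular_tail: "e \<in> arcs E \<Longrightarrow> regular E (tail E e)"
  by (auto simp: regular_iff out_arcs_def)

text \<open>Relation (iv) with e = f writes the range of e as a sum of terms containing some
  \<open>Ed e i\<close>, which absorbs the source of e on the left. Relation (iii) with i = j = 1
  writes v as a sum of terms containing some \<open>Ed e 1\<close>, which absorbs the range of e on
  the right.\<close>

lemma vertices_ideal_hereditary_saturated:
  assumes "algebra_ideal E \<omega> (U :: (('v, 'e) gen word \<Rightarrow>\<^sub>0 'k::field) set)"
  shows "hereditary E {v \<in> verts E. V v \<in> U}" "saturated E {v \<in> verts E. V v \<in> U}"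
proof -
  interpret U: algebra_ideal E \<omega> U by fact
  show "hereditary E {v \<in> verts E. V v \<in> U}"
    unfolding hereditary_def
  proof (intro conjI ballI impI)
    fix e assume e: "e \<in> arcs E" "tail E e \<in> {v \<in> verts E. V v \<in> U}"
    have "Ed e i \<in> U" if "i \<in> {1..vertex_weight E \<omega> (tail E e)}" for i
    proof -
      have "V (tail E e) * Ed e i - Ed e i \<in> relator_ideal E \<omega>"
        using e that weight by (intro relator_ideal.relator relators.tail_edge) auto
      from U.cong_rel[OF this] show ?thesis using e by (auto simp: U.right free_algebra_gen)
    qed
    then have "(\<Sum>i\<in>{1..vertex_weight E \<omega> (tail E e)}. Gh e i * Ed e i) \<in> U"
      by (intro U.sum U.left free_algebra_gen)
    moreover have "(\<Sum>i\<in>{1..vertex_weight E \<omega> (tail E e)}. Gh e i * Ed e i) - V (head E e) \<in> relator_ideal E \<omega>"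
      using relators.ghost_edge[OF regular_tail[OF e(1)], of e e \<omega>] e(1)
      by (auto intro: relator_ideal.relator)
    ultimately show "head E e \<in> {v \<in> verts E. V v \<in> U}"
      using U.cong_rel e(1) by auto
  qed auto
  show "saturated E {v \<in> verts E. V v \<in> U}"
    unfolding saturated_def
  proof (intro allI impI, elim conjE)
    fix v assume v: "regular E v" "head E ` out_arcs E v \<subseteq> {v \<in> verts E. V v \<in> U}"
    have "Ed e 1 \<in> U" if "e \<in> out_arcs E v" for e
    proof -
      have "Ed e 1 * V (head E e) - Ed e 1 \<in> relator_ideal E \<omega>"
        using that weight_pos by (intro relator_ideal.relator relators.edge_head) auto
      from U.cong_rel[OF this] show ?thesis using v(2) that U.left[OF free_algebra_gen] by blast
    qed
    then have "(\<Sum>e\<in>out_arcs E v. Ed e 1 * Gh e 1) \<in> U"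
      by (intro U.sum U.right free_algebra_gen)
    \<comment> \<open>The index 1 is in the range of relation (iii) because a regular vertex emits
      an edge, whose weight is positive.\<close>
    moreover obtain e where "e \<in> out_arcs E v" using v(1) unfolding regular_iff by blast
    then have "1 \<in> {1..vertex_weight E \<omega> v}"
      using weight[of e] weight_pos[of e] by auto
    then have "(\<Sum>e\<in>out_arcs E v. Ed e 1 * Gh e 1) - V v \<in> relator_ideal E \<omega>"
      using relators.edge_ghost[OF v(1), of 1 \<omega> 1] by (auto intro: relator_ideal.relator)
    ultimately show "v \<in> {v \<in> verts E. V v \<in> U}"
      using U.cong_rel v(1) by (auto simp: regular_iff)
  qed
qed

end

section \<open>A module detecting the vertices outside \<open>H\<close>\<close>

locale shift_module = constant_weight E \<omega> for E :: "('v, 'e) pre_digraph" and \<omega> :: "'e \<Rightarrow> nat" +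
  fixes H :: "'v set" and \<beta> :: "'v \<Rightarrow> nat \<times> nat \<Rightarrow> 'e \<times> nat"
  assumes her: "hereditary E H"
    and bij: "regular E v \<Longrightarrow> v \<notin> H \<Longrightarrow> bij_betw (\<beta> v) ({1..vertex_weight E \<omega> v} \<times> UNIV)
      ({e \<in> out_arcs E v. head E e \<notin> H} \<times> UNIV)"
begin

definition \<gamma> :: "'v \<Rightarrow> 'e \<times> nat \<Rightarrow> nat \<times> nat" where
  "\<gamma> v = inv_into ({1..vertex_weight E \<omega> v} \<times> UNIV) (\<beta> v)"

text \<open>Module elements are arbitrary functions and a generator acts by substituting the
  argument, so no support condition has to be preserved. The result always vanishes over
  \<open>H\<close>, which is how the part of the graph inside \<open>H\<close> is cut away.\<close>

fun gen_act :: "('v, 'e) gen \<Rightarrow> ('v \<times> nat \<Rightarrow> 'k::field) \<Rightarrow> 'v \<times> nat \<Rightarrow> 'k" where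
  "gen_act (Vertex v) f p = (if fst p = v \<and> v \<notin> H then f p else 0)"
| "gen_act (Edge e i) f p = (if fst p = tail E e \<and> fst p \<notin> H \<and> fst (\<beta> (fst p) (i, snd p)) = e
     then f (head E e, snd (\<beta> (fst p) (i, snd p))) else 0)"
| "gen_act (Ghost e i) f p = (if fst p = head E e \<and> fst p \<notin> H \<and> fst (\<gamma> (tail E e) (e, snd p)) = i
     then f (tail E e, snd (\<gamma> (tail E e) (e, snd p))) else 0)"

definition word_act :: "('v, 'e) gen word \<Rightarrow> ('v \<times> nat \<Rightarrow> 'k::field) \<Rightarrow> 'v \<times> nat \<Rightarrow> 'k" where
  "word_act w f = foldr gen_act (letters w) f"

definition act :: "(('v, 'e) gen word \<Rightarrow>\<^sub>0 'k::field) \<Rightarrow> ('v \<times> nat \<Rightarrow> 'k) \<Rightarrow> 'v \<times> nat \<Rightarrow> 'k" where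
  "act x f p = (\<Sum>w\<in>Poly_Mapping.keys x. Poly_Mapping.lookup x w * word_act w f p)"

lemma gen_act_linear:
  "gen_act g (\<lambda>p. \<Sum>i\<in>A. c i * f i p) = (\<lambda>p. \<Sum>i\<in>A. c i * gen_act g (f i) p)"
proof
  fix p :: "'v \<times> nat"
  show "gen_act g (\<lambda>p. \<Sum>i\<in>A. c i * f i p) p = (\<Sum>i\<in>A. c i * gen_act g (f i) p)"
    by (cases p; cases g) (auto intro!: sum.cong sum.neutral)
qed

lemma word_act_linear:
  "word_act w (\<lambda>p. \<Sum>i\<in>A. c i * f i p) = (\<lambda>p. \<Sum>i\<in>A. c i * word_act w (f i) p)"
proof -
  have "foldr gen_act gs (\<lambda>p. \<Sum>i\<in>A. c i * f i p) = (\<lambda>p. \<Sum>i\<in>A. c i * foldr gen_act gs (f i) p)" for gs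
    by (induction gs) (simp_all add: gen_act_linear)
  then show ?thesis by (simp add: word_act_def)
qed

lemma word_act_plus: "word_act (w + u) f = word_act w (word_act u f)"
  by (simp add: word_act_def plus_word_def)

lemma act_superset:
  "finite K \<Longrightarrow> Poly_Mapping.keys x \<subseteq> K \<Longrightarrow>
    act x f p = (\<Sum>w\<in>K. Poly_Mapping.lookup x w * word_act w f p)"
  unfolding act_def by (intro sum.mono_neutral_left) (auto simp: in_keys_iff)

lemma act_add: "act (x + y) f p = act x f p + act y f p"
proof -
  let ?K = "Poly_Mapping.keys x \<union> Poly_Mapping.keys y"
  have "Poly_Mapping.keys (x + y) \<subseteq> ?K" by (rule Poly_Mapping.keys_add)
  then show ?thesis
    by (simp add: act_superset[of ?K] lookup_add distrib_right sum.distrib)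
qed

lemma act_single: "act (Poly_Mapping.single w c) f p = c * word_act w f p"
  by (simp add: act_def)

lemma act_zero [simp]: "act 0 f p = 0"
  by (simp add: act_def)

lemma act_sum: "act (\<Sum>i\<in>A. x i) f p = (\<Sum>i\<in>A. act (x i) f p)"
  by (induction A rule: infinite_finite_induct) (simp_all add: act_add)

lemma act_diff: "act (x - y) f p = act x f p - act y f p"
  using act_add[of "x - y" y f p] by simp

lemma act_mult: "act (x * y) f = act x (act y f)"
proof
  fix p
  have e: "z = (\<Sum>w\<in>Poly_Mapping.keys z. Poly_Mapping.single w (Poly_Mapping.lookup z w))"
    for z :: "('v, 'e) gen word \<Rightarrow>\<^sub>0 'a"
    using sum_singles[of z] by (simp add: mult_single)
  have "act (x * y) f p = (\<Sum>w\<in>Poly_Mapping.keys x. \<Sum>u\<in>Poly_Mapping.keys y.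
      Poly_Mapping.lookup x w * Poly_Mapping.lookup y u * word_act (w + u) f p)"
    by (subst e[of x], subst e[of y]) 
      (simp add: sum_distrib_left sum_distrib_right act_sum mult_single act_single, rule sum.swap)
  also have "\<dots> = (\<Sum>w\<in>Poly_Mapping.keys x. Poly_Mapping.lookup x w *
      word_act w (\<lambda>p. \<Sum>u\<in>Poly_Mapping.keys y. Poly_Mapping.lookup y u * word_act u f p) p)"
    by (simp add: word_act_linear word_act_plus sum_distrib_left mult.assoc)
  also have "\<dots> = act x (act y f) p"
    by (simp add: act_def[abs_def])
  finally show "act (x * y) f p = act x (act y f) p" .
qed

lemma act_gen: "act (gen_elem E \<omega> g) f p = (if g \<in> gens E \<omega> then gen_act g f p else 0)"
  by (simp add: gen_elem_def act_single word_act_def)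

lemma act_zero_right: "act x (\<lambda>_. 0 :: 'k::field) p = 0"
proof -
  have "word_act w (\<lambda>_. 0 :: 'k) = (\<lambda>_. 0)" for w
    using word_act_linear[of w "\<lambda>_. 0 :: 'k" "\<lambda>_ _. 0" "{}"] by simp
  then show ?thesis by (simp add: act_def)
qed

text \<open>In relation (iii), evaluated at (v, n), only the edge e with
  \<open>\<beta> v (i, n) = (e, m)\<close> contributes; in relation (iv), evaluated at (r(e), n),
  only the index i with \<open>\<gamma> v (e, n) = (i, m)\<close>. As \<open>\<gamma>\<close>
  inverts \<open>\<beta>\<close>, the surviving term is the Kronecker delta of the relation.\<close>

lemma act_relator:
  fixes x :: "('v, 'e) gen word \<Rightarrow>\<^sub>0 'k::field"
  assumes "x \<in> relators E \<omega>" shows "act x f p = 0"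
proof -
  obtain u n where p: "p = (u, n)" by (cases p)
  have [simp]: "Edge e i \<in> gens E \<omega> \<longleftrightarrow> e \<in> arcs E \<and> 1 \<le> i \<and> i \<le> vertex_weight E \<omega> (tail E e)"
    "Ghost e i \<in> gens E \<omega> \<longleftrightarrow> e \<in> arcs E \<and> 1 \<le> i \<and> i \<le> vertex_weight E \<omega> (tail E e)"
    "Vertex v \<in> gens E \<omega> \<longleftrightarrow> v \<in> verts E" for e i v
    by (auto simp: gens_def weight)
  \<comment> \<open>Heredity read backwards: whenever the range is outside \<open>H\<close>, so is
    the source, and there \<open>bij\<close> makes \<open>\<gamma> (tail E e)\<close> a true
    inverse.\<close>
  have tail: "tail E e \<notin> H" if "e \<in> arcs E" "head E e \<notin> H" for e
    using that her by (auto simp: hereditary_def)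
  have \<beta>: "fst (\<beta> v (i, m)) \<in> out_arcs E v \<and> head E (fst (\<beta> v (i, m))) \<notin> H \<and> \<gamma> v (\<beta> v (i, m)) = (i, m)"
    if "regular E v" "v \<notin> H" "1 \<le> i" "i \<le> vertex_weight E \<omega> v" for v i m
    using bij_betwE[OF bij[OF that(1,2)]] bij_betw_inv_into_left[OF bij[OF that(1,2)], of "(i, m)"] that
    by (auto simp: \<gamma>_def mem_Times_iff)
  have \<gamma>: "1 \<le> fst (\<gamma> (tail E e) (e, m)) \<and> fst (\<gamma> (tail E e) (e, m)) \<le> vertex_weight E \<omega> (tail E e) \<and>
      \<beta> (tail E e) (\<gamma> (tail E e) (e, m)) = (e, m)"
    if "e \<in> arcs E" "head E e \<notin> H" for e m
  proof -
    note b = bij[OF regular_tail[OF that(1)] tail[OF that]]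
    show ?thesis
      using bij_betwE[OF bij_betw_inv_into[OF b]] bij_betw_inv_into_right[OF b, of "(e, m)"] that
      by (auto simp: \<gamma>_def mem_Times_iff)
  qed
  show ?thesis using assms unfolding p
  proof (cases rule: relators.cases)
    case (tail_edge e i)
    then show "act x f (u, n) = 0"
      using weight[of e] by (auto simp: act_diff act_mult act_gen)
  next
    case (edge_head e i)
    then show "act x f (u, n) = 0"
      using \<beta>[OF regular_tail[of e], of i n] weight[of e] by (auto simp: act_diff act_mult act_gen)
  next
    case (head_ghost e i)
    then show "act x f (u, n) = 0"
      using weight[of e] by (auto simp: act_diff act_mult act_gen)
  next
    case (ghost_tail e i)
    then show "act x f (u, n) = 0"
      using weight[of e] tail[of e] by (auto simp: act_diff act_mult act_gen)
  next
    case (edge_ghost v i j)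
    have "act (\<Sum>e\<in>out_arcs E v. Ed e i * Gh e j) f (u, n) = (if i = j \<and> u = v \<and> v \<notin> H then f (u, n) else 0)"
    proof (cases "u = v \<and> v \<notin> H")
      case True
      let ?e = "fst (\<beta> v (i, n))"
      note b = \<beta>[OF edge_ghost(2), of i n]
      have "act (\<Sum>e\<in>out_arcs E v. Ed e i * Gh e j) f (u, n) = 
        (\<Sum>e\<in>out_arcs E v. if e = ?e then if i = j then f (u, n) else 0 else 0)"
        unfolding act_sum
      proof (rule sum.cong)
        fix e assume "e \<in> out_arcs E v"
        then show "act (Ed e i * Gh e j) f (u, n) = (if e = ?e then if i = j then f (u, n) else 0 else 0)"
          using edge_ghost b True by (auto simp: act_mult act_gen)
      qed simp
      also have "\<dots> = (if i = j then f (u, n) else 0)"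
        using b True edge_ghost by (simp add: finite_out_arcs)
      finally show ?thesis using True by simp
    next
      case False
      then show ?thesis by (auto simp: act_sum act_mult act_gen intro!: sum.neutral)
    qed
    then show "act x f (u, n) = 0"
      using edge_ghost(1,2) unfolding regular_iff
      by (cases "i = j"; cases "u = v") (simp_all add: act_diff act_gen)
  next
    case (ghost_edge v e e')
    have "act (\<Sum>i\<in>{1..vertex_weight E \<omega> v}. Gh e i * Ed e' i) f (u, n) =
      (if e = e' \<and> u = head E e \<and> u \<notin> H then f (u, n) else 0)"
    proof (cases "u = head E e \<and> u \<notin> H")
      case True
      let ?i = "fst (\<gamma> v (e, n))"
      have c: "\<gamma> v (e, n) = (?i, snd (\<gamma> v (e, n)))" by simp
      have t: "tail E e = v" "tail E e' = v" "e \<in> arcs E" "e' \<in> arcs E" using ghost_edge by auto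
      have h: "head E e \<notin> H" using True by blast
      note b = \<gamma>[OF t(3) h, of n, unfolded t] tail[OF t(3) h, unfolded t]
      have "act (\<Sum>i\<in>{1..vertex_weight E \<omega> v}. Gh e i * Ed e' i) f (u, n) =
        (\<Sum>i\<in>{1..vertex_weight E \<omega> v}. if i = ?i then if e = e' then f (u, n) else 0 else 0)"
        unfolding act_sum
        using b True t by (intro sum.cong) (auto simp: act_mult act_gen)
      also have "\<dots> = (if e = e' then f (u, n) else 0)"
        using b True t by simp
      finally show ?thesis using True h by auto
    next
      case False
      then show ?thesis by (auto simp: act_sum act_mult act_gen intro!: sum.neutral)
    qed
    moreover have "head E e \<in> verts E" using ghost_edge by auto
    ultimately show "act x f (u, n) = 0"
      using ghost_edge(1) by (cases "e = e'"; cases "u = head E e") (simp_all add: act_diff act_gen)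
  next
    case (vertices a b)
    then show "act x f (u, n) = 0"
      by (simp add: act_diff act_mult act_gen)
  qed
qed

definition annihilator :: "(('v, 'e) gen word \<Rightarrow>\<^sub>0 'k::field) set" where
  "annihilator = {x \<in> free_algebra E \<omega>. \<forall>f p. act x f p = 0}"

lemma algebra_ideal_annihilator:
  "algebra_ideal E \<omega> (annihilator :: (('v, 'e) gen word \<Rightarrow>\<^sub>0 'k::field) set)"
proof (intro algebra_ideal.intro algebra_ideal_axioms.intro fin_digraph_this)
  have z: "act x f = (\<lambda>_. 0)" if "\<And>f p. act x f p = 0" for x :: "('v, 'e) gen word \<Rightarrow>\<^sub>0 'k" and f
    using that by auto
  show "relator_ideal E \<omega> \<subseteq> (annihilator :: (('v, 'e) gen word \<Rightarrow>\<^sub>0 'k::field) set)"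
  proof
    fix x :: "('v, 'e) gen word \<Rightarrow>\<^sub>0 'k" assume x: "x \<in> relator_ideal E \<omega>"
    then have "act x f = (\<lambda>_. 0)" for f
    proof (induction arbitrary: f rule: relator_ideal.induct)
      case (relator x) then show ?case by (intro z act_relator)
    next
      case (add x y) then show ?case by (intro z) (simp add: act_add)
    qed (rule z, simp add: act_mult act_zero_right)+
    then show "x \<in> annihilator" using x by (simp add: annihilator_def relator_ideal_free)
  qed
  show "a * x \<in> annihilator" "x * a \<in> annihilator"
    if "x \<in> annihilator" "a \<in> free_algebra E \<omega>" for x a :: "('v, 'e) gen word \<Rightarrow>\<^sub>0 'k"
  proof -
    have "act x f = (\<lambda>_. 0)" for f using that unfolding annihilator_def by (intro z) blast
    then show "a * x \<in> annihilator" "x * a \<in> annihilator"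
      using that by (simp_all add: annihilator_def free_algebra_mult act_mult act_zero_right)
  qed
qed (auto simp: annihilator_def free_algebra_add act_add)

lemma vertex_annihilator:
  assumes "v \<in> verts E"
  shows "(V v :: ('v, 'e) gen word \<Rightarrow>\<^sub>0 'k::field) \<in> annihilator \<longleftrightarrow> v \<in> H"
proof -
  have a: "act (V v) f p = gen_act (Vertex v) f p" for f :: "'v \<times> nat \<Rightarrow> 'k" and p
    using assms by (simp add: act_gen gens_def)
  have "act (V v) (\<lambda>_. 1 :: 'k) (v, 0) = 0 \<longleftrightarrow> v \<in> H"
    by (simp add: a)
  moreover have "act (V v) f p = 0" if "v \<in> H" for f :: "'v \<times> nat \<Rightarrow> 'k" and p
    using that by (simp add: a)
  ultimately show ?thesis unfolding annihilator_def using free_algebra_gen by blast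
qed

end

context constant_weight
begin

text \<open>Saturation gives a regular \<open>v\<close> outside \<open>H\<close> an edge whose range
  is outside \<open>H\<close>. Both sides of the required bijection are therefore nonempty before
  the factor \<open>nat\<close>, and countably infinite after it.\<close>

lemma ex_vertex_ideal:
  assumes "hereditary E H" "saturated E H"
  obtains U :: "(('v, 'e) gen word \<Rightarrow>\<^sub>0 'k::field) set"
  where "algebra_ideal E \<omega> U" "\<And>v. v \<in> verts E \<Longrightarrow> V v \<in> U \<longleftrightarrow> v \<in> H"
proof -
  have "\<exists>b. bij_betw b ({1..vertex_weight E \<omega> v} \<times> (UNIV :: nat set))
      ({e \<in> out_arcs E v. head E e \<notin> H} \<times> (UNIV :: nat set))" if v: "regular E v" "v \<notin> H" for v
  proof -
    have fin: "finite (out_arcs E v)" by (rule finite_out_arcs)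
    obtain e where e: "e \<in> out_arcs E v" "head E e \<notin> H"
      using v assms(2) unfolding saturated_def by blast
    then have w: "1 \<in> {1..vertex_weight E \<omega> v}"
      using weight[of e] weight_pos[of e] by auto
    have c: "countable ({1..vertex_weight E \<omega> v} \<times> (UNIV :: nat set))"
        "countable ({e \<in> out_arcs E v. head E e \<notin> H} \<times> (UNIV :: nat set))"
      by (rule countable_SIGMA[OF countable_finite countableI_type], simp add: fin)+
    have "infinite ({1..vertex_weight E \<omega> v} \<times> (UNIV :: nat set))"
      "infinite ({e \<in> out_arcs E v. head E e \<notin> H} \<times> (UNIV :: nat set))"
      using e w by (auto dest!: finite_cartesian_productD2)
    then show ?thesis
      using bij_betw_trans[OF to_nat_on_infinite[OF c(1)] bij_betw_from_nat_into[OF c(2)]] by blast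
  qed
  then have "\<forall>v. \<exists>b. regular E v \<and> v \<notin> H \<longrightarrow>
      bij_betw b ({1..vertex_weight E \<omega> v} \<times> (UNIV :: nat set))
      ({e \<in> out_arcs E v. head E e \<notin> H} \<times> (UNIV :: nat set))" by blast
  from choice[OF this] obtain b where "\<forall>v. regular E v \<and> v \<notin> H \<longrightarrow>
      bij_betw (b v) ({1..vertex_weight E \<omega> v} \<times> (UNIV :: nat set))
      ({e \<in> out_arcs E v. head E e \<notin> H} \<times> (UNIV :: nat set))" by blast
  then interpret shift_module E \<omega> H b
    using assms by unfold_locales auto
  show thesis
    using that[OF algebra_ideal_annihilator vertex_annihilator] .
qed

end

text \<open>Otherwise the simplifier turns the weight function into \<^term>\<open>\<lambda>_. Suc 0\<close>.\<close>

declare One_nat_def [simp del]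

section \<open>Homogeneous elements of Leavitt path algebras\<close>

text \<open>
  Spans modulo the relators. The length is an integer so that stripping a ghost edge needs no side
  condition when \<open>Z\<close> consists of sinks; for negative length only relators remain.
\<close>

inductive path_span ::
  "('v, 'e) pre_digraph \<Rightarrow> 'v set \<Rightarrow> int \<Rightarrow> (('v, 'e) gen word \<Rightarrow>\<^sub>0 'k::field) \<Rightarrow> bool"
  for E :: "('v, 'e) pre_digraph" and Z :: "'v set" where
  vertex: "v \<in> Z \<Longrightarrow> path_span E Z 0 (gen_elem E (\<lambda>_. 1) (Vertex v))"
| edge: "path_span E Z m y \<Longrightarrow> e \<in> arcs E \<Longrightarrow> path_span E Z (m + 1) (gen_elem E (\<lambda>_. 1) (Edge e 1) * y)"
| add: "path_span E Z m x \<Longrightarrow> path_span E Z m y \<Longrightarrow> path_span E Z m (x + y)"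
| scale: "path_span E Z m y \<Longrightarrow> path_span E Z m (Poly_Mapping.single 0 c * y)"
| relator: "y \<in> relator_ideal E (\<lambda>_. 1) \<Longrightarrow> path_span E Z m y"

locale unweighted = fin_digraph E for E :: "('v, 'e) pre_digraph"
begin

lemma out_arcs_empty: "e \<in> arcs E \<Longrightarrow> out_arcs E (tail E e) \<noteq> {}"
  by (auto simp: out_arcs_def)

sublocale constant_weight E "\<lambda>_. 1"
  using out_arcs_empty by unfold_locales (auto simp: vertex_weight_def image_constant_conv)

abbreviation R :: "(('v, 'e) gen word \<Rightarrow>\<^sub>0 'k::field) set" where
  "R \<equiv> relator_ideal E (\<lambda>_. 1)"

abbreviation edge_elem :: "'e \<Rightarrow> ('v, 'e) gen word \<Rightarrow>\<^sub>0 'k::field" where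
  "edge_elem e \<equiv> Ed e 1"

abbreviation ghost_elem :: "'e \<Rightarrow> ('v, 'e) gen word \<Rightarrow>\<^sub>0 'k::field" where
  "ghost_elem e \<equiv> Gh e 1"

lemma vertex_weight_one: "regular E v \<Longrightarrow> vertex_weight E (\<lambda>_. 1) v = 1"
  by (simp add: vertex_weight_def regular_iff image_constant_conv)

interpretation R: algebra_ideal E "\<lambda>_. 1" "R :: (('v, 'e) gen word \<Rightarrow>\<^sub>0 'k::field) set"
  by (rule algebra_ideal_relator_ideal) unfold_locales

lemma R_scale_left:
  fixes x :: "('v, 'e) gen word \<Rightarrow>\<^sub>0 'k::field"
  shows "a * (Poly_Mapping.single 0 c * x) = Poly_Mapping.single 0 c * (a * x)"
  by (metis mult.assoc scalar_commute)

lemma path_span_cong: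
  "path_span E Z m x \<Longrightarrow> y - x \<in> R \<Longrightarrow> path_span E Z m y"
  using path_span.add[OF _ path_span.relator, of E Z m x "y - x"] by simp

lemma path_span_free: "path_span E Z m x \<Longrightarrow> x \<in> free_algebra E (\<lambda>_. 1)"
  by (induction rule: path_span.induct)
    (simp_all add: free_algebra_gen free_algebra_add free_algebra_mult free_algebra_scale relator_ideal_free)

lemma path_span_mono: "path_span E Z m x \<Longrightarrow> Z \<subseteq> Z' \<Longrightarrow> path_span E Z' m x"
  by (induction rule: path_span.induct) (auto intro: path_span.intros)

lemma R_vertices: "u \<in> verts E \<Longrightarrow> v \<in> verts E \<Longrightarrow> V u * V v - (if u = v then V u else 0) \<in> R"
  by (intro relator_ideal.relator relators.vertices)

lemma R_tail: "e \<in> arcs E \<Longrightarrow> V (tail E e) * edge_elem e - edge_elem e \<in> R"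
  by (intro relator_ideal.relator relators.tail_edge) auto

lemma R_head: "e \<in> arcs E \<Longrightarrow> edge_elem e * V (head E e) - edge_elem e \<in> R"
  by (intro relator_ideal.relator relators.edge_head) auto

lemma R_ghost_tail: "e \<in> arcs E \<Longrightarrow> ghost_elem e * V (tail E e) - ghost_elem e \<in> R"
  by (intro relator_ideal.relator relators.ghost_tail) auto

text \<open>Inserting the source: u e = (u s(e)) e modulo relators, and u s(e) vanishes if u
  \<noteq> s(e).\<close>

lemma R_vertex_edge:
  assumes "u \<in> verts E" "e \<in> arcs E"
  shows "V u * edge_elem e - (if u = tail E e then edge_elem e else 0) \<in> R"
proof (cases "u = tail E e")
  case False
  have "(V u * V (tail E e)) * edge_elem e - V u * (V (tail E e) * edge_elem e - edge_elem e) \<in> R"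
    using R.diff[OF R.right[OF free_algebra_gen R_vertices[of u "tail E e"]] R.left[OF free_algebra_gen R_tail[OF assms(2)]]]
      False assms by auto
  then show ?thesis using False by (simp add: algebra_simps)
qed (use R_tail assms in auto)

lemma R_ghost_vertex:
  assumes "u \<in> verts E" "e \<in> arcs E" "u \<noteq> tail E e"
  shows "ghost_elem e * V u \<in> R"
proof -
  have "ghost_elem e * (V (tail E e) * V u) - (ghost_elem e * V (tail E e) - ghost_elem e) * V u \<in> R"
    using R.diff[OF R.left[OF free_algebra_gen R_vertices[of "tail E e" u]] R.right[OF free_algebra_gen R_ghost_tail[OF assms(2)]]]
      assms by auto
  then show ?thesis by (simp add: algebra_simps)
qed

text \<open>Relation (iv) covers edges with a common source; for different sources the vertex s(f)
  is inserted between the two factors and annihilates the ghost.\<close>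

lemma R_ghost_edge:
  assumes "e \<in> arcs E" "f \<in> arcs E"
  shows "ghost_elem e * edge_elem f - (if e = f then V (head E e) else 0) \<in> R"
proof (cases "tail E e = tail E f")
  case True
  then show ?thesis
    using relators.ghost_edge[OF regular_tail[OF assms(1)], of e f "\<lambda>_. 1"] assms
    by (auto intro: relator_ideal.relator simp: vertex_weight_one[OF regular_tail])
next
  case False
  have "ghost_elem e * V (tail E f) * edge_elem f - ghost_elem e * (V (tail E f) * edge_elem f - edge_elem f) \<in> R"
    using R.diff[OF R.right[OF free_algebra_gen R_ghost_vertex[of "tail E f" e]] R.left[OF free_algebra_gen R_tail[OF assms(2)]]]
      False assms by auto
  then show ?thesis using False by (auto simp: algebra_simps)
qed

lemma R_edge_ghost:
  assumes "v \<in> verts E" "\<not> is_sink E v"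
  shows "(\<Sum>e\<in>out_arcs E v. edge_elem e * ghost_elem e) - V v \<in> R"
proof -
  have "regular E v" using assms by (auto simp: regular_def)
  then show ?thesis
    using relators.edge_ghost[of E v 1 "\<lambda>_. 1" 1] 
    by (auto intro: relator_ideal.relator simp: vertex_weight_one)
qed

section \<open>Multiplication of spans of real paths\<close>

lemma path_span_zero: "path_span E Z m 0"
  by (intro path_span.relator relator_ideal.zero)

lemma path_span_vertex_left:
  assumes "path_span E Z m y" "u \<in> verts E" "Z \<subseteq> verts E"
  shows "path_span E Z m (V u * y)"
  using assms(1)
proof induction
  case (vertex v)
  then have "V u * V v - (if u = v then V v else 0) \<in> R"
    using R_vertices[OF assms(2), of v] assms(3) by (auto split: if_splits)
  moreover have "path_span E Z 0 (if u = v then V v else 0)"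
    using vertex by (simp add: path_span.vertex path_span_zero)
  ultimately show ?case by (rule path_span_cong[rotated])
next
  case (edge m y e)
  have "(V u * edge_elem e - (if u = tail E e then edge_elem e else 0)) * y \<in> R"
    using R_vertex_edge[OF assms(2) edge(2)] path_span_free[OF edge(1)] by (rule R.right[rotated])
  moreover have "path_span E Z (m + 1) ((if u = tail E e then edge_elem e else 0) * y)"
    using edge by (simp add: path_span.edge path_span_zero)
  ultimately show ?case
    unfolding left_diff_distrib mult.assoc by (rule path_span_cong[rotated])
next
  case (scale m y c)
  then show ?case by (subst R_scale_left) (rule path_span.scale)
qed (auto simp: distrib_left intro: path_span.intros R.left free_algebra_gen)

text \<open>Only the first edge of a path matters: either it is cancelled or the product vanishes.
  At length 0 there is no edge to cancel; then the vertex is a sink, hence not the source of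
  \<open>e\<close>, and the product is a relator.\<close>

lemma path_span_ghost_left:
  assumes "path_span E Z m y" "e \<in> arcs E" "Z \<subseteq> verts E" "m \<ge> 1 \<or> (\<forall>v\<in>Z. is_sink E v)"
  shows "path_span E Z (m - 1) (ghost_elem e * y)"
  using assms(1,4)
proof induction
  case (vertex v)
  then have "is_sink E v" by auto
  then have "v \<noteq> tail E e" "v \<in> verts E" using assms(2) by (auto simp: is_sink_def)
  then show ?case using R_ghost_vertex[of v e] assms(2) by (intro path_span.relator) auto
next
  case (edge m y f)
  have "(ghost_elem e * edge_elem f - (if e = f then V (head E e) else 0)) * y \<in> R"
    using R_ghost_edge[OF assms(2) edge(2)] path_span_free[OF edge(1)] by (rule R.right[rotated])
  moreover have "path_span E Z m ((if e = f then V (head E e) else 0) * y)"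
    using path_span_vertex_left[OF edge(1) _ assms(3), of "head E e"] assms(2)
    by (cases "e = f") (simp_all add: path_span_zero)
  ultimately have "path_span E Z m (ghost_elem e * (edge_elem f * y))"
    unfolding left_diff_distrib mult.assoc by (rule path_span_cong[rotated])
  then show ?case by simp
next
  case (scale m y c)
  then show ?case by (subst R_scale_left) (rule path_span.scale)
qed (auto simp: distrib_left intro: path_span.intros R.left free_algebra_gen)

lemma path_span_edge_right:
  fixes y :: "('v, 'e) gen word \<Rightarrow>\<^sub>0 'k::field"
  assumes "path_span E (verts E) m y" "f \<in> arcs E"
  shows "path_span E (verts E) (m + 1) (y * edge_elem f)"
  using assms(1)
proof induction
  case (vertex v)
  let ?f = "edge_elem f :: ('v, 'e) gen word \<Rightarrow>\<^sub>0 'k"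
  have "path_span E (verts E) (0 + 1) (?f * V (head E f))"
    using assms(2) by (intro path_span.intros) auto
  then have "path_span E (verts E) (0 + 1) ?f"
    by (rule path_span_cong) (use R.uminus[OF R_head[OF assms(2)]] in simp)
  then have "path_span E (verts E) (0 + 1) (if v = tail E f then ?f else 0)"
    by (simp add: path_span_zero)
  then show ?case
    using R_vertex_edge[OF vertex assms(2)] by (rule path_span_cong)
next
  case (edge m y e)
  then show ?case using path_span.edge[OF edge(3,2)] by (simp add: mult.assoc)
next
  case (scale m y c)
  then show ?case using path_span.scale by (simp add: mult.assoc)
qed (auto simp: distrib_right intro: path_span.intros R.right free_algebra_gen)

text \<open>Right multiplication by \<open>s\<close> selects the paths ending at \<open>s\<close>.
  This separates the paths that stop at the sink from those that can be prolonged.\<close>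

lemma path_span_vertex_right:
  assumes "path_span E (verts E) m y" "s \<in> verts E"
  shows "path_span E {s} m (y * V s)"
  using assms(1)
proof induction
  case (vertex v)
  have "path_span E {s} 0 (if v = s then V v else 0)"
    by (auto simp: path_span_zero intro: path_span.vertex)
  then show ?case using R_vertices[OF vertex assms(2)] by (rule path_span_cong)
next
  case (edge m y e)
  then show ?case using path_span.edge[OF edge(3,2)] by (simp add: mult.assoc)
next
  case (scale m y c)
  then show ?case using path_span.scale by (simp add: mult.assoc)
qed (auto simp: distrib_right intro: path_span.intros R.right free_algebra_gen)

lemma path_span_sum: "(\<And>i. i \<in> A \<Longrightarrow> path_span E Z m (f i)) \<Longrightarrow> path_span E Z m (sum f A)"
  by (induction A rule: infinite_finite_induct) (auto intro: path_span.add simp: path_span_zero)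

fun is_ghost :: "('v, 'e) gen \<Rightarrow> bool" where
  "is_ghost (Ghost e i) = True"
| "is_ghost _ = False"

text \<open>The letters act from the right end of the word. Each ghost consumes one edge, so a path
  at least as long as the number of ghosts never runs out; over sinks running out is
  harmless.\<close>

lemma path_span_word_left:
  assumes "path_span E Z m y" "Z \<subseteq> verts E" "set gs \<subseteq> gens E (\<lambda>_. 1)"
    and "m \<ge> int (length (filter is_ghost gs)) \<or> (\<forall>v\<in>Z. is_sink E v)"
  shows "path_span E Z (m + sum_list (map gen_degree gs)) (Poly_Mapping.single (Word gs) 1 * y)"
  using assms(3,4)
proof (induction gs)
  case Nil
  then show ?case using assms(1) by (simp flip: zero_word_def)
next
  case (Cons g gs)
  let ?m = "m + sum_list (map gen_degree gs)" and ?y = "Poly_Mapping.single (Word gs) 1 * y"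
  have IH: "path_span E Z ?m ?y" using Cons by (auto split: if_splits)
  \<comment> \<open>Degrees drop only at ghosts, so the length \<open>?m\<close> is still at least 1
    when \<open>g\<close> is one more ghost.\<close>
  have len: "sum_list (map gen_degree gs) \<ge> - int (length (filter is_ghost gs))"
  proof (induction gs)
    case (Cons g gs) then show ?case by (cases g) auto
  qed simp
  have s: "Poly_Mapping.single (Word (g # gs)) 1 * y = gen_elem E (\<lambda>_. 1) g * ?y"
    using Cons.prems by (simp add: gen_elem_def mult_single plus_word_def flip: mult.assoc)
  show ?case
  proof (cases g)
    case (Vertex v)
    then show ?thesis unfolding s
      using path_span_vertex_left[OF IH, of v] assms(2) Cons.prems by (auto simp: gens_def)
  next
    case (Edge e i)
    then show ?thesis unfolding s
      using path_span.edge[OF IH, of e] Cons.prems by (auto simp: gens_def algebra_simps)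
  next
    case (Ghost e i)
    then show ?thesis unfolding s
      using path_span_ghost_left[OF IH, of e] assms(2) Cons.prems len by (auto simp: gens_def algebra_simps)
  qed
qed

text \<open>Homogeneity of \<open>x\<close> puts the products of all its words with \<open>y\<close>
  into spans of one common length, so they can be added.\<close>

lemma path_span_homogeneous_left:
  assumes "path_span E Z m y" "Z \<subseteq> verts E" "x \<in> free_algebra E (\<lambda>_. 1)"
    and "\<forall>w\<in>Poly_Mapping.keys x. word_degree w = n"
    and "(\<forall>w\<in>Poly_Mapping.keys x. m \<ge> int (length (filter is_ghost (letters w)))) \<or> (\<forall>v\<in>Z. is_sink E v)"
  shows "path_span E Z (m + n) (x * y)"
proof -
  have "path_span E Z (m + n) (Poly_Mapping.single w 1 * y)" if w: "w \<in> Poly_Mapping.keys x" for w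
    using path_span_word_left[OF assms(1,2), of "letters w"] assms(3-5) w
    by (auto simp: free_algebra_def word_degree_def)
  then have "path_span E Z (m + n) ((\<Sum>w\<in>Poly_Mapping.keys x. 
      Poly_Mapping.single 0 (Poly_Mapping.lookup x w) * Poly_Mapping.single w 1) * y)"
    unfolding sum_distrib_right mult.assoc by (intro path_span_sum path_span.scale)
  then show ?thesis using sum_singles[of x] by simp
qed

lemma path_span_negative: "path_span E Z m y \<Longrightarrow> m < 0 \<Longrightarrow> y \<in> R"
proof (induction rule: path_span.induct)
  case (edge m y e)
  then show ?case by (intro R.left free_algebra_gen) auto
qed (auto intro: R.add R.scale)

text \<open>Left multiplication by \<open>u\<close> isolates the coefficient of \<open>u\<close> in
  a combination of vertices. In the edge case the remaining factor has length -1 and is therefore in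
  the relator ideal.\<close>

lemma path_span_zero_vertex:
  assumes "path_span E (verts E) m y" "m = 0" "u \<in> verts E"
  shows "\<exists>c. V u * y - Poly_Mapping.single 0 c * V u \<in> R"
  using assms(1,2)
proof (induction)
  case (vertex v)
  then show ?case using R_vertices[OF assms(3) vertex(1)]
    by (cases "u = v") (auto intro: exI[of _ 1] exI[of _ 0])
next
  case (edge m y e)
  then have "V u * (edge_elem e * y) \<in> R"
    using path_span_negative[OF edge(1)] by (intro R.left free_algebra_gen) auto
  then show ?case by (auto intro: exI[of _ 0])
next
  case (add m x y)
  then obtain c d where "V u * x - Poly_Mapping.single 0 c * V u \<in> R"
    "V u * y - Poly_Mapping.single 0 d * V u \<in> R" by auto
  from R.add[OF this] show ?case
    by (intro exI[of _ "c + d"]) (simp add: algebra_simps single_add)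
next
  case (scale m y c)
  then obtain d where "V u * y - Poly_Mapping.single 0 d * V u \<in> R" by auto
  from R.scale[OF this, of c] show ?case
    unfolding R_scale_left[of "V u"]
    by (intro exI[of _ "c * d"])
      (simp add: right_diff_distrib mult_single flip: mult.assoc)
next
  case (relator y m)
  then show ?case by (intro exI[of _ 0]) (simp add: R.left free_algebra_gen)
qed

text \<open>On a path with first edge f, the ghost of e vanishes unless e = f, so the sum over all
  arcs removes f and puts it back. This rebuilds \<open>y\<close> from the shorter elements
  \<open>ghost_elem e * y\<close>.\<close>

lemma path_span_strip:
  assumes "path_span E (verts E) m y" "m \<ge> 1"
  shows "(\<Sum>e\<in>arcs E. edge_elem e * (ghost_elem e * y)) - y \<in> R"
  using assms
proof induction
  case (edge m y f)
  have "edge_elem e * (ghost_elem e * edge_elem f - (if e = f then V (head E e) else 0)) * y \<in> R"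
    if "e \<in> arcs E" for e
    using R_ghost_edge[OF that edge(2)] path_span_free[OF edge(1)]
    by (intro R.right R.left free_algebra_gen) auto
  then have "(\<Sum>e\<in>arcs E. edge_elem e * (ghost_elem e * edge_elem f - (if e = f then V (head E e) else 0)) * y) \<in> R"
    by (rule R.sum)
  also have "(\<Sum>e\<in>arcs E. edge_elem e * (ghost_elem e * edge_elem f - (if e = f then V (head E e) else 0)) * y) =
    (\<Sum>e\<in>arcs E. edge_elem e * (ghost_elem e * (edge_elem f * y)) - (if e = f then edge_elem e * V (head E e) * y else 0))"
    by (intro sum.cong) (auto simp: algebra_simps)
  also have "\<dots> = (\<Sum>e\<in>arcs E. edge_elem e * (ghost_elem e * (edge_elem f * y))) - edge_elem f * V (head E f) * y"
    using edge(2) by (simp add: sum_subtractf)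
  finally have "\<dots> + (edge_elem f * V (head E f) - edge_elem f) * y \<in> R"
    using R_head[OF edge(2)] path_span_free[OF edge(1)] by (intro R.add R.right)
  then show ?case by (simp add: algebra_simps)
next
  case (add m x y)
  then have "(\<Sum>e\<in>arcs E. edge_elem e * (ghost_elem e * x)) - x + ((\<Sum>e\<in>arcs E. edge_elem e * (ghost_elem e * y)) - y) \<in> R"
    by (intro R.add) auto
  then show ?case by (simp add: algebra_simps sum.distrib)
next
  case (scale m y c)
  then have "Poly_Mapping.single 0 c * ((\<Sum>e\<in>arcs E. edge_elem e * (ghost_elem e * y)) - y) \<in> R"
    by (intro R.scale) auto
  then show ?case by (simp add: right_diff_distrib R_scale_left sum_distrib_left)
next
  case (relator y m)
  then show ?case by (intro R.diff R.sum R.left free_algebra_gen)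
qed simp

end

section \<open>Transfer from an ideal \<open>I\<close> to an ideal \<open>J\<close> containing the
  vertices of \<open>I\<close>\<close>

locale comparable_ideals = unweighted E + I: algebra_ideal E "\<lambda>_. 1" I + J: algebra_ideal E "\<lambda>_. 1" J
  for E :: "('v, 'e) pre_digraph" and I J :: "(('v, 'e) gen word \<Rightarrow>\<^sub>0 'k::field) set" +
  assumes vertices_sub: "v \<in> verts E \<Longrightarrow> V v \<in> I \<Longrightarrow> V v \<in> J"
begin

text \<open>Induction on the length: ghosts on the left shorten \<open>y\<close> inside
  \<open>I\<close>, and \<open>path_span_strip\<close> rebuilds it inside \<open>J\<close>. At
  length 0, u y = c u modulo relators; if c \<noteq> 0, dividing by c puts the vertex u into
  \<open>I\<close>, hence into \<open>J\<close>.\<close>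

lemma path_span_transfer:
  assumes "path_span E (verts E) m y" "y \<in> I"
  shows "y \<in> J"
proof (cases "m < 0")
  case True
  then show ?thesis using path_span_negative[OF assms(1)] J.rel by auto
next
  case False
  then show ?thesis using assms
  proof (induction "nat m" arbitrary: m y)
    case 0
    then have m: "m = 0" by simp
    have "V u * y \<in> J" if u: "u \<in> verts E" for u
    proof -
      obtain c where c: "V u * y - Poly_Mapping.single 0 c * V u \<in> R"
        using path_span_zero_vertex[OF 0(3) m u] by auto
      have "Poly_Mapping.single 0 c * V u \<in> I"
        using I.cong_rel[OF c] I.left[OF free_algebra_gen 0(4)] by simp
      then have "Poly_Mapping.single 0 (inverse c) * (Poly_Mapping.single 0 c * V u) \<in> I"
        by (rule I.scale)
      then have "V u \<in> I" if "c \<noteq> 0"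
        using that by (simp add: mult_single flip: mult.assoc)
      then have "Poly_Mapping.single 0 c * V u \<in> J"
        using vertices_sub[OF u] J.scale J.zero by (cases "c = 0") auto
      then show ?thesis using J.cong_rel[OF c] by simp
    qed
    then have "vertex_sum E (\<lambda>_. 1) * y \<in> J"
      unfolding vertex_sum_def sum_distrib_right by (rule J.sum)
    then show ?case
      using J.cong_rel[OF vertex_sum_unit(1)[OF fin_digraph_this path_span_free[OF 0(3)]]] by simp
  next
    case (Suc k)
    have m: "m \<ge> 1" "k = nat (m - 1)" using Suc(2) by arith+
    have "ghost_elem e * y \<in> J" if "e \<in> arcs E" for e
      using m path_span_ghost_left[OF Suc(4) that] Suc(5)
      by (intro Suc(1)[of "m - 1"] I.left free_algebra_gen) auto
    then have "(\<Sum>e\<in>arcs E. edge_elem e * (ghost_elem e * y)) \<in> J"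
      by (intro J.sum J.left[OF free_algebra_gen, of "ghost_elem _ * y"])
    then show ?case
      using J.cong_rel[OF path_span_strip[OF Suc(4)]] Suc(2,3) by simp
  qed
qed

text \<open>Splits off one more edge on the right, using $v = \sum_{e \in s^{-1}(v)} e e^*$.\<close>

lemma mem_of_path_products:
  assumes x: "x \<in> free_algebra E (\<lambda>_. 1)" and s: "\<And>v. v \<in> verts E \<Longrightarrow> is_sink E v \<longleftrightarrow> v = s" "s \<in> verts E"
    and top: "\<And>y. path_span E (verts E) (int N) y \<Longrightarrow> x * y \<in> J"
    and bot: "\<And>y j. path_span E {s} j y \<Longrightarrow> x * y \<in> J"
  shows "x \<in> J"
  using top
proof (induction N)
  case 0
  have "x * V v \<in> J" if "v \<in> verts E" for v
    using that 0 by (simp add: path_span.vertex)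
  then have "x * vertex_sum E (\<lambda>_. 1) \<in> J"
    unfolding vertex_sum_def sum_distrib_left by (rule J.sum)
  then show ?case
    using J.cong_rel[OF vertex_sum_unit(2)[OF fin_digraph_this x]] by simp
next
  case (Suc N)
  have "x * y \<in> J" if y: "path_span E (verts E) (int N) y" for y
  proof -
    have "x * y * V v \<in> J" if v: "v \<in> verts E" for v
    proof (cases "v = s")
      case True
      then show ?thesis using bot[OF path_span_vertex_right[OF y s(2)]] by (simp add: mult.assoc)
    next
      case False
      have "x * (y * edge_elem e) * ghost_elem e \<in> J" if "e \<in> arcs E" for e
        using Suc(2)[of "y * edge_elem e"] path_span_edge_right[OF y that]
        by (intro J.right[OF free_algebra_gen]) (simp add: add.commute)
      then have "(\<Sum>e\<in>out_arcs E v. x * (y * edge_elem e) * ghost_elem e) \<in> J"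
        by (intro J.sum) auto
      also have "(\<Sum>e\<in>out_arcs E v. x * (y * edge_elem e) * ghost_elem e) =
          (x * y) * (\<Sum>e\<in>out_arcs E v. edge_elem e * ghost_elem e)"
        by (simp add: sum_distrib_left mult.assoc)
      finally have a: "(x * y) * (\<Sum>e\<in>out_arcs E v. edge_elem e * ghost_elem e) \<in> J" .
      have "(x * y) * ((\<Sum>e\<in>out_arcs E v. edge_elem e * ghost_elem e) - V v) \<in> relator_ideal E (\<lambda>_. 1)"
        using R_edge_ghost[OF v] s v False x path_span_free[OF y]
        by (intro relator_ideal.left_mult free_algebra_mult) auto
      then show ?thesis using J.cong_rel a by (simp add: right_diff_distrib)
    qed
    then have "x * y * vertex_sum E (\<lambda>_. 1) \<in> J"
      unfolding vertex_sum_def sum_distrib_left by (rule J.sum)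
    then show ?thesis
      using J.cong_rel[OF vertex_sum_unit(2)[OF fin_digraph_this free_algebra_mult[OF x path_span_free[OF y]]]] by simp
  qed
  then show ?case by (rule Suc(1))
qed

lemma homogeneous_transfer:
  assumes x: "x \<in> I" and s: "\<And>v. v \<in> verts E \<Longrightarrow> is_sink E v \<longleftrightarrow> v = s" "s \<in> verts E"
    and deg: "\<forall>w\<in>Poly_Mapping.keys x. word_degree w = n"
  shows "x \<in> J"
proof -
  \<comment> \<open>\<open>N\<close> bounds the number of ghosts in each word of \<open>x\<close>,
    so that every ghost meets a real edge of a path of length \<open>N\<close>. The inserted 0
    covers \<open>x = 0\<close>.\<close>
  define N where "N = Max (insert 0 ((\<lambda>w. length (filter is_ghost (letters w))) ` Poly_Mapping.keys x))"
  have N: "length (filter is_ghost (letters w)) \<le> N" if "w \<in> Poly_Mapping.keys x" for w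
    using that unfolding N_def by (intro Max_ge) auto
  have free: "x \<in> free_algebra E (\<lambda>_. 1)" using x I.sub by auto
  show ?thesis
  proof (rule mem_of_path_products[OF free s, of N])
    fix y :: "('v, 'e) gen word \<Rightarrow>\<^sub>0 'k" and j
    show "x * y \<in> J" if y: "path_span E (verts E) (int N) y"
      using path_span_homogeneous_left[OF y _ free deg] N x
      by (intro path_span_transfer[of "int N + n"] I.right path_span_free[OF y]) auto
    show "x * y \<in> J" if y: "path_span E {s} j y"
      using path_span_homogeneous_left[OF y _ free deg] s x path_span_mono[of "{s}" "j + n" "x * y" "verts E"]
      by (intro path_span_transfer[of "j + n"] I.right path_span_free[OF y]) auto
  qed
qed

end

section \<open>Vertex sets of ideals and ideals generated by vertices\<close>

context constant_weight
begin

context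
  fixes k :: "'k::field itself"
begin

abbreviation vertex_ideal :: "'v set \<Rightarrow> (('v, 'e) gen word \<Rightarrow>\<^sub>0 'k) set set" where
  "vertex_ideal X \<equiv> Idl\<^bsub>weighted_leavitt k E \<omega>\<^esub> (vertex_class k E \<omega> ` X)"

definition ideal_vertices :: "(('v, 'e) gen word \<Rightarrow>\<^sub>0 'k) set set \<Rightarrow> 'v set" where
  "ideal_vertices I = {v \<in> verts E. V v \<in> ideal_lift \<omega> I}"

lemma ideal_vertices_hereditary_saturated:
  assumes "ideal I (weighted_leavitt k E \<omega>)"
  shows "hereditary E (ideal_vertices I)" "saturated E (ideal_vertices I)"
  unfolding ideal_vertices_def
  using vertices_ideal_hereditary_saturated[OF algebra_ideal_lift[OF assms]] .

text \<open>A Galois connection between sets of vertices and ideals. Its closed vertex sets turn out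
  to be the hereditary saturated ones.\<close>

lemma vertex_ideal_subset_iff:
  assumes "X \<subseteq> verts E" "ideal I (weighted_leavitt k E \<omega>)"
  shows "vertex_ideal X \<subseteq> I \<longleftrightarrow> X \<subseteq> ideal_vertices I"
  using idl_subset_iff[OF assms] assms(1) by (auto simp: ideal_vertices_def)

text \<open>One inclusion is the Galois connection. For the other, the ideal from
  \<open>ex_vertex_ideal\<close> contains \<open>vertex_ideal H\<close> but no vertex outside
  \<open>H\<close>.\<close>

lemma ideal_vertices_vertex_ideal:
  assumes "hereditary E H" "saturated E H"
  shows "ideal_vertices (vertex_ideal H) = H"
proof
  have H: "H \<subseteq> verts E" using assms(1) by (auto simp: hereditary_def)
  obtain U :: "(('v, 'e) gen word \<Rightarrow>\<^sub>0 'k) set" where U: "algebra_ideal E \<omega> U"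
    "\<And>v. v \<in> verts E \<Longrightarrow> V v \<in> U \<longleftrightarrow> v \<in> H"
    using ex_vertex_ideal[OF assms] by blast
  note I = ideal_class_image[OF U(1), of k]
  have lift: "ideal_lift \<omega> (leavitt_class E \<omega> ` U) = U" by (rule lift_class_image[OF U(1)])
  have eq: "ideal_vertices (leavitt_class E \<omega> ` U) = H"
    using U(2) H unfolding ideal_vertices_def lift by blast
  then have "vertex_ideal H \<subseteq> leavitt_class E \<omega> ` U"
    using vertex_ideal_subset_iff[OF H I] by simp
  then show "ideal_vertices (vertex_ideal H) \<subseteq> H"
    unfolding eq[symmetric] by (auto simp: ideal_vertices_def ideal_lift_def)
  show "H \<subseteq> ideal_vertices (vertex_ideal H)"
    using vertex_ideal_subset_iff[OF H ideal_idl, of H] by simp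
qed

lemma hereditary_saturated_vertex_ideal_order:
  assumes "hereditary E H" "saturated E H" "hereditary E H'" "saturated E H'"
  shows "H \<subseteq> H' \<longleftrightarrow> vertex_ideal H \<subseteq> vertex_ideal H'"
  using vertex_ideal_subset_iff[OF _ ideal_idl, of H H'] ideal_vertices_vertex_ideal[OF assms(3,4)] assms(1)
  by (simp add: hereditary_def)

text \<open>The common part of (5) and (6): what remains for each family is that its members contain
  a vertex and are generated by their vertices, and that it contains the ideals of all nonempty
  \<open>H\<close>.\<close>

lemma bij_betw_vertex_ideal:
  assumes "\<And>I. I \<in> \<I> \<Longrightarrow> ideal I (weighted_leavitt k E \<omega>) \<and>
      ideal_vertices I \<noteq> {} \<and> I \<subseteq> vertex_ideal (ideal_vertices I)"
    and "\<And>H. hereditary E H \<Longrightarrow> saturated E H \<Longrightarrow> H \<noteq> {} \<Longrightarrow> vertex_ideal H \<in> \<I>"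
  shows "bij_betw vertex_ideal {H. hereditary E H \<and> saturated E H \<and> H \<noteq> {}} \<I>"
proof (rule bij_betwI[where g = ideal_vertices])
  show "ideal_vertices \<in> \<I> \<rightarrow> {H. hereditary E H \<and> saturated E H \<and> H \<noteq> {}}"
    using assms(1) ideal_vertices_hereditary_saturated by blast
  show "vertex_ideal (ideal_vertices I) = I" if "I \<in> \<I>" for I
    using assms(1)[OF that] vertex_ideal_subset_iff[of "ideal_vertices I" I]
    by (auto simp: ideal_vertices_def)
qed (use assms(2) ideal_vertices_vertex_ideal in auto)

lemma hereditary_saturated_iso_vertex_ideals:
  assumes "lattice (hereditary_saturated_lattice E)"
  shows "hereditary_saturated_lattice E \<cong>\<^sub>l vertex_ideal_lattice k E \<omega>"
  unfolding hereditary_saturated_lattice_def vertex_ideal_lattice_def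
proof (rule lattice_isomorphic_orderI[OF assms[unfolded hereditary_saturated_lattice_def] bij_betw_vertex_ideal])
  fix I assume "I \<in> {I. \<exists>X\<subseteq>verts E. X \<noteq> {} \<and> I = vertex_ideal X}"
  then obtain X where X: "X \<subseteq> verts E" "X \<noteq> {}" "I = vertex_ideal X" by auto
  \<comment> \<open>The generating set \<open>X\<close> is arbitrary; it is enlarged to all vertices
    of \<open>I\<close>, which generate the same ideal.\<close>
  have "X \<subseteq> ideal_vertices I"
    using vertex_ideal_subset_iff[OF X(1) ideal_idl, of X] X(3) by simp
  moreover have "ideal_vertices I \<subseteq> verts E" by (auto simp: ideal_vertices_def)
  then have "ideal_vertices I \<subseteq> ideal_vertices (vertex_ideal (ideal_vertices I))"
    using vertex_ideal_subset_iff[OF _ ideal_idl, of "ideal_vertices I" "ideal_vertices I"] by simp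
  ultimately show "ideal I (weighted_leavitt k E \<omega>) \<and> ideal_vertices I \<noteq> {} \<and>
      I \<subseteq> vertex_ideal (ideal_vertices I)"
    using X(2) vertex_ideal_subset_iff[OF X(1) ideal_idl, of "ideal_vertices I"]
      ideal_idl[of k \<omega> X] unfolding X(3)[symmetric] by blast
next
  fix H :: "'v set" assume "hereditary E H" "H \<noteq> {}"
  then show "vertex_ideal H \<in> {I. \<exists>X\<subseteq>verts E. X \<noteq> {} \<and> I = vertex_ideal X}"
    by (auto simp: hereditary_def)
next
  fix H H' assume "H \<in> {H. hereditary E H \<and> saturated E H \<and> H \<noteq> {}}"
    "H' \<in> {H. hereditary E H \<and> saturated E H \<and> H \<noteq> {}}"
  then have "hereditary E H" "saturated E H" "hereditary E H'" "saturated E H'" by simp_all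
  then show "H \<subseteq> H' \<longleftrightarrow> vertex_ideal H \<subseteq> vertex_ideal H'"
    by (rule hereditary_saturated_vertex_ideal_order)
qed

end
end

section \<open>Graded ideals\<close>

definition homogeneous_part :: "int \<Rightarrow> (('v, 'e) gen word \<Rightarrow>\<^sub>0 'k::field) \<Rightarrow> ('v, 'e) gen word \<Rightarrow>\<^sub>0 'k" where
  "homogeneous_part n x =
    (\<Sum>w\<in>{w \<in> Poly_Mapping.keys x. word_degree w = n}. Poly_Mapping.single w (Poly_Mapping.lookup x w))"

lemma lookup_homogeneous_part:
  "Poly_Mapping.lookup (homogeneous_part n x) w = (if word_degree w = n then Poly_Mapping.lookup x w else 0)"
  by (auto simp: homogeneous_part_def lookup_sum lookup_single when_def in_keys_iff)

lemma keys_homogeneous_part: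
  "Poly_Mapping.keys (homogeneous_part n x) = {w \<in> Poly_Mapping.keys x. word_degree w = n}"
  by (auto simp: in_keys_iff lookup_homogeneous_part split: if_splits)

lemma homogeneous_part_free: "x \<in> free_algebra E \<omega> \<Longrightarrow> homogeneous_part n x \<in> free_algebra E \<omega>"
  by (auto simp: free_algebra_def keys_homogeneous_part)

lemma homogeneous_part_add: "homogeneous_part n (x + y) = homogeneous_part n x + homogeneous_part n y"
  by (rule poly_mapping_eqI) (simp add: lookup_homogeneous_part lookup_add)

lemma homogeneous_part_zero: "homogeneous_part n 0 = 0"
  by (rule poly_mapping_eqI) (simp add: lookup_homogeneous_part)

lemma homogeneous_part_sum: "homogeneous_part n (\<Sum>i\<in>A. f i) = (\<Sum>i\<in>A. homogeneous_part n (f i))"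
  by (induction A rule: infinite_finite_induct) (simp_all add: homogeneous_part_add homogeneous_part_zero)

lemma homogeneous_part_homogeneous:
  "\<forall>w\<in>Poly_Mapping.keys x. word_degree w = d \<Longrightarrow> homogeneous_part n x = (if d = n then x else 0)"
  by (intro poly_mapping_eqI) (auto simp: lookup_homogeneous_part in_keys_iff)

lemma homogeneous_part_decomp:
  "x = (\<Sum>n\<in>word_degree ` Poly_Mapping.keys x. homogeneous_part n x)"
  by (rule poly_mapping_eqI) (auto simp: lookup_sum lookup_homogeneous_part in_keys_iff)

lemma word_degree_plus: "word_degree (u + v) = word_degree u + word_degree v"
  by (simp add: word_degree_def plus_word_def)

text \<open>Once the degree of the left part is chosen, that of the right part is forced; degrees
  missing in \<open>y\<close> contribute 0.\<close>

lemma homogeneous_part_mult: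
  "homogeneous_part n (x * y) =
    (\<Sum>i\<in>word_degree ` Poly_Mapping.keys x. homogeneous_part i x * homogeneous_part (n - i) y)"
proof -
  let ?X = "word_degree ` Poly_Mapping.keys x" and ?Y = "word_degree ` Poly_Mapping.keys y"
  have h: "homogeneous_part n (homogeneous_part i x * homogeneous_part j y) =
      (if j = n - i then homogeneous_part i x * homogeneous_part j y else 0)" for i j
  proof (subst homogeneous_part_homogeneous)
    show "\<forall>w\<in>Poly_Mapping.keys (homogeneous_part i x * homogeneous_part j y). word_degree w = i + j"
      using keys_mult[of "homogeneous_part i x" "homogeneous_part j y"]
      by (auto simp: keys_homogeneous_part word_degree_plus)
  qed auto
  have z: "homogeneous_part j y = 0" if "j \<notin> ?Y" for j
    using that by (intro poly_mapping_eqI) (auto simp: lookup_homogeneous_part in_keys_iff image_iff)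
  have "homogeneous_part n (x * y) =
      homogeneous_part n ((\<Sum>i\<in>?X. homogeneous_part i x) * (\<Sum>j\<in>?Y. homogeneous_part j y))"
    using homogeneous_part_decomp[of x] homogeneous_part_decomp[of y] by simp
  also have "\<dots> = (\<Sum>i\<in>?X. \<Sum>j\<in>?Y. if j = n - i then homogeneous_part i x * homogeneous_part j y else 0)"
    unfolding sum_product homogeneous_part_sum h ..
  also have "\<dots> = (\<Sum>i\<in>?X. homogeneous_part i x * homogeneous_part (n - i) y)"
    by (intro sum.cong) (auto simp: z)
  finally show ?thesis .
qed

context unweighted
begin

context
  fixes k :: "'k::field itself"
begin

text \<open>Elements with a representative whose homogeneous parts all lie in the vertex ideal form
  an ideal, the image of \<open>K\<close>. It contains the generating vertices, which are
  homogeneous of degree 0, and hence the whole vertex ideal.\<close>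

lemma graded_ideal_vertex_ideal:
  assumes X: "X \<subseteq> verts E"
  shows "graded_ideal (vertex_ideal k X) (leavitt k E) (leavitt_component k E)"
  unfolding graded_ideal_def leavitt_def
proof (intro conjI ballI)
  let ?L = "weighted_leavitt k E (\<lambda>_. 1)"
  note J = ideal_idl[of k "\<lambda>_. 1" X]
  show "ideal (vertex_ideal k X) ?L" by (rule J)
  interpret J: algebra_ideal E "\<lambda>_. 1" "ideal_lift (\<lambda>_. 1) (vertex_ideal k X)"
    by (rule algebra_ideal_lift[OF J])
  \<comment> \<open>Allowing \<open>y\<close> to differ from \<open>x\<close> by relators puts every
    relator into \<open>K\<close>, with \<open>y = 0\<close>.\<close>
  define K where "K = {x \<in> free_algebra E (\<lambda>_. 1). \<exists>y. y \<in> free_algebra E (\<lambda>_. 1) \<and> x - y \<in> (R :: (('v, 'e) gen word \<Rightarrow>\<^sub>0 'k) set) \<and>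
    (\<forall>n. homogeneous_part n y \<in> ideal_lift (\<lambda>_. 1) (vertex_ideal k X))}"
  interpret R: algebra_ideal E "\<lambda>_. 1" "R :: (('v, 'e) gen word \<Rightarrow>\<^sub>0 'k::field) set"
    by (rule algebra_ideal_relator_ideal) unfold_locales
  have K_I: "x \<in> K" if "x \<in> free_algebra E (\<lambda>_. 1)" "y \<in> free_algebra E (\<lambda>_. 1)" "x - y \<in> R"
    "\<And>n. homogeneous_part n y \<in> ideal_lift (\<lambda>_. 1) (vertex_ideal k X)" for x y
    using that unfolding K_def by blast
  have K: "algebra_ideal E (\<lambda>_. 1) K"
  proof (intro algebra_ideal.intro algebra_ideal_axioms.intro fin_digraph_this)
    show "K \<subseteq> free_algebra E (\<lambda>_. 1)" by (auto simp: K_def)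
    show "R \<subseteq> K"
      using J.zero R.sub free_algebra_zero unfolding K_def
      by (auto simp: homogeneous_part_zero intro!: exI[of _ 0])
  next
    fix x x' :: "('v, 'e) gen word \<Rightarrow>\<^sub>0 'k"
    assume "x \<in> K" "x' \<in> K"
    then obtain y y' where y: "y \<in> free_algebra E (\<lambda>_. 1)" "x - y \<in> R"
        "\<And>n. homogeneous_part n y \<in> ideal_lift (\<lambda>_. 1) (vertex_ideal k X)"
        "y' \<in> free_algebra E (\<lambda>_. 1)" "x' - y' \<in> R"
        "\<And>n. homogeneous_part n y' \<in> ideal_lift (\<lambda>_. 1) (vertex_ideal k X)"
        and x: "x \<in> free_algebra E (\<lambda>_. 1)" "x' \<in> free_algebra E (\<lambda>_. 1)"
      unfolding K_def by auto
    have "x + x' - (y + y') \<in> R" using R.add[OF y(2,5)] by (simp add: algebra_simps)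
    with y x show "x + x' \<in> K"
      by (intro K_I[of "x + x'" "y + y'"]) (simp_all add: free_algebra_add homogeneous_part_add J.add)
  next
    fix a x :: "('v, 'e) gen word \<Rightarrow>\<^sub>0 'k"
    assume a: "a \<in> free_algebra E (\<lambda>_. 1)" and "x \<in> K"
    then obtain y where y: "y \<in> free_algebra E (\<lambda>_. 1)" "x - y \<in> R"
        "\<And>n. homogeneous_part n y \<in> ideal_lift (\<lambda>_. 1) (vertex_ideal k X)"
        and x: "x \<in> free_algebra E (\<lambda>_. 1)"
      unfolding K_def by auto
    have "a * x - a * y \<in> R" "x * a - y * a \<in> R"
      using R.left[OF a y(2)] R.right[OF a y(2)] by (simp_all add: algebra_simps)
    moreover have "homogeneous_part n (a * y) \<in> ideal_lift (\<lambda>_. 1) (vertex_ideal k X)"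
      "homogeneous_part n (y * a) \<in> ideal_lift (\<lambda>_. 1) (vertex_ideal k X)" for n
      unfolding homogeneous_part_mult
      by (intro J.sum J.left J.right homogeneous_part_free a y)+
    ultimately show "a * x \<in> K" "x * a \<in> K"
      using K_I[of "a * x" "a * y"] K_I[of "x * a" "y * a"] free_algebra_mult a y(1) x by blast+
  qed
  have lift: "ideal_lift (\<lambda>_. 1) (leavitt_class E (\<lambda>_. 1) ` K) = K"
    by (rule lift_class_image[OF K])
  have "V v \<in> K" if "v \<in> X" for v
  proof -
    have "\<forall>w\<in>Poly_Mapping.keys (V v :: ('v, 'e) gen word \<Rightarrow>\<^sub>0 'k). word_degree w = 0"
      by (simp add: gen_elem_def word_degree_def)
    note h = homogeneous_part_homogeneous[OF this]
    have "V v \<in> ideal_lift (\<lambda>_. 1) (vertex_ideal k X)"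
      using idl_subset_iff[OF X J] that by auto
    then show ?thesis
      using free_algebra_gen J.zero R.zero unfolding K_def by (auto simp: h intro!: exI[of _ "V v"])
  qed
  then have sub: "vertex_ideal k X \<subseteq> leavitt_class E (\<lambda>_. 1) ` K"
    using idl_subset_iff[OF X ideal_class_image[OF K], of k] unfolding lift by auto
  fix Y assume "Y \<in> vertex_ideal k X"
  then obtain x where x: "x \<in> K" "Y = leavitt_class E (\<lambda>_. 1) x" using sub by auto
  then obtain y where y: "y \<in> free_algebra E (\<lambda>_. 1)" "x - y \<in> R"
      "\<And>n. homogeneous_part n y \<in> ideal_lift (\<lambda>_. 1) (vertex_ideal k X)" "x \<in> free_algebra E (\<lambda>_. 1)"
    unfolding K_def by auto
  let ?N = "word_degree ` Poly_Mapping.keys y"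
  have "Y = leavitt_class E (\<lambda>_. 1) y" using x(2) y class_eq_iff[of x "\<lambda>_. 1" y] by simp
  also have "\<dots> = leavitt_class E (\<lambda>_. 1) (\<Sum>n\<in>?N. homogeneous_part n y)"
    by (rule arg_cong[OF homogeneous_part_decomp])
  also have "\<dots> = (\<Oplus>\<^bsub>?L\<^esub>n\<in>?N. leavitt_class E (\<lambda>_. 1) (homogeneous_part n y))"
    using y(1) by (intro class_finsum[symmetric] homogeneous_part_free) auto
  finally have "Y = \<dots>" .
  moreover have "leavitt_class E (\<lambda>_. 1) (homogeneous_part n y) \<in> vertex_ideal k X \<inter> leavitt_component k E n" for n
    using y(3)[of n] y(1) homogeneous_part_free[of y E "\<lambda>_. 1" n]
    unfolding ideal_lift_def leavitt_component_def by (auto simp: keys_homogeneous_part)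
  ultimately show "\<exists>N f. finite N \<and> (\<forall>n\<in>N. f n \<in> vertex_ideal k X \<inter> leavitt_component k E n) \<and>
      Y = (\<Oplus>\<^bsub>?L\<^esub>n\<in>N. f n)"
    by (intro exI[of _ ?N] exI[of _ "\<lambda>n. leavitt_class E (\<lambda>_. 1) (homogeneous_part n y)"]) auto
qed

text \<open>The grading reduces the inclusion to homogeneous elements of \<open>I\<close>. Each has
  a representative whose words share one degree, as \<open>homogeneous_transfer\<close>
  requires.\<close>

lemma graded_ideal_subset_vertex_ideal:
  assumes s: "\<And>v. v \<in> verts E \<Longrightarrow> is_sink E v \<longleftrightarrow> v = s" "s \<in> verts E"
    and I: "graded_ideal I (leavitt k E) (leavitt_component k E)"
  shows "I \<subseteq> vertex_ideal k (ideal_vertices I)"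
proof
  let ?L = "weighted_leavitt k E (\<lambda>_. 1)"
  let ?J = "vertex_ideal k (ideal_vertices I)"
  have ideal: "ideal I ?L" using I by (simp add: graded_ideal_def leavitt_def)
  note J = ideal_idl[of k "\<lambda>_. 1" "ideal_vertices I"]
  interpret J: ideal ?J ?L by (rule J)
  have "ideal_vertices I \<subseteq> verts E" by (auto simp: ideal_vertices_def)
  then have "ideal_vertices I \<subseteq> ideal_vertices ?J"
    using vertex_ideal_subset_iff[OF _ J, of "ideal_vertices I"] by simp
  then interpret comparable_ideals E "ideal_lift (\<lambda>_. 1) I" "ideal_lift (\<lambda>_. 1) ?J"
    using algebra_ideal_lift[OF ideal] algebra_ideal_lift[OF J] unweighted_axioms
    by (intro comparable_ideals.intro comparable_ideals_axioms.intro)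
      (auto simp: ideal_vertices_def)
  have hom: "X \<in> ?J" if X: "X \<in> I" "X \<in> leavitt_component k E n" for X n
  proof -
    obtain x where x: "X = leavitt_class E (\<lambda>_. 1) x" "x \<in> free_algebra E (\<lambda>_. 1)"
      "\<forall>w\<in>Poly_Mapping.keys x. word_degree w = n"
      using X(2) unfolding leavitt_component_def by auto
    then have "x \<in> ideal_lift (\<lambda>_. 1) I" using X(1) by (simp add: ideal_lift_def)
    from homogeneous_transfer[OF this s x(3)] show ?thesis by (simp add: ideal_lift_def x(1))
  qed
  fix X assume X: "X \<in> I"
  obtain N f where N: "finite N" "\<And>n. n \<in> N \<Longrightarrow> f n \<in> I \<inter> leavitt_component k E n"
    "X = (\<Oplus>\<^bsub>?L\<^esub>n\<in>N. f n)"
    using bspec[OF conjunct2[OF I[unfolded graded_ideal_def leavitt_def]] X] by blast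
  have "(\<Oplus>\<^bsub>?L\<^esub>n\<in>N. f n) \<in> ?J"
    using N(1,2)
  proof (induction N)
    case empty
    then show ?case using additive_subgroup.zero_closed[OF J.additive_subgroup_axioms] by simp
  next
    case (insert n N)
    have f: "f m \<in> ?J" if "m \<in> insert n N" for m using hom insert(4)[OF that] by auto
    then have "(\<Oplus>\<^bsub>?L\<^esub>m\<in>insert n N. f m) = f n \<oplus>\<^bsub>?L\<^esub> (\<Oplus>\<^bsub>?L\<^esub>m\<in>N. f m)"
      using insert(1,2) J.Icarr by (intro J.finsum_insert) auto
    then show ?case using f insert J.a_closed by auto
  qed
  then show "X \<in> ?J" using N(3) by simp
qed

lemma hereditary_saturated_iso_graded_ideals:
  assumes "lattice (hereditary_saturated_lattice E)"
    and s: "\<And>v. v \<in> verts E \<Longrightarrow> is_sink E v \<longleftrightarrow> v = s" "s \<in> verts E"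
  shows "hereditary_saturated_lattice E \<cong>\<^sub>l graded_ideal_lattice k E"
  unfolding hereditary_saturated_lattice_def graded_ideal_lattice_def
proof (rule lattice_isomorphic_orderI[OF assms(1)[unfolded hereditary_saturated_lattice_def] bij_betw_vertex_ideal])
  interpret L: ring "weighted_leavitt k E (\<lambda>_. 1)" by (rule ring_leavitt)
  fix I assume "I \<in> {I. graded_ideal I (leavitt k E) (leavitt_component k E) \<and> I \<noteq> {\<zero>\<^bsub>leavitt k E\<^esub>}}"
  then have I: "graded_ideal I (leavitt k E) (leavitt_component k E)" "I \<noteq> {\<zero>\<^bsub>weighted_leavitt k E (\<lambda>_. 1)\<^esub>}"
    by (simp_all add: leavitt_def)
  then have ideal: "ideal I (weighted_leavitt k E (\<lambda>_. 1))" by (simp add: graded_ideal_def leavitt_def)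
  note sub = graded_ideal_subset_vertex_ideal[OF s I(1)]
  \<comment> \<open>Without vertices, \<open>I\<close> lies in the ideal generated by the empty set,
    which is zero.\<close>
  have "I = {\<zero>\<^bsub>weighted_leavitt k E (\<lambda>_. 1)\<^esub>}" if "ideal_vertices I = {}"
  proof
    have "vertex_ideal k {} \<subseteq> {\<zero>\<^bsub>weighted_leavitt k E (\<lambda>_. 1)\<^esub>}"
      using vertex_ideal_subset_iff[OF _ L.zeroideal, of "{}"] by simp
    then show "I \<subseteq> {\<zero>\<^bsub>weighted_leavitt k E (\<lambda>_. 1)\<^esub>}" using sub that by simp
    show "{\<zero>\<^bsub>weighted_leavitt k E (\<lambda>_. 1)\<^esub>} \<subseteq> I"
      using additive_subgroup.zero_closed[OF ideal.axioms(1)[OF ideal]] by simp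
  qed
  then show "ideal I (weighted_leavitt k E (\<lambda>_. 1)) \<and> ideal_vertices I \<noteq> {} \<and>
      I \<subseteq> vertex_ideal k (ideal_vertices I)"
    using ideal sub I(2) by blast
next
  interpret L: ring "weighted_leavitt k E (\<lambda>_. 1)" by (rule ring_leavitt)
  fix H :: "'v set" assume H: "hereditary E H" "saturated E H" "H \<noteq> {}"
  have "H \<subseteq> verts E" using H(1) by (simp add: hereditary_def)
  moreover have "vertex_ideal k H \<noteq> {\<zero>\<^bsub>weighted_leavitt k E (\<lambda>_. 1)\<^esub>}"
  proof
    assume eq: "vertex_ideal k H = {\<zero>\<^bsub>weighted_leavitt k E (\<lambda>_. 1)\<^esub>}"
    \<comment> \<open>The empty set is hereditary and saturated too, so the order embedding shows
      that a nonempty \<open>H\<close> generates more than the zero ideal.\<close>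
    have e: "hereditary E {}" "saturated E {}"
      by (auto simp: hereditary_def saturated_def regular_def is_sink_def)
    have "vertex_ideal k H \<subseteq> vertex_ideal k {}"
      unfolding eq using additive_subgroup.zero_closed[OF ideal.axioms(1)[OF ideal_idl[of k "\<lambda>_. 1" "{}"]]] by simp
    then show False
      using hereditary_saturated_vertex_ideal_order[OF H(1,2) e, of k] H(3) by simp
  qed
  ultimately show "vertex_ideal k H \<in> {I. graded_ideal I (leavitt k E) (leavitt_component k E) \<and> I \<noteq> {\<zero>\<^bsub>leavitt k E\<^esub>}}"
    using graded_ideal_vertex_ideal by (simp add: leavitt_def)
next
  fix H H' assume "H \<in> {H. hereditary E H \<and> saturated E H \<and> H \<noteq> {}}"
    "H' \<in> {H. hereditary E H \<and> saturated E H \<and> H \<noteq> {}}"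
  then have "hereditary E H" "saturated E H" "hereditary E H'" "saturated E H'" by simp_all
  then show "H \<subseteq> H' \<longleftrightarrow> vertex_ideal k H \<subseteq> vertex_ideal k H'"
    by (rule hereditary_saturated_vertex_ideal_order)
qed

end
end

declare One_nat_def [simp]

section \<open>Cyclic components\<close>

context sandpile_graph
begin

definition the_sink :: 'v where
  "the_sink = (THE s. is_sink E s)"

lemma is_sink_iff: "is_sink E v \<longleftrightarrow> v = the_sink"
  using unique_sink theI'[OF unique_sink] unfolding the_sink_def by blast

lemma sink_vert: "the_sink \<in> verts E"
  using is_sink_iff[of the_sink] by (simp add: is_sink_def)

lemma reaches_the_sink: "v \<in> verts E \<Longrightarrow> v \<rightarrow>\<^sup>*\<^bsub>E\<^esub> the_sink"
  using reaches_sink is_sink_iff by blast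

lemma regular_iff_not_sink: "regular E v \<longleftrightarrow> v \<in> verts E \<and> v \<noteq> the_sink"
  by (auto simp: regular_def is_sink_iff finite_out_arcs)

lemma hereditary_reachable: "u \<rightarrow>\<^sup>*\<^bsub>E\<^esub> v \<Longrightarrow> hereditary E H \<Longrightarrow> u \<in> H \<Longrightarrow> v \<in> H"
  by (induction rule: reachable_induct) (auto simp: hereditary_def arcs_ends_conv)

text \<open>Consequently every vertex outside a nonempty hereditary set is regular, so that
  saturation applies to it.\<close>

lemma sink_in_hereditary: "hereditary E H \<Longrightarrow> H \<noteq> {} \<Longrightarrow> the_sink \<in> H"
  using hereditary_reachable[OF reaches_the_sink] by (auto simp: hereditary_def)

lemma cyclic_component_verts:
  assumes "C \<in> cyclic_components E"
  shows "verts C \<in> sccs_verts" "verts C \<noteq> {}" "verts C \<subseteq> verts E"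
    "u \<in> verts C \<Longrightarrow> v \<in> verts C \<Longrightarrow> u \<rightarrow>\<^sup>*\<^bsub>E\<^esub> v"
proof -
  show *: "verts C \<in> sccs_verts"
    using assms by (auto simp: cyclic_components_def sccs_verts_conv)
  then show "verts C \<noteq> {}" "u \<in> verts C \<Longrightarrow> v \<in> verts C \<Longrightarrow> u \<rightarrow>\<^sup>*\<^bsub>E\<^esub> v"
    by (auto simp: sccs_verts_def)
  show "verts C \<subseteq> verts E"
    using * reachable_in_verts by (force simp: sccs_verts_def)
qed

text \<open>From \<open>u\<close> walk to the cycle, go round it once and walk back; the cycle makes
  the length positive.\<close>

lemma cyclic_component_loop:
  assumes C: "C \<in> cyclic_components E" and u: "u \<in> verts C"
  shows "u \<rightarrow>\<^sup>+\<^bsub>E\<^esub> u"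
proof -
  have sub: "subgraph C E"
    using C by (auto simp: cyclic_components_def sccs_def induced_subgraph_def)
  then interpret C: wf_digraph C by blast
  obtain p x where p: "C.awalk x p x" "p \<noteq> []"
    using C by (auto simp: cyclic_components_def C.cycle_def)
  have "awalk x p x" using subgraph_awalk_imp_awalk[OF p(1) sub] .
  then have "x \<rightarrow>\<^sup>+\<^bsub>E\<^esub> x" using p(2) unfolding reachable1_awalk by blast
  moreover have "x \<in> verts C" using p(1) by auto
  ultimately show ?thesis
    using cyclic_component_verts(4)[OF C] u reachable_reachable1_trans reachable1_reachable_trans by blast
qed

lemma ex_cyclic_component:
  assumes u: "u \<rightarrow>\<^sup>+\<^bsub>E\<^esub> u"
  obtains C where "C \<in> cyclic_components E" "u \<in> verts C"
proof -
  let ?S = "scc_of u"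
  have S: "?S \<in> sccs_verts"
    using u unfolding sccs_verts_def scc_of_def by (auto intro: reachable_trans)
  have uS: "u \<in> ?S" using reachable1_reachable[OF u] by (simp add: scc_of_def)
  note C = in_verts_sccsD_sccs[OF S]
  interpret C: wf_digraph "E \<restriction> ?S" by (rule wellformed_induce_subgraph)
  \<comment> \<open>Strong connectivity only provides walks that may be empty. Splitting off the
    first arc of the closed walk gives positive length inside the component.\<close>
  obtain w where w: "u \<rightarrow>\<^bsub>E\<^esub> w" "w \<rightarrow>\<^sup>*\<^bsub>E\<^esub> u"
    using tranclD[OF u] adj_in_verts(2) reachable_conv' by blast
  then have wS: "w \<in> ?S" by (auto simp: scc_of_def)
  have "w \<rightarrow>\<^sup>*\<^bsub>E \<restriction> ?S\<^esub> u"
    using C wS uS by (auto simp: sccs_def)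
  moreover have "u \<rightarrow>\<^bsub>E \<restriction> ?S\<^esub> w"
    using w(1) uS wS by (auto simp: arcs_ends_conv)
  ultimately have "u \<rightarrow>\<^sup>+\<^bsub>E \<restriction> ?S\<^esub> u"
    using C.reachable1_reachable_trans by blast
  then have "\<exists>p. C.cycle p"
    unfolding C.reachable1_awalk using C.closed_w_imp_cycle by (auto simp: C.closed_w_def)
  then show thesis
    using that[of "E \<restriction> ?S"] C uS by (simp add: cyclic_components_def)
qed

lemma hereditary_saturated_iff_components:
  assumes H: "hereditary E H" "saturated E H" "H \<noteq> {}" and v: "v \<in> verts E"
  shows "v \<in> H \<longleftrightarrow> (\<forall>C\<in>cyclic_components E. (\<exists>u\<in>verts C. v \<rightarrow>\<^sup>*\<^bsub>E\<^esub> u) \<longrightarrow> verts C \<subseteq> H)"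
proof
  show "\<forall>C\<in>cyclic_components E. (\<exists>u\<in>verts C. v \<rightarrow>\<^sup>*\<^bsub>E\<^esub> u) \<longrightarrow> verts C \<subseteq> H" if "v \<in> H"
    using that H(1) cyclic_component_verts(4) hereditary_reachable by blast
next
  assume *: "\<forall>C\<in>cyclic_components E. (\<exists>u\<in>verts C. v \<rightarrow>\<^sup>*\<^bsub>E\<^esub> u) \<longrightarrow> verts C \<subseteq> H"
  show "v \<in> H"
  proof (rule ccontr)
    assume vH: "v \<notin> H"
    have "\<exists>w. u \<rightarrow>\<^bsub>E\<^esub> w \<and> w \<notin> H" if u: "u \<in> verts E" "u \<notin> H" for u
    proof -
      have "regular E u"
        using u sink_in_hereditary[OF H(1,3)] by (auto simp: regular_iff_not_sink)
      then obtain e where "e \<in> out_arcs E u" "head E e \<notin> H"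
        using H(2) u(2) unfolding saturated_def by blast
      then show ?thesis by (auto simp: arcs_ends_conv)
    qed
    then obtain f where f: "\<And>u. u \<in> verts E \<Longrightarrow> u \<notin> H \<Longrightarrow> u \<rightarrow>\<^bsub>E\<^esub> f u \<and> f u \<notin> H"
      by metis
    \<comment> \<open>Iterating the choice gives an infinite walk outside \<open>H\<close>, which
      must repeat one of the finitely many vertices.\<close>
    define g where "g n = (f ^^ n) v" for n
    have g: "g n \<in> verts E \<and> g n \<notin> H \<and> v \<rightarrow>\<^sup>*\<^bsub>E\<^esub> g n" for n
    proof (induction n)
      case 0 show ?case using v vH by (simp add: g_def)
    next
      case (Suc n)
      then have "g n \<rightarrow>\<^bsub>E\<^esub> g (Suc n)" "g (Suc n) \<notin> H" using f[of "g n"] by (auto simp: g_def)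
      with Suc show ?case using reachable_adj_trans reachable_in_verts(2) by blast
    qed
    have step: "g n \<rightarrow>\<^bsub>E\<^esub> g (Suc n)" for n
      using f[of "g n"] g[of n] by (simp add: g_def)
    have path: "g i \<rightarrow>\<^sup>+\<^bsub>E\<^esub> g j" if "i < j" for i j
      using that by (induction rule: less_Suc_induct) (auto intro: step trancl_trans)
    have "finite (range g)" using g by (intro finite_subset[OF _ finite_verts]) auto
    then have "\<not> inj g" using finite_imageD infinite_UNIV_nat by blast
    then obtain i j where "i < j" "g i = g j"
      unfolding inj_def by (metis linorder_neqE_nat)
    then have "g i \<rightarrow>\<^sup>+\<^bsub>E\<^esub> g i" using path by metis
    then obtain C where "C \<in> cyclic_components E" "g i \<in> verts C" by (rule ex_cyclic_component)
    then show False using * g by blast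
  qed
qed

text \<open>This is the right-hand side of \<open>hereditary_saturated_iff_components\<close> with
  \<open>verts C \<subseteq> H\<close> replaced by \<open>C \<in> F\<close>; it inverts the map from
  \<open>H\<close> to the set of cyclic components inside \<open>H\<close>.\<close>

definition filter_vertices :: "('v, 'e) pre_digraph set \<Rightarrow> 'v set" where
  "filter_vertices F =
    {v \<in> verts E. \<forall>C\<in>cyclic_components E. (\<exists>u\<in>verts C. v \<rightarrow>\<^sup>*\<^bsub>E\<^esub> u) \<longrightarrow> C \<in> F}"

lemma hereditary_saturated_of_filter:
  assumes F: "order_filter (cyclic_components E) (component_le E) F"
  shows "hereditary E (filter_vertices F)" "saturated E (filter_vertices F)" "filter_vertices F \<noteq> {}"
    "{C \<in> cyclic_components E. verts C \<subseteq> filter_vertices F} = F"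
proof -
  let ?H = "filter_vertices F"
  show "hereditary E ?H"
    unfolding hereditary_def
  proof (intro conjI ballI impI)
    fix e assume e: "e \<in> arcs E" "tail E e \<in> ?H"
    have "tail E e \<rightarrow>\<^bsub>E\<^esub> head E e" using e(1) by (rule in_arcs_imp_in_arcs_ends)
    then show "head E e \<in> ?H"
      using e unfolding filter_vertices_def by (auto dest: adj_reachable_trans)
  qed (auto simp: filter_vertices_def)
  \<comment> \<open>Even if \<open>v\<close> equals \<open>u\<close>, the closed walk through
    \<open>u\<close> gives a walk of positive length, which leaves \<open>v\<close> along an arc.
    This yields saturation and shows that the sink reaches no cyclic component.\<close>
  have succ: "\<exists>e\<in>out_arcs E v. head E e \<rightarrow>\<^sup>*\<^bsub>E\<^esub> u"
    if C: "C \<in> cyclic_components E" "u \<in> verts C" "v \<rightarrow>\<^sup>*\<^bsub>E\<^esub> u" for C u v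
  proof -
    have "v \<rightarrow>\<^sup>+\<^bsub>E\<^esub> u"
      using cyclic_component_loop[OF C(1,2)] C(3) reachable_reachable1_trans by blast
    then obtain w where w: "v \<rightarrow>\<^bsub>E\<^esub> w" "(w, u) \<in> (arcs_ends E)\<^sup>*" by (auto dest: tranclD)
    then have "w \<rightarrow>\<^sup>*\<^bsub>E\<^esub> u" using adj_in_verts(2) reachable_conv' by blast
    with w(1) show ?thesis by (auto simp: arcs_ends_conv)
  qed
  show "saturated E ?H"
    unfolding saturated_def
  proof (intro allI impI, elim conjE)
    fix v assume v: "regular E v" "head E ` out_arcs E v \<subseteq> ?H"
    have "C \<in> F" if C: "C \<in> cyclic_components E" "u \<in> verts C" "v \<rightarrow>\<^sup>*\<^bsub>E\<^esub> u" for C u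
      using succ[OF C] v(2) C(1,2) unfolding filter_vertices_def by blast
    then show "v \<in> ?H" using v(1) unfolding filter_vertices_def by (auto simp: regular_def)
  qed
  have "out_arcs E the_sink = {}"
    using is_sink_iff[of the_sink] by (simp add: is_sink_def)
  then have "the_sink \<in> ?H"
    using succ[of _ _ the_sink] sink_vert unfolding filter_vertices_def by blast
  then show "?H \<noteq> {}" by auto
  show "{C \<in> cyclic_components E. verts C \<subseteq> ?H} = F"
  proof (intro equalityI subsetI)
    fix C assume "C \<in> {C \<in> cyclic_components E. verts C \<subseteq> ?H}"
    then have C: "C \<in> cyclic_components E" "verts C \<subseteq> ?H" by auto
    then obtain v where v: "v \<in> verts C" "v \<in> ?H" using cyclic_component_verts(2) by blast
    then have "v \<rightarrow>\<^sup>*\<^bsub>E\<^esub> v" by (auto simp: filter_vertices_def)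
    then show "C \<in> F" using C(1) v unfolding filter_vertices_def by blast
  next
    fix C assume CF: "C \<in> F"
    then have C: "C \<in> cyclic_components E" using F by (auto simp: order_filter_def)
    have "v \<in> ?H" if v: "v \<in> verts C" for v
    proof -
      have "D \<in> F" if "D \<in> cyclic_components E" "u \<in> verts D" "v \<rightarrow>\<^sup>*\<^bsub>E\<^esub> u" for D u
        using F CF v that unfolding order_filter_def component_le_def by blast
      then show ?thesis
        using v cyclic_component_verts(3)[OF C] unfolding filter_vertices_def by blast
    qed
    then show "C \<in> {C \<in> cyclic_components E. verts C \<subseteq> ?H}" using C by auto
  qed
qed

lemma lattice_set_family:
  assumes "\<And>x y. x \<in> \<A> \<Longrightarrow> y \<in> \<A> \<Longrightarrow> x \<union> y \<in> \<A> \<and> x \<inter> y \<in> \<A>"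
  shows "lattice (order_of \<A> (\<subseteq>))"
proof -
  let ?L = "order_of \<A> (\<subseteq>)"
  interpret partial_order ?L
    by standard (auto simp: order_of_def)
  show ?thesis
  proof
    fix x y assume "x \<in> carrier ?L" "y \<in> carrier ?L"
    then have xy: "x \<in> \<A>" "y \<in> \<A>" by (simp_all add: order_of_def)
    show "\<exists>s. least ?L s (Upper ?L {x, y})"
      using assms[OF xy] by (intro exI[of _ "x \<union> y"]) (simp add: least_Upper_order_of xy)
    show "\<exists>s. greatest ?L s (Lower ?L {x, y})"
      using assms[OF xy] by (intro exI[of _ "x \<inter> y"]) (simp add: greatest_Lower_order_of xy)
  qed
qed

lemma lattice_filters: "lattice (filter_lattice E)"
  unfolding filter_lattice_def
  by (rule lattice_set_family) (auto simp: order_filter_def)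

lemma bij_betw_filter_vertices:
  "bij_betw filter_vertices {F. order_filter (cyclic_components E) (component_le E) F}
    {H. hereditary E H \<and> saturated E H \<and> H \<noteq> {}}"
proof (rule bij_betwI[where g = "\<lambda>H. {C \<in> cyclic_components E. verts C \<subseteq> H}"])
  show "filter_vertices {C \<in> cyclic_components E. verts C \<subseteq> H} = H"
    if "H \<in> {H. hereditary E H \<and> saturated E H \<and> H \<noteq> {}}" for H
  proof -
    have H: "hereditary E H" "saturated E H" "H \<noteq> {}" "H \<subseteq> verts E"
      using that by (simp_all add: hereditary_def)
    have "v \<in> filter_vertices {C \<in> cyclic_components E. verts C \<subseteq> H} \<longleftrightarrow> v \<in> H" if "v \<in> verts E" for v
      unfolding hereditary_saturated_iff_components[OF H(1-3) that] using that
      by (auto simp: filter_vertices_def)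
    then show ?thesis
      using H(4) by (auto simp: filter_vertices_def)
  qed
  show "(\<lambda>H. {C \<in> cyclic_components E. verts C \<subseteq> H}) \<in> {H. hereditary E H \<and> saturated E H \<and> H \<noteq> {}} \<rightarrow>
      {F. order_filter (cyclic_components E) (component_le E) F}"
  proof
    fix H assume H: "H \<in> {H. hereditary E H \<and> saturated E H \<and> H \<noteq> {}}"
    have "verts D \<subseteq> H" if D: "verts C \<subseteq> H" "D \<in> cyclic_components E" "component_le E C D" for C D
    proof
      fix w assume w: "w \<in> verts D"
      obtain u v where uv: "u \<in> verts C" "v \<in> verts D" "u \<rightarrow>\<^sup>*\<^bsub>E\<^esub> v"
        using D(3) by (auto simp: component_le_def)
      have "u \<rightarrow>\<^sup>*\<^bsub>E\<^esub> w"
        using reachable_trans[OF uv(3) cyclic_component_verts(4)[OF D(2) uv(2) w]] .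
      then show "w \<in> H" using hereditary_reachable H D(1) uv(1) by blast
    qed
    then show "{C \<in> cyclic_components E. verts C \<subseteq> H} \<in> {F. order_filter (cyclic_components E) (component_le E) F}"
      unfolding order_filter_def by blast
  qed
  show "filter_vertices \<in> {F. order_filter (cyclic_components E) (component_le E) F} \<rightarrow>
      {H. hereditary E H \<and> saturated E H \<and> H \<noteq> {}}"
    using hereditary_saturated_of_filter(1-3) by simp
qed (simp add: hereditary_saturated_of_filter(4))

lemma filters_iso_hereditary_saturated: "filter_lattice E \<cong>\<^sub>l hereditary_saturated_lattice E"
  unfolding filter_lattice_def hereditary_saturated_lattice_def
proof (rule lattice_isomorphic_orderI[OF lattice_filters[unfolded filter_lattice_def] bij_betw_filter_vertices])
  fix F F' assume F: "F \<in> {F. order_filter (cyclic_components E) (component_le E) F}"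
    "F' \<in> {F. order_filter (cyclic_components E) (component_le E) F}"
  show "F \<subseteq> F' \<longleftrightarrow> filter_vertices F \<subseteq> filter_vertices F'"
  proof
    assume "filter_vertices F \<subseteq> filter_vertices F'"
    then have "{C \<in> cyclic_components E. verts C \<subseteq> filter_vertices F} \<subseteq>
        {C \<in> cyclic_components E. verts C \<subseteq> filter_vertices F'}"
      by blast
    then show "F \<subseteq> F'" using hereditary_saturated_of_filter(4) F by simp
  next
    assume "F \<subseteq> F'"
    then show "filter_vertices F \<subseteq> filter_vertices F'" unfolding filter_vertices_def by blast
  qed
qed

end

section \<open>Idempotents and order-ideals\<close>

text \<open>By pigeonhole the powers of \<open>p\<close> have period \<open>d\<close> from the
  exponent \<open>i\<close> on. Any exponent that is a multiple of \<open>d\<close> and at least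
  \<open>i\<close> then gives an idempotent.\<close>

lemma (in monoid) ex_idempotent_power:
  assumes "finite (carrier G)" "p \<in> carrier G"
  obtains n :: nat where "n > 0" "p [^] n \<otimes> p [^] n = p [^] n"
proof -
  have "\<not> inj (\<lambda>n::nat. p [^] n)"
    using assms finite_subset[of "range (\<lambda>n::nat. p [^] n)" "carrier G"] finite_imageD infinite_UNIV_nat
    by auto
  then obtain i j :: nat where ij: "i < j" "p [^] i = p [^] j"
    unfolding inj_def by (metis linorder_neqE_nat)
  define d where "d = j - i"
  have step: "p [^] (m + d) = p [^] m" if "m \<ge> i" for m
  proof -
    have e: "m + d = j + (m - i)" using that ij(1) by (simp add: d_def)
    have "p [^] (m + d) = p [^] j \<otimes> p [^] (m - i)"
      unfolding e by (rule nat_pow_mult[OF assms(2), symmetric])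
    also have "\<dots> = p [^] i \<otimes> p [^] (m - i)" by (simp only: ij(2))
    also have "\<dots> = p [^] m" using that assms(2) by (simp add: nat_pow_mult)
    finally show ?thesis .
  qed
  have steps: "p [^] (m + c * d) = p [^] m" if "m \<ge> i" for m c
  proof (induction c)
    case (Suc c)
    have "p [^] (m + Suc c * d) = p [^] ((m + c * d) + d)" by (simp add: ac_simps)
    also have "\<dots> = p [^] (m + c * d)" using that by (intro step) simp
    finally show ?case using Suc by simp
  qed simp
  \<comment> \<open>The summand 1 keeps the exponent positive when \<open>i = 0\<close>.\<close>
  let ?n = "(i + 1) * d"
  have "d > 0" using ij by (simp add: d_def)
  then have "i \<le> ?n" "?n > 0" by (cases d; simp)+
  moreover have "p [^] ?n \<otimes> p [^] ?n = p [^] ?n"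
    using steps[OF \<open>i \<le> ?n\<close>, of "i + 1"] assms(2) by (simp add: nat_pow_mult)
  ultimately show thesis using that by blast
qed

text \<open>For an idempotent e, e divides f exactly if e f = f. Used in both directions, this gives
  e = f by commutativity.\<close>

lemma (in comm_monoid) idempotent_divides_antisym:
  assumes "e \<in> idempotents G" "f \<in> idempotents G" "e divides f" "f divides e"
  shows "e = f"
proof -
  obtain a b where ab: "a \<in> carrier G" "b \<in> carrier G" "f = e \<otimes> a" "e = f \<otimes> b"
    using assms(3,4) by (auto elim!: dividesE)
  have ef: "e \<in> carrier G" "f \<in> carrier G" "e \<otimes> e = e" "f \<otimes> f = f"
    using assms by (auto simp: idempotents_def)
  have "e \<otimes> f = f" using ab(1,3) ef m_assoc[of e e a] by simp
  moreover have "f \<otimes> e = e" using ab(2,4) ef m_assoc[of f f b] by simp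
  ultimately show ?thesis using m_comm[of e f] ef by simp
qed

text \<open>If x and y divide e, then x y divides e e, and idempotency brings this back to
  e.\<close>

lemma (in comm_monoid) order_ideal_divisors:
  assumes "e \<in> idempotents G"
  shows "order_ideal {x \<in> carrier G. x divides e} G"
  unfolding order_ideal_def
proof (intro conjI ballI impI)
  have e: "e \<in> carrier G" "e \<otimes> e = e" using assms by (auto simp: idempotents_def)
  show "submonoid {x \<in> carrier G. x divides e} G"
  proof
    show "\<one> \<in> {x \<in> carrier G. x divides e}" using e by (auto intro: dividesI[of e])
    fix x y assume "x \<in> {x \<in> carrier G. x divides e}" "y \<in> {x \<in> carrier G. x divides e}"
    then obtain a b where xy: "x \<in> carrier G" "y \<in> carrier G" "a \<in> carrier G" "b \<in> carrier G"
      "e = x \<otimes> a" "e = y \<otimes> b"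
      by (auto elim!: dividesE)
    then have "e = (x \<otimes> y) \<otimes> (a \<otimes> b)" using e(2) by (simp add: m_ac)
    then show "x \<otimes> y \<in> {x \<in> carrier G. x divides e}" using xy by (auto intro: dividesI)
  qed auto
  fix x y assume xy: "x \<in> carrier G" "y \<in> carrier G" "x \<otimes> y \<in> {x \<in> carrier G. x divides e}"
  then obtain a where a: "a \<in> carrier G" "e = (x \<otimes> y) \<otimes> a" by (auto elim!: dividesE)
  have "e = x \<otimes> (y \<otimes> a)" "e = y \<otimes> (x \<otimes> a)" using a xy by (simp_all add: m_ac)
  then show "x \<in> {x \<in> carrier G. x divides e}" "y \<in> {x \<in> carrier G. x divides e}"
    using a(1) xy(1,2) m_closed unfolding factor_def by blast+
qed

text \<open>Being finite, \<open>I\<close> contains a common multiple \<open>p\<close> of all its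
  elements. An idempotent power of \<open>p\<close> is still a common multiple, because its exponent
  is positive.\<close>

lemma (in comm_monoid) finite_order_ideal_divisors:
  assumes fin: "finite (carrier G)" and I: "order_ideal I G"
  obtains e where "e \<in> idempotents G" "I = {x \<in> carrier G. x divides e}"
proof -
  interpret I: submonoid I G using I by (simp add: order_ideal_def)
  have "\<exists>p\<in>I. \<forall>x\<in>A. x divides p" if "finite A" "A \<subseteq> I" for A
    using that
  proof induction
    case empty then show ?case using I.one_closed by blast
  next
    case (insert y A)
    then obtain p where p: "p \<in> I" "\<forall>x\<in>A. x divides p" by auto
    have "x divides y \<otimes> p" if "x \<in> insert y A" for x
      using that insert(4) p I.mem_carrier divides_prod_l[of x p y] by (auto intro: dividesI)
    then show ?case using insert(4) p(1) I.m_closed by blast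
  qed
  from this[of I] obtain p where p: "p \<in> I" "\<forall>x\<in>I. x divides p"
    using fin I.subset finite_subset by blast
  then obtain n :: nat where n: "n > 0" "p [^] n \<otimes> p [^] n = p [^] n"
    using ex_idempotent_power[OF fin] I.mem_carrier by blast
  have pc: "p \<in> carrier G" using p(1) I.mem_carrier by blast
  have "p divides p [^] n" using n(1) pc
    by (cases n) (auto intro: dividesI simp: m_comm)
  then have "x divides p [^] n" if "x \<in> I" for x
    using that p(2) I.mem_carrier divides_trans by blast
  moreover have e: "p [^] n \<in> I"
    by (induction n) (simp_all add: I.m_closed I.one_closed p(1))
  moreover have "x \<in> I" if x: "x \<in> carrier G" "x divides p [^] n" for x
  proof -
    obtain c where c: "c \<in> carrier G" "p [^] n = x \<otimes> c" using x(2) by (rule dividesE)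
    have "x \<otimes> c \<in> I" using e unfolding c(2) .
    with I x(1) c(1) show ?thesis unfolding order_ideal_def by blast
  qed
  ultimately have "I = {x \<in> carrier G. x divides p [^] n}" using I.mem_carrier by blast
  moreover have "p [^] n \<in> idempotents G" using n(2) pc by (simp add: idempotents_def)
  ultimately show thesis using that by blast
qed

lemma (in comm_monoid) order_ideals_iso_idempotents:
  assumes "finite (carrier G)" "lattice (order_ideal_lattice G)"
  shows "idempotent_lattice G \<cong>\<^sub>l order_ideal_lattice G"
proof -
  let ?D = "\<lambda>e. {x \<in> carrier G. x divides e}"
  have c: "e \<in> ?D e" if "e \<in> idempotents G" for e
    using that by (auto simp: idempotents_def)
  have le: "e divides f \<longleftrightarrow> ?D e \<subseteq> ?D f" if "e \<in> idempotents G" "f \<in> idempotents G" for e f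
    using c that by (auto intro: divides_trans)
  have bij: "bij_betw ?D (idempotents G) {I. order_ideal I G}"
  proof (rule bij_betw_imageI)
    show "inj_on ?D (idempotents G)"
    proof (rule inj_onI)
      fix e f assume ef: "e \<in> idempotents G" "f \<in> idempotents G" "?D e = ?D f"
      then show "e = f" using le[OF ef(1,2)] le[OF ef(2,1)] idempotent_divides_antisym by simp
    qed
    show "?D ` idempotents G = {I. order_ideal I G}"
    proof (intro equalityI subsetI)
      fix I assume "I \<in> {I. order_ideal I G}"
      then have I: "order_ideal I G" by simp
      show "I \<in> ?D ` idempotents G"
        by (rule finite_order_ideal_divisors[OF assms(1) I]) (rule image_eqI)
    qed (use order_ideal_divisors in auto)
  qed
  show ?thesis
    unfolding order_ideal_lattice_def idempotent_lattice_def
    using assms(2)[unfolded order_ideal_lattice_def] bij le by (rule lattice_isomorphic_orderI')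
qed

section \<open>The sandpile monoid\<close>

context sandpile_graph
begin

abbreviation sandpile_class :: "'v multiset \<Rightarrow> 'v multiset set" where
  "sandpile_class M \<equiv> sandpile_cong E `` {M}"

lemma carrier_sandpile: "carrier (sandpile_monoid E) = sandpile_class ` free_cmonoid E"
  by (auto simp: sandpile_monoid_def quotient_def)

lemma sandpile_class_add:
  "M \<in> free_cmonoid E \<Longrightarrow> N \<in> free_cmonoid E \<Longrightarrow>
    sandpile_class M \<otimes>\<^bsub>sandpile_monoid E\<^esub> sandpile_class N = sandpile_class (M + N)"
  by (simp add: sandpile_monoid_def
      quotient_op_class[OF equiv_sandpile_cong[OF fin_digraph_this] sandpile_cong.add])

lemma sandpile_class_eq_iff:
  "M \<in> free_cmonoid E \<Longrightarrow> N \<in> free_cmonoid E \<Longrightarrow>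
    sandpile_class M = sandpile_class N \<longleftrightarrow> (M, N) \<in> sandpile_cong E"
  using eq_equiv_class_iff[OF equiv_sandpile_cong[OF fin_digraph_this]] by blast

lemma sandpile_one: "\<one>\<^bsub>sandpile_monoid E\<^esub> = sandpile_class {#}"
  by (simp add: sandpile_monoid_def)

lemma comm_monoid_sandpile: "comm_monoid (sandpile_monoid E)"
  by (rule comm_monoid_sandpile_monoid[OF fin_digraph_this])

lemma topple_eq:
  assumes "v \<in> verts E" "v \<noteq> the_sink"
  shows "sandpile_class (replicate_mset (card (out_arcs E v)) v) =
    sandpile_class (image_mset (head E) (mset_set (out_arcs E v)))"
  using sandpile_cong.topple[OF assms(1)] assms(2) equiv_sandpile_cong[OF fin_digraph_this]
  by (intro equiv_class_eq) (auto simp: is_sink_iff)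

lemma sandpile_cong_support:
  assumes "(M, N) \<in> sandpile_cong E" and H: "hereditary E H" "saturated E H" "H \<noteq> {}"
  shows "set_mset M \<subseteq> H \<longleftrightarrow> set_mset N \<subseteq> H"
  using assms(1)
proof induction
  case (sink s)
  then show ?case using sink_in_hereditary[OF H(1,3)] by (simp add: is_sink_iff)
next
  case (topple v)
  \<comment> \<open>A vertex other than the sink emits an edge, so the multiplicity is positive and
    the left side of the relation really has support \<open>{v}\<close>.\<close>
  have "out_arcs E v \<noteq> {}" using topple by (auto simp: is_sink_def)
  then have "set_mset (replicate_mset (card (out_arcs E v)) v) = {v}"
    by (simp add: finite_out_arcs card_gt_0_iff)
  moreover have "head E ` out_arcs E v \<subseteq> H \<longleftrightarrow> v \<in> H"
  proof
    show "v \<in> H" if "head E ` out_arcs E v \<subseteq> H"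
      using that H(2) topple regular_iff_not_sink is_sink_iff unfolding saturated_def by blast
    show "head E ` out_arcs E v \<subseteq> H" if "v \<in> H"
      using that H(1) by (auto simp: hereditary_def)
  qed
  ultimately show ?case by (simp add: finite_out_arcs)
qed auto

definition support_ideal :: "'v set \<Rightarrow> 'v multiset set set" where
  "support_ideal H = {sandpile_class M | M. set_mset M \<subseteq> H}"

lemma class_in_support_ideal:
  assumes H: "hereditary E H" "saturated E H" "H \<noteq> {}" and M: "M \<in> free_cmonoid E"
  shows "sandpile_class M \<in> support_ideal H \<longleftrightarrow> set_mset M \<subseteq> H"
proof
  assume "sandpile_class M \<in> support_ideal H"
  then obtain N where N: "sandpile_class M = sandpile_class N" "set_mset N \<subseteq> H"
    by (auto simp: support_ideal_def)
  have "N \<in> free_cmonoid E" using N(2) H(1) by (auto simp: free_cmonoid_def hereditary_def)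
  then have "(M, N) \<in> sandpile_cong E" using N(1) sandpile_class_eq_iff[OF M] by simp
  then show "set_mset M \<subseteq> H" using sandpile_cong_support[OF _ H] N(2) by blast
qed (auto simp: support_ideal_def)

lemma order_ideal_support_ideal:
  assumes H: "hereditary E H" "saturated E H" "H \<noteq> {}"
  shows "order_ideal (support_ideal H) (sandpile_monoid E)"
proof -
  have sub: "M \<in> free_cmonoid E" if "set_mset M \<subseteq> H" for M
    using that H(1) by (auto simp: free_cmonoid_def hereditary_def)
  show ?thesis
    unfolding order_ideal_def
  proof (intro conjI ballI impI)
    show "submonoid (support_ideal H) (sandpile_monoid E)"
    proof
      show "support_ideal H \<subseteq> carrier (sandpile_monoid E)"
        using sub by (auto simp: support_ideal_def carrier_sandpile)
      show "\<one>\<^bsub>sandpile_monoid E\<^esub> \<in> support_ideal H"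
        unfolding sandpile_one support_ideal_def by (intro CollectI exI[of _ "{#}"]) simp
      fix x y assume "x \<in> support_ideal H" "y \<in> support_ideal H"
      then obtain M N where "x = sandpile_class M" "set_mset M \<subseteq> H" "y = sandpile_class N" "set_mset N \<subseteq> H"
        by (auto simp: support_ideal_def)
      then show "x \<otimes>\<^bsub>sandpile_monoid E\<^esub> y \<in> support_ideal H"
        using sandpile_class_add[OF sub sub] unfolding support_ideal_def
        by (intro CollectI exI[of _ "M + N"]) simp
    qed
    fix x y assume "x \<in> carrier (sandpile_monoid E)" "y \<in> carrier (sandpile_monoid E)"
      and xy: "x \<otimes>\<^bsub>sandpile_monoid E\<^esub> y \<in> support_ideal H"
    then obtain M N where MN: "x = sandpile_class M" "y = sandpile_class N"
      "M \<in> free_cmonoid E" "N \<in> free_cmonoid E"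
      by (auto simp: carrier_sandpile)
    then have "M + N \<in> free_cmonoid E" by (simp add: free_cmonoid_def)
    then have "set_mset (M + N) \<subseteq> H"
      using xy class_in_support_ideal[OF H] MN by (simp add: sandpile_class_add)
    then show "x \<in> support_ideal H" "y \<in> support_ideal H"
      using MN class_in_support_ideal[OF H] by simp_all
  qed
qed

definition ideal_support :: "'v multiset set set \<Rightarrow> 'v set" where
  "ideal_support I = {v \<in> verts E. sandpile_class {#v#} \<in> I}"

text \<open>A sum lies in an order-ideal exactly when both summands do, so an order-ideal is
  determined by the generators it contains.\<close>

lemma class_in_order_ideal:
  assumes I: "order_ideal I (sandpile_monoid E)" and M: "M \<in> free_cmonoid E"
  shows "sandpile_class M \<in> I \<longleftrightarrow> set_mset M \<subseteq> ideal_support I"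
  using M
proof (induction M)
  case empty
  have "\<one>\<^bsub>sandpile_monoid E\<^esub> \<in> I" using I submonoid.one_closed by (auto simp: order_ideal_def)
  then show ?case by (simp add: sandpile_one)
next
  case (add v M)
  then have v: "v \<in> verts E" "{#v#} \<in> free_cmonoid E" and M: "M \<in> free_cmonoid E"
    by (auto simp: free_cmonoid_def)
  have c: "sandpile_class {#v#} \<in> carrier (sandpile_monoid E)" "sandpile_class M \<in> carrier (sandpile_monoid E)"
    using v M by (auto simp: carrier_sandpile)
  have "sandpile_class (add_mset v M) = sandpile_class {#v#} \<otimes>\<^bsub>sandpile_monoid E\<^esub> sandpile_class M"
    using v M by (simp add: sandpile_class_add)
  also have "\<dots> \<in> I \<longleftrightarrow> sandpile_class {#v#} \<in> I \<and> sandpile_class M \<in> I"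
  proof
    show "sandpile_class {#v#} \<in> I \<and> sandpile_class M \<in> I"
      if "sandpile_class {#v#} \<otimes>\<^bsub>sandpile_monoid E\<^esub> sandpile_class M \<in> I"
      using that I c unfolding order_ideal_def by blast
  qed (use I in \<open>simp add: order_ideal_def submonoid.m_closed\<close>)
  finally show ?case using add.IH[OF M] v by (simp add: ideal_support_def)
qed

lemma hereditary_saturated_ideal_support:
  assumes I: "order_ideal I (sandpile_monoid E)"
  shows "hereditary E (ideal_support I)" "saturated E (ideal_support I)" "ideal_support I \<noteq> {}"
proof -
  \<comment> \<open>Both sides of the toppling relation are the same class. The two directions are
    heredity and saturation at \<open>v\<close>.\<close>
  have iff: "v \<in> ideal_support I \<longleftrightarrow> head E ` out_arcs E v \<subseteq> ideal_support I" if v: "v \<in> verts E" "v \<noteq> the_sink" for v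
  proof -
    have "out_arcs E v \<noteq> {}" using v is_sink_iff[of v] by (simp add: is_sink_def)
    then have s: "set_mset (replicate_mset (card (out_arcs E v)) v) = {v}"
      by (simp add: finite_out_arcs card_gt_0_iff)
    then have f: "replicate_mset (card (out_arcs E v)) v \<in> free_cmonoid E"
      "image_mset (head E) (mset_set (out_arcs E v)) \<in> free_cmonoid E"
      using v by (auto simp: free_cmonoid_def finite_out_arcs)
    show ?thesis
      using class_in_order_ideal[OF I f(1)] class_in_order_ideal[OF I f(2)] topple_eq[OF v] s
      by (simp add: finite_out_arcs)
  qed
  show "hereditary E (ideal_support I)"
    unfolding hereditary_def
  proof (intro conjI ballI impI)
    fix e assume e: "e \<in> arcs E" "tail E e \<in> ideal_support I"
    then have "e \<in> out_arcs E (tail E e)" by simp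
    moreover from this have "tail E e \<noteq> the_sink" using is_sink_iff[of "tail E e"] by (auto simp: is_sink_def)
    ultimately show "head E e \<in> ideal_support I" using iff[of "tail E e"] e by auto
  qed (auto simp: ideal_support_def)
  show "saturated E (ideal_support I)"
    unfolding saturated_def using iff regular_iff_not_sink by blast
  have "sandpile_class {#the_sink#} = sandpile_class {#}"
    using sandpile_cong.sink[of E the_sink] equiv_sandpile_cong[OF fin_digraph_this]
    by (intro equiv_class_eq) (auto simp: is_sink_iff)
  then have "sandpile_class {#the_sink#} \<in> I"
    using class_in_order_ideal[OF I, of "{#}"] by (simp add: free_cmonoid_def)
  then show "ideal_support I \<noteq> {}" using sink_vert by (auto simp: ideal_support_def)
qed

lemma singleton_free: "v \<in> verts E \<Longrightarrow> {#v#} \<in> free_cmonoid E"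
  by (simp add: free_cmonoid_def)

lemma ideal_support_support_ideal:
  assumes "hereditary E H" "saturated E H" "H \<noteq> {}"
  shows "ideal_support (support_ideal H) = H"
proof -
  have "H \<subseteq> verts E" using assms(1) by (simp add: hereditary_def)
  then show ?thesis
    using class_in_support_ideal[OF assms singleton_free] unfolding ideal_support_def by auto
qed

lemma support_ideal_ideal_support:
  assumes I: "order_ideal I (sandpile_monoid E)"
  shows "support_ideal (ideal_support I) = I"
proof -
  note H = hereditary_saturated_ideal_support[OF I]
  have "submonoid I (sandpile_monoid E)" "submonoid (support_ideal (ideal_support I)) (sandpile_monoid E)"
    using I order_ideal_support_ideal[OF H] by (auto simp: order_ideal_def)
  then have c: "I \<subseteq> sandpile_class ` free_cmonoid E"
      "support_ideal (ideal_support I) \<subseteq> sandpile_class ` free_cmonoid E"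
    unfolding carrier_sandpile[symmetric] by (simp_all add: submonoid.subset)
  have "sandpile_class M \<in> support_ideal (ideal_support I) \<longleftrightarrow> sandpile_class M \<in> I" if "M \<in> free_cmonoid E" for M
    using class_in_support_ideal[OF H that] class_in_order_ideal[OF I that] by simp
  then show ?thesis using c by blast
qed

lemma hereditary_saturated_iso_order_ideals:
  assumes "lattice (hereditary_saturated_lattice E)"
  shows "hereditary_saturated_lattice E \<cong>\<^sub>l order_ideal_lattice (sandpile_monoid E)"
  unfolding hereditary_saturated_lattice_def order_ideal_lattice_def
proof (rule lattice_isomorphic_orderI[OF assms[unfolded hereditary_saturated_lattice_def]])
  show "bij_betw support_ideal {H. hereditary E H \<and> saturated E H \<and> H \<noteq> {}}
      {I. order_ideal I (sandpile_monoid E)}"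
    by (rule bij_betwI[where g = ideal_support])
      (use order_ideal_support_ideal hereditary_saturated_ideal_support in
        \<open>simp_all add: ideal_support_support_ideal support_ideal_ideal_support\<close>)
next
  fix H H' assume H: "H \<in> {H. hereditary E H \<and> saturated E H \<and> H \<noteq> {}}"
    "H' \<in> {H. hereditary E H \<and> saturated E H \<and> H \<noteq> {}}"
  show "H \<subseteq> H' \<longleftrightarrow> support_ideal H \<subseteq> support_ideal H'"
  proof
    assume "support_ideal H \<subseteq> support_ideal H'"
    then have "ideal_support (support_ideal H) \<subseteq> ideal_support (support_ideal H')"
      unfolding ideal_support_def by blast
    then show "H \<subseteq> H'" using H by (simp add: ideal_support_support_ideal)
  qed (auto simp: support_ideal_def)
qed

section \<open>Finiteness of the sandpile monoid\<close>

definition sink_distance :: "'v \<Rightarrow> nat" where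
  "sink_distance v = (LEAST n. (v, the_sink) \<in> arcs_ends E ^^ n)"

lemma ex_closer_arc:
  assumes "v \<in> verts E" "v \<noteq> the_sink"
  obtains e where "e \<in> out_arcs E v" "sink_distance (head E e) < sink_distance v"
proof -
  have "(v, the_sink) \<in> (arcs_ends E)\<^sup>*"
    using reaches_the_sink[OF assms(1)] unfolding reachable_conv'[OF assms(1)] .
  then obtain m where "(v, the_sink) \<in> arcs_ends E ^^ m" by (auto simp: rtrancl_power)
  then have d: "(v, the_sink) \<in> arcs_ends E ^^ sink_distance v"
    unfolding sink_distance_def by (rule LeastI)
  then obtain n where n: "sink_distance v = Suc n" using assms(2) by (cases "sink_distance v") auto
  obtain w where w: "(v, w) \<in> arcs_ends E" "(w, the_sink) \<in> arcs_ends E ^^ n"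
    using d unfolding n by (meson relpow_Suc_D2)
  have "sink_distance w \<le> n" unfolding sink_distance_def using w(2) by (rule Least_le)
  with w(1) n show thesis by (auto simp: arcs_ends_conv intro: that)
qed

text \<open>
  The base exceeds every out-degree, so the drop along one arc towards the sink outweighs the
  possible gain along all other arcs with the same tail.
\<close>

definition potential :: "'v \<Rightarrow> int" where
  "potential v =
    (let B = int (card (arcs E)) + 1; N = Max (sink_distance ` verts E)
     in 1 + B ^ N - B ^ (N - sink_distance v))"

text \<open>Truncated subtraction keeps the exponent at most \<open>N\<close>. The summand 1 in
  \<open>potential\<close> makes the removal of a grain at the sink a strict decrease as
  well.\<close>

lemma potential_pos: "1 \<le> potential v"
  unfolding potential_def Let_def by (simp add: power_increasing)

text \<open>Let D be the out-degree of v and x = B^(N - sink_distance v). One head is closer to the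
  sink and has potential at most 1 + B^N - B x; the other D - 1 arcs contribute at most B^N each.
  Since B \<ge> D + 1 and x \<ge> 1, the sum is at most D B^N - D x, which is less than D (1 + B^N -
  x).\<close>

lemma potential_topple:
  assumes v: "v \<in> verts E" "v \<noteq> the_sink"
  shows "(\<Sum>e\<in>out_arcs E v. potential (head E e)) < int (card (out_arcs E v)) * potential v"
proof -
  define B where "B = int (card (arcs E)) + 1"
  define N where "N = Max (sink_distance ` verts E)"
  define D where "D = int (card (out_arcs E v))"
  have pot: "potential u = 1 + B ^ N - B ^ (N - sink_distance u)" for u
    by (simp add: potential_def Let_def B_def N_def)
  have B: "B \<ge> 1" by (simp add: B_def)
  have N: "sink_distance v \<le> N" unfolding N_def using v(1) by (intro Max_ge) auto
  obtain f where f: "f \<in> out_arcs E v" "sink_distance (head E f) < sink_distance v"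
    using ex_closer_arc[OF v] .
  then have "card (out_arcs E v) > 0" using finite_out_arcs[of v] card_gt_0_iff by blast
  then have D: "D \<ge> 1" by (simp add: D_def)
  have "card (out_arcs E v) \<le> card (arcs E)" by (intro card_mono) auto
  then have DB: "D + 1 \<le> B" by (simp add: D_def B_def)
  let ?x = "B ^ (N - sink_distance v)"
  have x: "?x \<ge> 1" using B by simp
  have "B * ?x = B ^ Suc (N - sink_distance v)" by simp
  also have "\<dots> \<le> B ^ (N - sink_distance (head E f))"
    using f(2) N B by (intro power_increasing) auto
  finally have pf: "potential (head E f) \<le> 1 + B ^ N - B * ?x" by (simp add: pot)
  have "(\<Sum>e\<in>out_arcs E v. potential (head E e)) =
      potential (head E f) + (\<Sum>e\<in>out_arcs E v - {f}. potential (head E e))"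
    using f(1) by (intro sum.remove) (auto simp: finite_out_arcs)
  also have "(\<Sum>e\<in>out_arcs E v - {f}. potential (head E e)) \<le> (\<Sum>e\<in>out_arcs E v - {f}. B ^ N)"
    using B by (intro sum_mono) (simp add: pot)
  also have "\<dots> = (D - 1) * B ^ N"
    using f(1) D by (simp add: card_Diff_singleton of_nat_diff D_def)
  finally have "(\<Sum>e\<in>out_arcs E v. potential (head E e)) \<le> 1 + D * B ^ N - B * ?x"
    using pf by (simp add: left_diff_distrib)
  moreover have "(D + 1) * ?x \<le> B * ?x" using DB x by (intro mult_right_mono) auto
  moreover have "D * potential v = D + D * B ^ N - D * ?x"
    by (simp add: pot algebra_simps)
  ultimately show ?thesis using x D unfolding D_def[symmetric] by (simp add: algebra_simps)
qed

text \<open>The bound is weak, unlike the usual strict one, so that at the sink, of out-degree 0, it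
  says that there are no grains. A violation always permits a toppling or a removal at the
  sink.\<close>

definition stable :: "'v multiset \<Rightarrow> bool" where
  "stable M \<longleftrightarrow> M \<in> free_cmonoid E \<and> (\<forall>v\<in>verts E. count M v \<le> card (out_arcs E v))"

lemma stabilization:
  assumes "M \<in> free_cmonoid E"
  shows "\<exists>N. stable N \<and> (M, N) \<in> sandpile_cong E"
  using assms
proof (induction "nat (\<Sum>v\<in>#M. potential v)" arbitrary: M rule: less_induct)
  case less
  show ?case
  proof (cases "stable M")
    case True
    then show ?thesis using less.prems sandpile_cong.refl by blast
  next
    case False
    then obtain v where v: "v \<in> verts E" "count M v > card (out_arcs E v)"
      using less.prems by (auto simp: stable_def not_le)
    let ?A = "if v = the_sink then {#v#} else replicate_mset (card (out_arcs E v)) v"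
    let ?B = "if v = the_sink then {#} else image_mset (head E) (mset_set (out_arcs E v))"
    have "?A \<subseteq># M" using v(2) by (auto simp: subseteq_mset_def simp flip: count_greater_zero_iff)
    have M: "M = (M - ?A) + ?A" using \<open>?A \<subseteq># M\<close> by simp
    have free: "M - ?A \<in> free_cmonoid E"
      using less.prems by (auto simp: free_cmonoid_def dest: in_diffD)
    have AB: "(?A, ?B) \<in> sandpile_cong E"
      using sandpile_cong.sink[of E v] sandpile_cong.topple[OF v(1)] by (auto simp: is_sink_iff)
    have "(M, (M - ?A) + ?B) \<in> sandpile_cong E"
      using sandpile_cong.add[OF sandpile_cong.refl[OF free] AB] M by simp
    moreover from this have fB: "(M - ?A) + ?B \<in> free_cmonoid E"
      using sandpile_cong_subset[OF fin_digraph_this] by blast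
    \<comment> \<open>Since \<open>nat\<close> truncates, the lower bound 0 is what carries the
      strict drop of the integer sum over to \<open>nat\<close>.\<close>
    have pos: "(\<Sum>v\<in>#K. potential v) \<ge> 0" for K
    proof (induction K)
      case (add x K) then show ?case using potential_pos[of x] by simp
    qed simp
    have "(\<Sum>v\<in>#?B. potential v) < (\<Sum>v\<in>#?A. potential v)"
      using potential_pos[of v] potential_topple[OF v(1)]
      by (cases "v = the_sink") (simp_all add: image_mset.compositionality comp_def sum_unfold_sum_mset)
    then have "(\<Sum>v\<in>#(M - ?A) + ?B. potential v) < (\<Sum>v\<in>#(M - ?A) + ?A. potential v)"
      by simp
    then have "nat (\<Sum>v\<in>#(M - ?A) + ?B. potential v) < nat (\<Sum>v\<in>#M. potential v)"
      using M pos[of "(M - ?A) + ?B"] by simp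
    from less.hyps[OF this fB] obtain N where "stable N" "((M - ?A) + ?B, N) \<in> sandpile_cong E" by blast
    ultimately show ?thesis using sandpile_cong.trans by blast
  qed
qed

lemma finite_stable: "finite {M. stable M}"
proof (rule finite_imageD)
  let ?f = "\<lambda>M. restrict (count M) (verts E)"
  have "?f ` {M. stable M} \<subseteq> (\<Pi>\<^sub>E v\<in>verts E. {..card (out_arcs E v)})"
    by (auto simp: stable_def)
  then show "finite (?f ` {M. stable M})"
    by (rule finite_subset) (intro finite_PiE, auto)
  show "inj_on ?f {M. stable M}"
  proof (rule inj_onI, rule multiset_eqI)
    fix M N v assume MN: "M \<in> {M. stable M}" "N \<in> {M. stable M}" "?f M = ?f N"
    show "count M v = count N v"
    proof (cases "v \<in> verts E")
      case True
      then show ?thesis using fun_cong[OF MN(3), of v] by simp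
    next
      case False
      then have "v \<notin># M" "v \<notin># N" using MN by (auto simp: stable_def free_cmonoid_def)
      then show ?thesis by (simp add: not_in_iff)
    qed
  qed
qed

lemma finite_sandpile: "finite (carrier (sandpile_monoid E))"
proof (rule finite_subset)
  show "carrier (sandpile_monoid E) \<subseteq> sandpile_class ` {M. stable M}"
  proof
    fix x assume "x \<in> carrier (sandpile_monoid E)"
    then obtain M where M: "x = sandpile_class M" "M \<in> free_cmonoid E" by (auto simp: carrier_sandpile)
    then obtain N where N: "stable N" "(M, N) \<in> sandpile_cong E" using stabilization by blast
    then have "x = sandpile_class N"
      using M equiv_class_eq[OF equiv_sandpile_cong[OF fin_digraph_this]] by blast
    then show "x \<in> sandpile_class ` {M. stable M}" using N(1) by blast
  qed
qed (simp add: finite_stable)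

end

theorem theorem4p4:
  fixes E :: "('v, 'e) pre_digraph"
  assumes "sandpile_graph E"
  shows "idempotent_lattice (sandpile_monoid E) \<cong>\<^sub>l filter_lattice E
    \<and> filter_lattice E \<cong>\<^sub>l hereditary_saturated_lattice E
    \<and> hereditary_saturated_lattice E \<cong>\<^sub>l order_ideal_lattice (sandpile_monoid E)
    \<and> order_ideal_lattice (sandpile_monoid E) \<cong>\<^sub>l graded_ideal_lattice TYPE('k::field) E
    \<and> graded_ideal_lattice TYPE('k) E \<cong>\<^sub>l vertex_ideal_lattice TYPE('k) E (balanced_weight E)"
proof -
  interpret sandpile_graph E by fact
  interpret U: unweighted E by unfold_locales
  \<comment> \<open>Balanced weights depend only on the source, so the maximum at a vertex is their
    common value.\<close>
  interpret W: constant_weight E "balanced_weight E"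
  proof
    fix e assume e: "e \<in> arcs E"
    then have ne: "out_arcs E (tail E e) \<noteq> {}" by auto
    have "balanced_weight E ` out_arcs E (tail E e) = {card (out_arcs E (tail E e))}"
      using ne by (auto simp: balanced_weight_def)
    then show "balanced_weight E e = vertex_weight E (balanced_weight E) (tail E e)"
      by (simp add: vertex_weight_def balanced_weight_def)
    show "1 \<le> balanced_weight E e"
      using ne finite_out_arcs[of "tail E e"] card_gt_0_iff[of "out_arcs E (tail E e)"]
      by (simp add: balanced_weight_def Suc_le_eq)
  qed
  interpret SP: comm_monoid "sandpile_monoid E" by (rule comm_monoid_sandpile)
  note filters = filters_iso_hereditary_saturated
  have lat: "lattice (hereditary_saturated_lattice E)"
    using filters by (simp add: lattice_isomorphic_def)
  note order_ideals = hereditary_saturated_iso_order_ideals[OF lat]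
  have "lattice (order_ideal_lattice (sandpile_monoid E))"
    using order_ideals by (simp add: lattice_isomorphic_def)
  note idempotents = SP.order_ideals_iso_idempotents[OF finite_sandpile this]
  note graded = U.hereditary_saturated_iso_graded_ideals[OF lat is_sink_iff sink_vert, of "TYPE('k)"]
  note vertex = W.hereditary_saturated_iso_vertex_ideals[OF lat, of "TYPE('k)"]
  have "idempotent_lattice (sandpile_monoid E) \<cong>\<^sub>l filter_lattice E"
    using lattice_isomorphic_trans[OF idempotents lattice_isomorphic_sym[OF order_ideals]]
      lattice_isomorphic_sym[OF filters] by (rule lattice_isomorphic_trans)
  moreover have "order_ideal_lattice (sandpile_monoid E) \<cong>\<^sub>l graded_ideal_lattice TYPE('k) E"
    using lattice_isomorphic_sym[OF order_ideals] graded by (rule lattice_isomorphic_trans)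
  moreover have "graded_ideal_lattice TYPE('k) E \<cong>\<^sub>l vertex_ideal_lattice TYPE('k) E (balanced_weight E)"
    using lattice_isomorphic_sym[OF graded] vertex by (rule lattice_isomorphic_trans)
  ultimately show ?thesis using filters order_ideals by blast
qed

end
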